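(* Fix $L\in\mathbb{N}$, $\eta\in[0,1/L)$ and $\delta>0$. For $\mathbb{P}$-a.e. $\xi$ there exists a subsequence $(t_k^{\delta,\eta}(\xi))_{k\in\mathbb{N}}$ of $\mathbb{N}_{L,\eta}$ with $$\limsup_{k\to\infty}\frac{t_k^{\delta,\eta}(\xi)}{k}\le\frac{1+\delta}{L}$$ such that $\big(M_{t_k^{\delta,\eta}(\xi)}-E^\xi[M_{t_k^{\delta,\eta}(\xi)}]\big)_{k\in\mathbb{N}}$ is tight with respect to $P^\xi$.
   Context: Branching random walk in random environment (BRWRE). Let $(\xi(x))_{x\in\mathbb{Z}}$ be an i.i.d. collection of random variables on a probability space $(\Omega,\mathcal{F},\mathbb{P})$ with $0<\mathrm{ei}:=\operatorname{ess\,inf}\xi(0)<\operatorname{ess\,sup}\xi(0)=:\mathrm{es}<\infty$. Given a realization of $\xi$, start with one particle at site $0$. All particles move independently according to a continuous-time simple (symmetric nearest-neighbour) random walk on $\mathbb{Z}$ with jump rate $1$. While at site $x$, a particle splits into two at rate $\xi(x)$, independently of everything else; the resulting particles then evolve independently according to the same mechanism. $P^\xi$, $E^\xi$ (quenched law and expectation) denote the law of this process given $\xi$ and the corresponding expectation. $N(t)$ is the set of particles alive at time $t$; for $Y\in N(t)$, $(Y_s)_{s\in[0,t]}$ is the trajectory of the particle and its ancestors up to time $t$. $M_t:=\max_{Y\in N(t)}Y_t$. $\mathbb{N}=\{1,2,\dots\}$ and $\mathbb{N}_{L,\eta}:=\mathbb{N}/L+\eta=\{k/L+\eta:k\in\mathbb{N}\}$.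 A subsequence of $\mathbb{N}_{L,\eta}$ is a strictly increasing sequence of elements of $\mathbb{N}_{L,\eta}$. *)

theory Defs
  imports "HOL-Probability.Probability"
begin

definition essinf :: "'a measure \<Rightarrow>
    ('a \<Rightarrow> 'b::{second_countable_topology, dense_linorder, linorder_topology, complete_linorder}) \<Rightarrow> 'b"
  where "essinf M f = (if f \<in> borel_measurable M then Liminf (ae_filter M) f else bot)"

definition time_grid :: "nat \<Rightarrow> real \<Rightarrow> real set"
  where "time_grid L \<eta> = {real k / real L + \<eta> | k. k \<ge> 1}"

text \<open>
  Branching random walk on the integers in the environment \<open>\<xi>\<close>, built from competing exponential
  clocks. The life of a particle is cut into segments at its jump times; a segment is named by a
  list of Booleans that records the events leading to it, most recent first.
  Each segment carries its own independent triple
  \<^item> \<open>jump_clock\<close>: exponential with parameter 1,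
  \<^item> \<open>split_clock\<close>: exponential with parameter 1,
  \<^item> \<open>jump_step\<close>: uniform on \<open>{-1, 1}\<close>.

  A segment at the site \<open>x\<close> ends when the first of the two times \<open>jump_clock\<close> and
  \<open>split_clock / \<xi> x\<close> has elapsed; the latter time is exponential with parameter \<open>\<xi> x\<close>
  (for \<open>\<xi> x > 0\<close>), so that the particle jumps at rate 1 and splits at rate \<open>\<xi> x\<close>.
  By the lack of memory of the exponential distribution, restarting the clocks after a
  jump does not change the law of the process. After a jump the particle goes on as the segment
  \<open>False # u\<close>; after a split its two offspring are \<open>False # u\<close> and \<open>True # u\<close>.
\<close>

type_synonym clocks = "bool list \<Rightarrow> real \<times> real \<times> int"

definition jump_clock :: "clocks \<Rightarrow> bool list \<Rightarrow> real"
  where "jump_clock \<omega> u = fst (\<omega> u)"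

definition split_clock :: "clocks \<Rightarrow> bool list \<Rightarrow> real"
  where "split_clock \<omega> u = fst (snd (\<omega> u))"

definition jump_step :: "clocks \<Rightarrow> bool list \<Rightarrow> int"
  where "jump_step \<omega> u = snd (snd (\<omega> u))"

definition clock_measure :: "clocks measure"
  where "clock_measure = (\<Pi>\<^sub>M u\<in>UNIV.
    density lborel (exponential_density 1) \<Otimes>\<^sub>M
    (density lborel (exponential_density 1) \<Otimes>\<^sub>M measure_pmf (pmf_of_set {-1, 1})))"

text \<open>
  Starting time and site of a segment; \<open>None\<close> if the segment does not occur in the
  realization \<open>\<omega>\<close>.
\<close>

fun segment :: "(int \<Rightarrow> real) \<Rightarrow> clocks \<Rightarrow> bool list \<Rightarrow> (real \<times> int) option"
  where
    "segment \<xi> \<omega> [] = Some (0, 0)"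
  | "segment \<xi> \<omega> (b # u) = (case segment \<xi> \<omega> u of
        None \<Rightarrow> None
      | Some (s, x) \<Rightarrow>
          if jump_clock \<omega> u < split_clock \<omega> u / \<xi> x
          then (if b then None else Some (s + jump_clock \<omega> u, x + jump_step \<omega> u))
          else Some (s + split_clock \<omega> u / \<xi> x, x))"

text \<open>
  The particles alive at time \<open>t\<close> correspond to the segments that have started but not ended
  at time \<open>t\<close>.
\<close>

definition particles :: "(int \<Rightarrow> real) \<Rightarrow> clocks \<Rightarrow> real \<Rightarrow> bool list set"
  where "particles \<xi> \<omega> t = {u. \<exists>s x. segment \<xi> \<omega> u = Some (s, x) \<and>
    s \<le> t \<and> t < s + min (jump_clock \<omega> u) (split_clock \<omega> u / \<xi> x)}"

definition site :: "(int \<Rightarrow> real) \<Rightarrow> clocks \<Rightarrow> bool list \<Rightarrow> int"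
  where "site \<xi> \<omega> u = snd (the (segment \<xi> \<omega> u))"

text \<open>
  For \<open>t \<ge> 0\<close> and \<open>\<xi>\<close> bounded and bounded away from 0, the set of particles is almost surely
  finite and nonempty. Where it is not, \<open>Max\<close> has an arbitrary value.
\<close>

definition max_position :: "(int \<Rightarrow> real) \<Rightarrow> real \<Rightarrow> clocks \<Rightarrow> real"
  where "max_position \<xi> t \<omega> = real_of_int (Max (site \<xi> \<omega> ` particles \<xi> \<omega> t))"

definition mean_max_position :: "(int \<Rightarrow> real) \<Rightarrow> real \<Rightarrow> real"
  where "mean_max_position \<xi> t = (\<integral>\<omega>. max_position \<xi> t \<omega> \<partial>clock_measure)"

end

theory Submission
  imports Defs
begin

text \<open>
  Almost every environment takes all its values in an interval \<open>[a, b]\<close> with \<open>0 < a\<close>, and the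
  statement holds for each such environment \<open>e\<close>. The argument is that of Dekking and Host, applied to
  the record \<open>R t\<close> (the rightmost site visited by time \<open>t\<close>) in place of the maximum \<open>M t\<close>, because the
  law of \<open>R t\<close> increases with \<open>t\<close>.

  Let \<open>u z x t\<close> be the probability that a process started at \<open>x\<close> has visited a site \<open>\<ge> z\<close> by time
  \<open>t\<close>. Conditioning on the first jump or split (\<open>first_step\<close>) shows that for \<open>x < z\<close>, in integrated
  form, the time derivative of \<open>u\<close> is
  \<open>(u (x + 1) + u (x - 1)) / 2 - u x + e x * u x * (1 - u x)\<close>.
  Sum this over \<open>z \<ge> 1\<close> at \<open>x = 0\<close>. On the left stands the growth of \<open>\<rho> t\<close>, the mean of \<open>R t\<close>. On the
  right, the sum of \<open>u * (1 - u)\<close> bounds the mean distance of \<open>R t\<close> from its median. So \<open>R t\<close> is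
  concentrated whenever \<open>\<rho>\<close> grows little after \<open>t\<close> (\<open>hit_prob_step\<close>) and the Laplacian is not too
  negative, that is, whenever starting at \<open>1\<close> or \<open>-1\<close> is not much worse than starting at \<open>0\<close>.

  In a random environment the last point is not automatic. It holds because a process started at
  \<open>\<plusminus>1\<close> has a particle at \<open>0\<close> after a time with an exponential tail; a single walk would need a time of
  infinite mean, so it is essential that particles split. Restarting at this time bounds the
  defect, summed over \<open>z\<close>, by a multiple of the discounted growth
  \<open>A n = (\<Sum>j\<le>n. (\<rho> j - \<rho> (j - 1)) * \<theta> ^ (n - j))\<close> along the time grid
  (\<open>hit_prob_from_elsewhere\<close>), where \<open>\<rho>\<close> counts as \<open>0\<close> before the first grid time. The same quantity bounds the mean of \<open>R t - M t\<close>
  (\<open>occ_prob_after_hit\<close>): the particle that sets a record has, some time later, descendants at or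
  beyond that site with a probability exponentially close to \<open>1\<close>.

  Since \<open>\<rho>\<close> grows at most linearly (\<open>mean_record_linear\<close>), the sum of \<open>A n\<close> and of the increments of \<open>\<rho>\<close> over
  \<open>n \<le> N\<close> is of order \<open>N\<close>. Both are therefore bounded by some \<open>K\<close> outside a set of grid times of
  density as small as desired (\<open>slow_times\<close>), and along the remaining times \<open>M t\<close> is within bounded
  mean distance of a number that depends on \<open>t\<close> only.

  All estimates on \<open>u\<close> rest on a comparison principle for the integral equation (\<open>comparison\<close>). The
  exponential tails come from an explicit subsolution (\<open>barrier_subsolution\<close>), and restarting at a random
  time corresponds to the fact that mixtures of delayed subsolutions are subsolutions
  (\<open>mixture_subsolution\<close>).
\<close>

section \<open>Clocks and the branching property\<close>

abbreviation unit_exponential :: "real measure"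
  where "unit_exponential \<equiv> density lborel (exponential_density 1)"

abbreviation segment_clock :: "(real \<times> real \<times> int) measure"
  where "segment_clock \<equiv> unit_exponential \<Otimes>\<^sub>M (unit_exponential \<Otimes>\<^sub>M measure_pmf (pmf_of_set {-1, 1}))"

lemma prob_space_unit_exponential: "prob_space unit_exponential"
  by (rule prob_space_exponential_density) simp

lemma prob_space_segment_clock: "prob_space segment_clock"
  by (intro prob_space_pair prob_space_unit_exponential prob_space_measure_pmf)

interpretation clocks: product_prob_space "\<lambda>_. segment_clock" "UNIV :: bool list set"
  by (intro product_prob_spaceI prob_space_segment_clock)

lemma prob_space_clock_measure: "prob_space clock_measure"
  unfolding clock_measure_def by (intro prob_space_PiM prob_space_segment_clock)

interpretation C: prob_space clock_measure
  by (rule prob_space_clock_measure)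

lemma sets_segment_clock [measurable_cong]:
  "sets segment_clock = sets (borel \<Otimes>\<^sub>M (borel \<Otimes>\<^sub>M count_space UNIV))"
  by (intro sets_pair_measure_cong) auto

lemma sets_clock_measure [measurable_cong]:
  "sets clock_measure = sets (\<Pi>\<^sub>M u\<in>UNIV. borel \<Otimes>\<^sub>M (borel \<Otimes>\<^sub>M count_space UNIV))"
  unfolding clock_measure_def by (intro sets_PiM_cong refl sets_segment_clock)

lemma space_segment_clock [simp]: "space segment_clock = UNIV"
  by (simp add: space_pair_measure)

lemma space_clock_measure [simp]: "space clock_measure = UNIV"
  by (simp add: clock_measure_def space_PiM)

lemma measurable_jump_clock [measurable]: "(\<lambda>\<omega>. jump_clock \<omega> u) \<in> borel_measurable clock_measure"
  unfolding jump_clock_def by measurable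

lemma measurable_split_clock [measurable]: "(\<lambda>\<omega>. split_clock \<omega> u) \<in> borel_measurable clock_measure"
  unfolding split_clock_def by measurable

lemma measurable_jump_step [measurable]: "(\<lambda>\<omega>. jump_step \<omega> u) \<in> clock_measure \<rightarrow>\<^sub>M count_space UNIV"
  unfolding jump_step_def by measurable

text \<open>
  The inverse of cutting a realization at its root: the clocks of the root segment, of the subtree
  below \<open>False\<close> and of the subtree below \<open>True\<close> are put together. The root event is the last letter
  of a word, because words list the most recent event first.
\<close>

definition graft :: "(real \<times> real \<times> int) \<times> clocks \<times> clocks \<Rightarrow> clocks"
  where "graft = (\<lambda>(r, f, g) u. if u = [] then r else if last u then g (butlast u) else f (butlast u))"

lemma graft_simps [simp]:
  "graft (r, f, g) [] = r"
  "graft (r, f, g) (u @ [True]) = g u"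
  "graft (r, f, g) (u @ [False]) = f u"
  by (simp_all add: graft_def)

lemma measurable_graft [measurable]:
  "graft \<in> segment_clock \<Otimes>\<^sub>M (clock_measure \<Otimes>\<^sub>M clock_measure) \<rightarrow>\<^sub>M clock_measure"
proof -
  have "(\<lambda>x. graft x u) \<in> segment_clock \<Otimes>\<^sub>M (clock_measure \<Otimes>\<^sub>M clock_measure) \<rightarrow>\<^sub>M segment_clock" for u
    unfolding graft_def clock_measure_def case_prod_beta by measurable
  then show ?thesis
    unfolding clock_measure_def[of] by (intro measurable_PiM_single') (auto simp: space_PiM clock_measure_def)
qed

text \<open>
  The branching property: the root clocks and the two subtrees are independent, and each subtree is
  distributed as the whole tree. Both sides are product measures, so it suffices to compare finite
  boxes, whose coordinates split into the root and the two subtrees.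
\<close>

lemma distr_graft:
  "distr (segment_clock \<Otimes>\<^sub>M (clock_measure \<Otimes>\<^sub>M clock_measure)) clock_measure graft = clock_measure"
proof -
  have "distr (segment_clock \<Otimes>\<^sub>M (clock_measure \<Otimes>\<^sub>M clock_measure)) clock_measure graft
      = (\<Pi>\<^sub>M u\<in>UNIV. segment_clock)"
  proof (rule clocks.PiM_eq)
    show "sets (distr (segment_clock \<Otimes>\<^sub>M (clock_measure \<Otimes>\<^sub>M clock_measure)) clock_measure graft)
      = sets (\<Pi>\<^sub>M u\<in>UNIV. segment_clock)"
      by (simp add: clock_measure_def)
  next
    fix J :: "bool list set" and F
    assume J: "finite J" and F: "\<And>j. j \<in> J \<Longrightarrow> F j \<in> sets segment_clock"
    define H where "H u = (if u \<in> J then F u else UNIV)" for u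
    have H [measurable]: "H u \<in> sets segment_clock" for u
      using F sets.top[of segment_clock] by (auto simp: H_def)
    have H1: "u \<notin> J \<Longrightarrow> emeasure segment_clock (H u) = 1" for u
      using prob_space.emeasure_space_1[OF prob_space_segment_clock] by (simp add: H_def)
    define JJ where "JJ b = {u. u @ [b] \<in> J}" for b
    have JJ_fin: "finite (JJ b)" for b
      unfolding JJ_def by (rule finite_vimageI[OF J, unfolded vimage_def]) (auto simp: inj_def)
    have box: "emeasure clock_measure {f. \<forall>u\<in>JJ b. f u \<in> H (u @ [b])} = (\<Prod>u\<in>JJ b. emeasure segment_clock (H (u @ [b])))" for b
      using clocks.emeasure_PiM_Collect[OF subset_UNIV JJ_fin, of b "\<lambda>u. H (u @ [b])", OF H]
      by (simp add: clock_measure_def space_PiM)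
    have box_sets: "{f. \<forall>u\<in>JJ b. f u \<in> H (u @ [b])} \<in> sets clock_measure" for b
    proof -
      have "{f \<in> space clock_measure. \<forall>u\<in>JJ b. f u \<in> H (u @ [b])} \<in> sets clock_measure"
        unfolding clock_measure_def using JJ_fin[of b] by measurable
      then show ?thesis by simp
    qed
    have Jdec: "J = (J \<inter> {[]}) \<union> ((\<lambda>u. u @ [False]) ` JJ False \<union> (\<lambda>u. u @ [True]) ` JJ True)"
    proof -
      have "u \<in> (J \<inter> {[]}) \<union> ((\<lambda>u. u @ [False]) ` JJ False \<union> (\<lambda>u. u @ [True]) ` JJ True)" if "u \<in> J" for u
        using that by (cases u rule: rev_cases; cases "last u") (auto simp: JJ_def image_iff)
      then show ?thesis by (auto simp: JJ_def)
    qed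
    have pre: "graft -` prod_emb UNIV (\<lambda>_. segment_clock) J (Pi\<^sub>E J F)
       = H [] \<times> ({f. \<forall>u\<in>JJ False. f u \<in> H (u @ [False])} \<times> {f. \<forall>u\<in>JJ True. f u \<in> H (u @ [True])})"
    proof -
      have "graft (r, f, g) \<in> prod_emb UNIV (\<lambda>_. segment_clock) J (Pi\<^sub>E J F) \<longleftrightarrow> (\<forall>u\<in>J. graft (r, f, g) u \<in> H u)" for r f g
        by (auto simp: prod_emb_def space_PiM PiE_iff H_def extensional_def)
      also have "\<dots> r f g \<longleftrightarrow> r \<in> H [] \<and> (\<forall>u\<in>JJ False. f u \<in> H (u @ [False])) \<and> (\<forall>u\<in>JJ True. g u \<in> H (u @ [True]))" for r f g
        apply (subst Jdec)
        apply (simp only: ball_Un ball_simps)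
        apply (auto simp: H_def)
        done
      finally show ?thesis by auto
    qed
    have "emeasure (distr (segment_clock \<Otimes>\<^sub>M (clock_measure \<Otimes>\<^sub>M clock_measure)) clock_measure graft)
        (prod_emb UNIV (\<lambda>_. segment_clock) J (Pi\<^sub>E J F))
      = emeasure (segment_clock \<Otimes>\<^sub>M (clock_measure \<Otimes>\<^sub>M clock_measure))
         (H [] \<times> ({f. \<forall>u\<in>JJ False. f u \<in> H (u @ [False])} \<times> {f. \<forall>u\<in>JJ True. f u \<in> H (u @ [True])}))"
    proof (subst emeasure_distr[OF measurable_graft])
      show "prod_emb UNIV (\<lambda>_. segment_clock) J (Pi\<^sub>E J F) \<in> sets clock_measure"
        unfolding clock_measure_def using J F by (intro sets_PiM_I) auto
    qed (simp add: pre space_pair_measure)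
    also have "\<dots> = emeasure segment_clock (H []) * ((\<Prod>u\<in>JJ False. emeasure segment_clock (H (u @ [False])))
        * (\<Prod>u\<in>JJ True. emeasure segment_clock (H (u @ [True]))))"
    proof -
      interpret CC: prob_space "clock_measure \<Otimes>\<^sub>M clock_measure"
        by (intro prob_space_pair prob_space_clock_measure)
      show ?thesis
        by (subst CC.emeasure_pair_measure_Times[OF H pair_measureI[OF box_sets box_sets]],
            subst C.emeasure_pair_measure_Times[OF box_sets box_sets], simp only: box)
    qed
    also have "\<dots> = (\<Prod>j\<in>J. emeasure segment_clock (H j))"
    proof -
      have "(\<Prod>j\<in>J. emeasure segment_clock (H j)) = (\<Prod>j\<in>J \<inter> {[]}. emeasure segment_clock (H j)) *
        ((\<Prod>j\<in>(\<lambda>u. u @ [False]) ` JJ False. emeasure segment_clock (H j)) * (\<Prod>j\<in>(\<lambda>u. u @ [True]) ` JJ True. emeasure segment_clock (H j)))"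
        using J JJ_fin by (subst Jdec, subst prod.union_disjoint; (subst prod.union_disjoint)?) auto
      moreover have "(\<Prod>j\<in>J \<inter> {[]}. emeasure segment_clock (H j)) = emeasure segment_clock (H [])"
        using H1[of "[]"] by (cases "[] \<in> J") auto
      ultimately show ?thesis
        by (simp add: prod.reindex inj_on_def)
    qed
    also have "\<dots> = (\<Prod>j\<in>J. emeasure segment_clock (F j))"
      by (simp add: H_def)
    finally show "emeasure (distr (segment_clock \<Otimes>\<^sub>M (clock_measure \<Otimes>\<^sub>M clock_measure)) clock_measure graft)
        (prod_emb UNIV (\<lambda>_. segment_clock) J (Pi\<^sub>E J F)) = (\<Prod>j\<in>J. emeasure segment_clock (F j))" .
  qed
  then show ?thesis by (simp add: clock_measure_def)
qed

text \<open>
  Cutting at the root: below the first event, the process is a process of the same kind in the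
  environment seen from the site reached, delayed by the duration of the first segment.
\<close>

lemma segment_snoc:
  "segment e \<omega> (u @ [b]) =
    (if jump_clock \<omega> [] < split_clock \<omega> [] / e 0
     then (if b then None
           else map_option (\<lambda>(s, y). (jump_clock \<omega> [] + s, jump_step \<omega> [] + y))
                  (segment (\<lambda>i. e (jump_step \<omega> [] + i)) (\<lambda>v. \<omega> (v @ [b])) u))
     else map_option (\<lambda>(s, y). (split_clock \<omega> [] / e 0 + s, y)) (segment e (\<lambda>v. \<omega> (v @ [b])) u))"
proof (induction u)
  case Nil
  show ?case by simp
next
  case (Cons c u)
  show ?case
    by (simp add: Cons.IH jump_clock_def split_clock_def jump_step_def split: option.splits)
qed

section \<open>Measurable events of the process\<close>

definition birth :: "(int \<Rightarrow> real) \<Rightarrow> clocks \<Rightarrow> bool list \<Rightarrow> real"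
  where "birth e \<omega> u = fst (the (segment e \<omega> u))"

lemma born_Cons:
  "segment e \<omega> (b # u) \<noteq> None \<longleftrightarrow> segment e \<omega> u \<noteq> None \<and>
     \<not> (b \<and> jump_clock \<omega> u < split_clock \<omega> u / e (site e \<omega> u))"
  by (auto simp: site_def split: option.splits)

lemma birth_Cons:
  "birth e \<omega> (b # u) = (if segment e \<omega> (b # u) \<noteq> None
     then birth e \<omega> u + min (jump_clock \<omega> u) (split_clock \<omega> u / e (site e \<omega> u)) else fst (the (None :: (real \<times> int) option)))"
  by (auto simp: birth_def site_def split: option.splits)

lemma site_Cons:
  "site e \<omega> (b # u) = (if segment e \<omega> (b # u) \<noteq> None
     then site e \<omega> u + (if jump_clock \<omega> u < split_clock \<omega> u / e (site e \<omega> u) then jump_step \<omega> u else 0)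
     else snd (the (None :: (real \<times> int) option)))"
  by (auto simp: site_def split: option.splits)

text \<open>
  The three properties have to be proved together, since each is needed for the next letter.
\<close>

lemma measurable_segment:
  "Measurable.pred clock_measure (\<lambda>\<omega>. segment e \<omega> u \<noteq> None)
   \<and> (\<lambda>\<omega>. birth e \<omega> u) \<in> borel_measurable clock_measure
   \<and> (\<lambda>\<omega>. site e \<omega> u) \<in> clock_measure \<rightarrow>\<^sub>M count_space UNIV"
proof (induction u)
  case Nil
  show ?case by (simp add: birth_def site_def)
next
  case (Cons b u)
  then have [measurable]: "Measurable.pred clock_measure (\<lambda>\<omega>. segment e \<omega> u \<noteq> None)"
    "(\<lambda>\<omega>. birth e \<omega> u) \<in> borel_measurable clock_measure"
    "(\<lambda>\<omega>. site e \<omega> u) \<in> clock_measure \<rightarrow>\<^sub>M count_space UNIV"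
    by auto
  have [measurable]: "(\<lambda>\<omega>. e (site e \<omega> u)) \<in> borel_measurable clock_measure"
    by (rule measurable_compose[of _ _ "count_space UNIV"]) auto
  have 1 [measurable]: "Measurable.pred clock_measure (\<lambda>\<omega>. segment e \<omega> (b # u) \<noteq> None)"
    unfolding born_Cons by measurable
  show ?case
    unfolding birth_Cons site_Cons using 1 by (intro conjI measurable_If; measurable)
qed

lemma measurable_born [measurable]: "Measurable.pred clock_measure (\<lambda>\<omega>. segment e \<omega> u \<noteq> None)"
  and measurable_birth [measurable]: "(\<lambda>\<omega>. birth e \<omega> u) \<in> borel_measurable clock_measure"
  and measurable_site [measurable]: "(\<lambda>\<omega>. site e \<omega> u) \<in> clock_measure \<rightarrow>\<^sub>M count_space UNIV"
  using measurable_segment by auto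

lemma measurable_rate_at_site: "(\<lambda>\<omega>. e (site e' \<omega> u) :: real) \<in> borel_measurable clock_measure"
  by (rule measurable_compose[of _ _ "count_space UNIV"]) auto

lemma particles_iff:
  "u \<in> particles e \<omega> t \<longleftrightarrow> segment e \<omega> u \<noteq> None \<and> birth e \<omega> u \<le> t
     \<and> t < birth e \<omega> u + min (jump_clock \<omega> u) (split_clock \<omega> u / e (site e \<omega> u))"
  by (auto simp: particles_def birth_def site_def)

definition reached :: "(int \<Rightarrow> real) \<Rightarrow> int \<Rightarrow> real \<Rightarrow> clocks set"
  where "reached e k t = {\<omega>. \<exists>u. segment e \<omega> u \<noteq> None \<and> birth e \<omega> u \<le> t \<and> k \<le> site e \<omega> u}"

definition occupied :: "(int \<Rightarrow> real) \<Rightarrow> int \<Rightarrow> real \<Rightarrow> clocks set"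
  where "occupied e k t = {\<omega>. \<exists>u. u \<in> particles e \<omega> t \<and> k \<le> site e \<omega> u}"

definition generation :: "(int \<Rightarrow> real) \<Rightarrow> nat \<Rightarrow> real \<Rightarrow> clocks set"
  where "generation e n t = {\<omega>. \<exists>u. length u = n \<and> segment e \<omega> u \<noteq> None \<and> birth e \<omega> u \<le> t}"

text \<open>
  Joint measurability in the time and in the realization is needed because the subtrees are observed at
  the random time that remains after the first event.
\<close>

lemma measurable_reached [measurable]:
  "Measurable.pred (borel \<Otimes>\<^sub>M clock_measure) (\<lambda>(t, \<omega>). \<omega> \<in> reached e k t)"
  unfolding reached_def mem_Collect_eq case_prod_beta by measurable

lemma measurable_occupied [measurable]:
  "Measurable.pred (borel \<Otimes>\<^sub>M clock_measure) (\<lambda>(t, \<omega>). \<omega> \<in> occupied e k t)"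
proof -
  note measurable_rate_at_site[of e e, measurable]
  show ?thesis
    unfolding occupied_def mem_Collect_eq case_prod_beta particles_iff by measurable
qed

lemma measurable_generation [measurable]:
  "Measurable.pred (borel \<Otimes>\<^sub>M clock_measure) (\<lambda>(t, \<omega>). \<omega> \<in> generation e n t)"
  unfolding generation_def mem_Collect_eq case_prod_beta by measurable

lemma sets_section:
  assumes "Measurable.pred (borel \<Otimes>\<^sub>M clock_measure) (\<lambda>(t, \<omega>). \<omega> \<in> A t)"
  shows "A (t :: real) \<in> sets clock_measure"
proof -
  have "Measurable.pred clock_measure (\<lambda>\<omega>. case (t, \<omega>) of (t, \<omega>) \<Rightarrow> \<omega> \<in> A t)"
    by (rule measurable_compose[OF _ assms]) simp
  then show ?thesis by (simp add: pred_def)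
qed

lemma measurable_prob_section:
  assumes "Measurable.pred (borel \<Otimes>\<^sub>M clock_measure) (\<lambda>(t, \<omega>). \<omega> \<in> A t)"
  shows "(\<lambda>t :: real. C.prob (A t)) \<in> borel_measurable borel"
proof -
  have "{x \<in> space (borel \<Otimes>\<^sub>M clock_measure). case x of (t, \<omega>) \<Rightarrow> \<omega> \<in> A t} \<in> sets (borel \<Otimes>\<^sub>M clock_measure)"
    using assms by (simp add: pred_def)
  from C.measurable_emeasure_Pair[OF this]
  have "(\<lambda>t. emeasure clock_measure (A t)) \<in> borel_measurable borel"
    by (simp add: space_pair_measure vimage_def)
  then show ?thesis unfolding measure_def by measurable
qed

definition positive_clocks :: "clocks set"
  where "positive_clocks = {\<omega>. \<forall>u. 0 < jump_clock \<omega> u \<and> 0 < split_clock \<omega> u \<and> jump_step \<omega> u \<in> {-1, 1}}"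

lemma AE_unit_exponential_pos: "AE j in unit_exponential. 0 < j"
proof -
  have "AE j in lborel. j \<noteq> (0::real)" by (rule AE_lborel_singleton)
  then show ?thesis
    by (subst AE_density) (auto simp: exponential_density_def elim!: eventually_mono split: if_splits)
qed

lemma AE_segment_clock_pos:
  "AE r in segment_clock. 0 < fst r \<and> 0 < fst (snd r) \<and> snd (snd r) \<in> {-1, 1}"
proof -
  interpret E: prob_space unit_exponential by (rule prob_space_unit_exponential)
  interpret pair_sigma_finite unit_exponential "measure_pmf (pmf_of_set {-1, 1 :: int})"
    by unfold_locales
  interpret PP: prob_space "unit_exponential \<Otimes>\<^sub>M measure_pmf (pmf_of_set {-1, 1 :: int})"
    by (intro prob_space_pair prob_space_unit_exponential prob_space_measure_pmf)
  interpret P: pair_sigma_finite unit_exponential "unit_exponential \<Otimes>\<^sub>M measure_pmf (pmf_of_set {-1, 1 :: int})"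
    by unfold_locales
  have 1: "AE r in unit_exponential \<Otimes>\<^sub>M measure_pmf (pmf_of_set {-1, 1 :: int}). 0 < fst r \<and> snd r \<in> {-1, 1}"
  proof (rule AE_pair_measure)
    show "AE x in unit_exponential. AE y in measure_pmf (pmf_of_set {-1, 1 :: int}). 0 < fst (x, y) \<and> snd (x, y) \<in> {-1, 1}"
      using AE_unit_exponential_pos
    proof eventually_elim
      case (elim x)
      then show ?case by (auto intro!: AE_pmfI simp: set_pmf_of_set)
    qed
  next
    have [measurable]: "(\<lambda>x. x \<in> {-1, 1 :: int}) \<in> measurable (count_space UNIV) (count_space UNIV)" by simp
    show "{x \<in> space (unit_exponential \<Otimes>\<^sub>M measure_pmf (pmf_of_set {-1, 1 :: int})). 0 < fst x \<and> snd x \<in> {-1, 1}}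
      \<in> sets (unit_exponential \<Otimes>\<^sub>M measure_pmf (pmf_of_set {-1, 1 :: int}))"
      by measurable
  qed
  show ?thesis
  proof (rule P.AE_pair_measure)
    have [measurable]: "(\<lambda>x. x \<in> {-1, 1 :: int}) \<in> measurable (count_space UNIV) (count_space UNIV)" by simp
    show "{x \<in> space segment_clock. 0 < fst x \<and> 0 < fst (snd x) \<and> snd (snd x) \<in> {- 1, 1}} \<in> sets segment_clock"
      by measurable
    show "AE x in unit_exponential. AE y in unit_exponential \<Otimes>\<^sub>M measure_pmf (pmf_of_set {-1, 1 :: int}).
       0 < fst (x, y) \<and> 0 < fst (snd (x, y)) \<and> snd (snd (x, y)) \<in> {- 1, 1}"
      using AE_unit_exponential_pos
    proof eventually_elim
      case (elim x)
      then show ?case using 1 by simp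
    qed
  qed
qed

lemma AE_positive_clocks: "AE \<omega> in clock_measure. \<omega> \<in> positive_clocks"
proof -
  have "AE \<omega> in clock_measure. 0 < fst (\<omega> u) \<and> 0 < fst (snd (\<omega> u)) \<and> snd (snd (\<omega> u)) \<in> {-1, 1}" for u
    unfolding clock_measure_def by (rule clocks.AE_component[OF UNIV_I AE_segment_clock_pos])
  then show ?thesis
    by (simp add: positive_clocks_def jump_clock_def split_clock_def jump_step_def AE_all_countable)
qed

lemma nn_integral_unit_exponential:
  assumes [measurable]: "f \<in> borel_measurable borel"
  shows "(\<integral>\<^sup>+ j. f j \<partial>unit_exponential) = (\<integral>\<^sup>+ j. ennreal (exp (- j)) * f j * indicator {0..} j \<partial>lborel)"
  by (subst nn_integral_density)
     (auto simp: exponential_density_def intro!: nn_integral_cong split: split_indicator)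

lemma emeasure_unit_exponential_atLeast:
  assumes "0 \<le> c" shows "emeasure unit_exponential {c..} = ennreal (exp (- c))"
proof -
  have "emeasure unit_exponential {c..} = (\<integral>\<^sup>+ j. indicator {c..} j \<partial>unit_exponential)" by simp
  also have "\<dots> = (\<integral>\<^sup>+ j. ennreal (exp (- j)) * indicator {c..} j \<partial>lborel)"
    using assms by (subst nn_integral_unit_exponential) (auto intro!: nn_integral_cong split: split_indicator)
  also have "\<dots> = ennreal (0 - (- exp (- c)))"
  proof (rule nn_integral_FTC_atLeast)
    show "((\<lambda>x. - exp (- x) :: real) \<longlongrightarrow> 0) at_top"
      using tendsto_minus[OF filterlim_compose[OF exp_at_bot filterlim_uminus_at_bot_at_top]] by simp
  qed (auto intro!: derivative_eq_intros)
  finally show ?thesis by simp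
qed

lemma emeasure_unit_exponential_greaterThan:
  assumes "0 \<le> c" shows "emeasure unit_exponential {c<..} = ennreal (exp (- c))"
proof -
  have "AE x in unit_exponential. x \<noteq> c"
    by (subst AE_density) (auto intro: AE_mp[OF AE_lborel_singleton[of c]])
  then have "emeasure unit_exponential {c<..} = emeasure unit_exponential {c..}"
    by (intro emeasure_eq_AE) (auto elim!: eventually_mono)
  then show ?thesis using emeasure_unit_exponential_atLeast[OF assms] by simp
qed

section \<open>Conditioning on the first event\<close>

lemma set_integrable_bounded_Icc:
  fixes f :: "real \<Rightarrow> real"
  assumes "f \<in> borel_measurable borel" "\<And>x. x \<in> {a..b} \<Longrightarrow> \<bar>f x\<bar> \<le> K"
  shows "set_integrable lborel {a..b} f"
  unfolding set_integrable_def
  by (rule integrableI_bounded_set_indicator[where B = K]) (use assms in \<open>auto simp: emeasure_lborel_Icc_eq\<close>)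

lemma prob_union_of_copies:
  assumes "B \<in> sets clock_measure"
  shows "emeasure (clock_measure \<Otimes>\<^sub>M clock_measure) {(f, g). f \<in> B \<or> g \<in> B}
    = ennreal (2 * C.prob B - (C.prob B)\<^sup>2)"
proof -
  interpret CC: prob_space "clock_measure \<Otimes>\<^sub>M clock_measure"
    by (intro prob_space_pair prob_space_clock_measure)
  have [simp]: "space (clock_measure \<Otimes>\<^sub>M clock_measure) = UNIV"
    by (simp add: space_pair_measure)
  have B': "- B \<in> sets clock_measure"
    using sets.compl_sets[OF assms] by (simp add: Compl_eq_Diff_UNIV)
  have "CC.prob ((- B) \<times> (- B)) = C.prob (- B) * C.prob (- B)"
    using B' by (simp add: measure_def C.emeasure_pair_measure_Times enn2real_mult)
  moreover have "C.prob (- B) = 1 - C.prob B"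
    using C.prob_compl[OF assms] by (simp add: Compl_eq_Diff_UNIV)
  moreover have "{(f, g). f \<in> B \<or> g \<in> B} = space (clock_measure \<Otimes>\<^sub>M clock_measure) - ((- B) \<times> (- B))"
    by auto
  moreover have "(- B) \<times> (- B) \<in> CC.events"
    using B' by simp
  ultimately have "CC.prob {(f, g). f \<in> B \<or> g \<in> B} = 2 * C.prob B - (C.prob B)\<^sup>2"
    unfolding power2_eq_square using CC.prob_compl[of "(- B) \<times> (- B)"] by (simp add: algebra_simps)
  then show ?thesis
    by (simp only: CC.emeasure_eq_measure)
qed

lemma nn_integral_segment_clock:
  assumes [measurable]: "h \<in> borel_measurable (borel \<Otimes>\<^sub>M (borel \<Otimes>\<^sub>M count_space UNIV))"
  shows "(\<integral>\<^sup>+ r. h r \<partial>segment_clock) =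
    (\<integral>\<^sup>+ j. \<integral>\<^sup>+ s. (h (j, s, 1) + h (j, s, -1)) / 2 \<partial>unit_exponential \<partial>unit_exponential)"
proof -
  interpret E: prob_space unit_exponential by (rule prob_space_unit_exponential)
  interpret PP: prob_space "unit_exponential \<Otimes>\<^sub>M measure_pmf (pmf_of_set {-1, 1 :: int})"
    by (intro prob_space_pair prob_space_unit_exponential prob_space_measure_pmf)
  have "(\<integral>\<^sup>+ r. h r \<partial>segment_clock)
    = (\<integral>\<^sup>+ j. \<integral>\<^sup>+ x. h (j, x) \<partial>(unit_exponential \<Otimes>\<^sub>M measure_pmf (pmf_of_set {-1, 1 :: int})) \<partial>unit_exponential)"
    by (rule PP.nn_integral_fst[symmetric]) measurable
  also have "\<dots> = (\<integral>\<^sup>+ j. \<integral>\<^sup>+ s. \<integral>\<^sup>+ i. h (j, s, i) \<partial>measure_pmf (pmf_of_set {-1, 1 :: int}) \<partial>unit_exponential \<partial>unit_exponential)"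
    by (intro nn_integral_cong measure_pmf.nn_integral_fst[symmetric]) measurable
  also have "\<dots> = (\<integral>\<^sup>+ j. \<integral>\<^sup>+ s. (h (j, s, 1) + h (j, s, -1)) / 2 \<partial>unit_exponential \<partial>unit_exponential)"
    by (intro nn_integral_cong) (simp add: nn_integral_pmf_of_set add.commute)
  finally show ?thesis .
qed

text \<open>
  Passes from the split clock \<open>s\<close>, which rings at time \<open>s / e0\<close>, to the time \<open>\<sigma>\<close> that remains after it.
\<close>

lemma nn_integral_reflect_scale:
  fixes t e0 :: real
  assumes "0 < e0" "0 \<le> t" and [measurable]: "F \<in> borel_measurable borel"
  shows "(\<integral>\<^sup>+ s. F s * indicator {0..e0 * t} s \<partial>lborel)
    = (\<integral>\<^sup>+ \<sigma>. ennreal e0 * F (e0 * (t - \<sigma>)) * indicator {0..t} \<sigma> \<partial>lborel)"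
proof -
  have "(\<integral>\<^sup>+ s. F s * indicator {0..e0 * t} s \<partial>lborel)
    = ennreal e0 * (\<integral>\<^sup>+ \<sigma>. F (e0 * t + - e0 * \<sigma>) * indicator {0..e0 * t} (e0 * t + - e0 * \<sigma>) \<partial>lborel)"
    using assms by (subst nn_integral_real_affine[where c="- e0" and t="e0 * t"]) auto
  also have "\<dots> = (\<integral>\<^sup>+ \<sigma>. ennreal e0 * (F (e0 * (t - \<sigma>)) * indicator {0..t} \<sigma>) \<partial>lborel)"
  proof -
    have "indicator {0..e0 * t} (e0 * t + - e0 * \<sigma>) = (indicator {0..t} \<sigma> :: ennreal)" for \<sigma>
    proof -
      have 1: "0 \<le> e0 * t + - e0 * \<sigma> \<longleftrightarrow> \<sigma> \<le> t"
        using mult_le_cancel_left_pos[OF assms(1), of \<sigma> t] by simp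
      have 2: "e0 * t + - e0 * \<sigma> \<le> e0 * t \<longleftrightarrow> 0 \<le> \<sigma>"
        using mult_le_cancel_left_pos[OF assms(1), of 0 \<sigma>] by simp
      show ?thesis unfolding indicator_def atLeastAtMost_iff 1 2 by (simp add: conj_commute)
    qed
    then show ?thesis
      by (subst nn_integral_cmult[symmetric]) (simp_all add: algebra_simps)
  qed
  finally show ?thesis by (simp add: mult.assoc)
qed

lemma ennreal_average: "0 \<le> x \<Longrightarrow> 0 \<le> y \<Longrightarrow> (ennreal x + ennreal y) / 2 = ennreal ((x + y) / 2)"
  using divide_ennreal[of "x + y" 2] by simp

text \<open>
  Jump and split clocks race, so the first event happens at rate \<open>1 + e0\<close>. The event \<open>Y\<close> is decided by
  \<open>c\<close> if nothing happens up to time \<open>t\<close>, by the event \<open>A\<close> for the one continuing particle after a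
  jump, and by at least one of two independent copies of \<open>B\<close> after a split; the latter has
  probability \<open>2 * p - p ^ 2\<close>. The variable of integration is the time that remains.
\<close>

lemma first_step:
  fixes Y :: "clocks set" and A :: "int \<Rightarrow> real \<Rightarrow> clocks set" and B :: "real \<Rightarrow> clocks set"
    and c :: bool and e0 t :: real
  assumes e0: "0 < e0" and t: "0 \<le> t" and Y: "Y \<in> sets clock_measure"
    and A: "\<And>i. Measurable.pred (borel \<Otimes>\<^sub>M clock_measure) (\<lambda>(s, \<omega>). \<omega> \<in> A i s)"
    and B: "Measurable.pred (borel \<Otimes>\<^sub>M clock_measure) (\<lambda>(s, \<omega>). \<omega> \<in> B s)"
    and step: "\<And>j s i f g. 0 < j \<Longrightarrow> 0 < s \<Longrightarrow> i \<in> {-1, 1} \<Longrightarrow> f \<in> positive_clocks \<Longrightarrow> g \<in> positive_clocks \<Longrightarrow>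
      graft ((j, s, i), f, g) \<in> Y \<longleftrightarrow>
        (if t < min j (s / e0) then c
         else if j < s / e0 then f \<in> A i (t - j)
         else f \<in> B (t - s / e0) \<or> g \<in> B (t - s / e0))"
  shows "C.prob Y = (if c then exp (- (1 + e0) * t) else 0)
    + (LBINT \<sigma>:{0..t}. exp (- (1 + e0) * (t - \<sigma>)) *
        ((C.prob (A 1 \<sigma>) + C.prob (A (- 1) \<sigma>)) / 2 + e0 * (2 * C.prob (B \<sigma>) - (C.prob (B \<sigma>))\<^sup>2)))"
proof -
  define a where "a i s = C.prob (A i s)" for i s
  define b where "b s = 2 * C.prob (B s) - (C.prob (B s))\<^sup>2" for s
  have a_meas [measurable]: "a i \<in> borel_measurable borel" for i
    unfolding a_def by (rule measurable_prob_section[OF A])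
  have b_meas [measurable]: "b \<in> borel_measurable borel"
    unfolding b_def using measurable_prob_section[OF B] by measurable
  have a_bounds: "0 \<le> a i s" "a i s \<le> 1" for i s
    by (auto simp: a_def)
  have b_bounds: "0 \<le> b s" "b s \<le> 1" for s
  proof -
    have "0 \<le> C.prob (B s) * (1 - C.prob (B s)) + C.prob (B s)" by (intro add_nonneg_nonneg mult_nonneg_nonneg) auto
    then show "0 \<le> b s" by (simp add: b_def power2_eq_square algebra_simps)
    have "0 \<le> (1 - C.prob (B s))\<^sup>2" by simp
    then show "b s \<le> 1" by (simp add: b_def power2_eq_square algebra_simps)
  qed
  (* the three outcomes: nothing happens up to time t, a jump comes first, a split comes first *)
  define h1 where "h1 = (\<lambda>(j, s, i :: int). ennreal (of_bool (c \<and> t < j \<and> e0 * t < s)))"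
  define h2 where "h2 = (\<lambda>(j, s, i). ennreal (of_bool (j \<le> t \<and> e0 * j < s) * a i (t - j)))"
  define h3 where "h3 = (\<lambda>(j, s, i :: int). ennreal (of_bool (s \<le> e0 * t \<and> s / e0 \<le> j) * b (t - s / e0)))"
  have h1_meas [measurable]: "h1 \<in> borel_measurable (borel \<Otimes>\<^sub>M (borel \<Otimes>\<^sub>M count_space UNIV))"
    unfolding h1_def by measurable
  have a_joint: "(\<lambda>x. a (snd (snd x)) (t - fst x)) \<in> borel_measurable (borel \<Otimes>\<^sub>M (borel \<Otimes>\<^sub>M count_space UNIV))"
    by (rule measurable_compose_countable[where g = "\<lambda>x. snd (snd x)"]) measurable
  have h2_meas [measurable]: "h2 \<in> borel_measurable (borel \<Otimes>\<^sub>M (borel \<Otimes>\<^sub>M count_space UNIV))"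
  proof -
    have "(\<lambda>x :: real \<times> real \<times> int. of_bool (fst x \<le> t \<and> e0 * fst x < fst (snd x)) :: real)
      \<in> borel_measurable (borel \<Otimes>\<^sub>M (borel \<Otimes>\<^sub>M count_space UNIV))"
      by measurable
    from measurable_compose[OF borel_measurable_times[OF this a_joint] measurable_ennreal]
    show ?thesis unfolding h2_def case_prod_beta .
  qed
  have h3_meas [measurable]: "h3 \<in> borel_measurable (borel \<Otimes>\<^sub>M (borel \<Otimes>\<^sub>M count_space UNIV))"
  proof -
    have 1: "(\<lambda>x :: real \<times> real \<times> int. of_bool (fst (snd x) \<le> e0 * t \<and> fst (snd x) / e0 \<le> fst x) :: real)
      \<in> borel_measurable (borel \<Otimes>\<^sub>M (borel \<Otimes>\<^sub>M count_space UNIV))"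
      by measurable
    have 2: "(\<lambda>x :: real \<times> real \<times> int. b (t - fst (snd x) / e0))
      \<in> borel_measurable (borel \<Otimes>\<^sub>M (borel \<Otimes>\<^sub>M count_space UNIV))"
      by (rule measurable_compose[OF _ b_meas]) measurable
    from measurable_compose[OF borel_measurable_times[OF 1 2] measurable_ennreal]
    show ?thesis unfolding h3_def case_prod_beta .
  qed
  interpret CC: prob_space "clock_measure \<Otimes>\<^sub>M clock_measure"
    by (intro prob_space_pair prob_space_clock_measure)
  interpret CC': pair_sigma_finite clock_measure clock_measure ..
  have AE_CC: "AE x in clock_measure \<Otimes>\<^sub>M clock_measure. fst x \<in> positive_clocks \<and> snd x \<in> positive_clocks"
  proof -
    have "{x \<in> space (clock_measure \<Otimes>\<^sub>M clock_measure). fst x \<in> positive_clocks \<and> snd x \<in> positive_clocks}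
       \<in> sets (clock_measure \<Otimes>\<^sub>M clock_measure)"
      unfolding positive_clocks_def mem_Collect_eq insert_iff empty_iff by measurable
    then show ?thesis
    proof (rule CC'.AE_pair_measure)
      show "AE x in clock_measure. AE y in clock_measure. fst (x, y) \<in> positive_clocks \<and> snd (x, y) \<in> positive_clocks"
        using AE_positive_clocks by eventually_elim (simp add: AE_positive_clocks)
    qed
  qed
  have pre: "graft -` Y \<in> sets (segment_clock \<Otimes>\<^sub>M (clock_measure \<Otimes>\<^sub>M clock_measure))"
    using measurable_sets[OF measurable_graft Y] by (simp add: space_pair_measure)
  have "emeasure clock_measure Y = emeasure (segment_clock \<Otimes>\<^sub>M (clock_measure \<Otimes>\<^sub>M clock_measure)) (graft -` Y)"
    by (subst distr_graft[symmetric], subst emeasure_distr[OF measurable_graft Y])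
       (simp add: space_pair_measure)
  also have "\<dots> = (\<integral>\<^sup>+ r. emeasure (clock_measure \<Otimes>\<^sub>M clock_measure) (Pair r -` (graft -` Y)) \<partial>segment_clock)"
    by (rule CC.emeasure_pair_measure_alt[OF pre])
  also have "\<dots> = (\<integral>\<^sup>+ r. h1 r + h2 r + h3 r \<partial>segment_clock)"
  proof (rule nn_integral_cong_AE)
    show "AE r in segment_clock. emeasure (clock_measure \<Otimes>\<^sub>M clock_measure) (Pair r -` (graft -` Y)) = h1 r + h2 r + h3 r"
      using AE_segment_clock_pos
    proof eventually_elim
      case (elim r)
      obtain j s i where r: "r = (j, s, i)" by (cases r)
      have pos: "0 < j" "0 < s" "i \<in> {-1, 1}" using elim by (auto simp: r)
      define Z where "Z = (if t < min j (s / e0) then {x. c}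
         else if j < s / e0 then A i (t - j) \<times> UNIV
         else {(f, g). f \<in> B (t - s / e0) \<or> g \<in> B (t - s / e0)})"
      have Bs: "B s \<in> sets clock_measure" for s by (rule sets_section[OF B])
      have As: "A i s \<in> sets clock_measure" for i s by (rule sets_section[OF A])
      have Bs2: "{(f, g). f \<in> B s \<or> g \<in> B s} \<in> sets (clock_measure \<Otimes>\<^sub>M clock_measure)" for s
      proof -
        have "{(f, g). f \<in> B s \<or> g \<in> B s} = B s \<times> space clock_measure \<union> space clock_measure \<times> B s" by auto
        also have "\<dots> \<in> sets (clock_measure \<Otimes>\<^sub>M clock_measure)" by (intro sets.Un pair_measureI Bs sets.top)
        finally show ?thesis .
      qed
      have Z: "Z \<in> sets (clock_measure \<Otimes>\<^sub>M clock_measure)"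
      proof -
        have "{x :: clocks \<times> clocks. c} \<in> sets (clock_measure \<Otimes>\<^sub>M clock_measure)"
          using sets.top[of "clock_measure \<Otimes>\<^sub>M clock_measure"] by (cases c) (auto simp: space_pair_measure)
        moreover have "A i (t - j) \<times> UNIV \<in> sets (clock_measure \<Otimes>\<^sub>M clock_measure)"
          using pair_measureI[OF As sets.top[of clock_measure]] by simp
        ultimately show ?thesis using Bs2 by (simp add: Z_def)
      qed
      have "emeasure (clock_measure \<Otimes>\<^sub>M clock_measure) (Pair r -` (graft -` Y)) = emeasure (clock_measure \<Otimes>\<^sub>M clock_measure) Z"
      proof (rule emeasure_eq_AE)
        show "AE x in clock_measure \<Otimes>\<^sub>M clock_measure. (x \<in> Pair r -` (graft -` Y)) = (x \<in> Z)"
          using AE_CC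
        proof eventually_elim
          case (elim x)
          then show ?case using step[OF pos, of "fst x" "snd x"]
            by (cases x) (auto simp: r Z_def)
        qed
      qed (use Z sets_Pair1[OF pre] in auto)
      also have "\<dots> = h1 r + h2 r + h3 r"
      proof -
        have eq: "emeasure clock_measure (A i s) = ennreal (a i s)" for i s
          by (simp add: a_def C.emeasure_eq_measure)
        have sp: "UNIV = space (clock_measure \<Otimes>\<^sub>M clock_measure)" by (simp add: space_pair_measure)
        have 1: "emeasure (clock_measure \<Otimes>\<^sub>M clock_measure) {x. c} = ennreal (of_bool c)"
          using CC.emeasure_space_1 by (cases c) (auto simp: sp[symmetric])
        have 2: "emeasure (clock_measure \<Otimes>\<^sub>M clock_measure) (A i (t - j) \<times> UNIV) = ennreal (a i (t - j))"
          using C.emeasure_pair_measure_Times[OF As sets.top[of clock_measure]] C.emeasure_space_1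
          by (simp add: eq)
        have 3: "emeasure (clock_measure \<Otimes>\<^sub>M clock_measure) {(f, g). f \<in> B s \<or> g \<in> B s} = ennreal (b s)" for s
          using prob_union_of_copies[OF Bs] by (simp add: b_def)
        have lt: "t < s / e0 \<longleftrightarrow> e0 * t < s" "j < s / e0 \<longleftrightarrow> e0 * j < s"
          using e0 by (auto simp: field_simps)
        consider "t < j" "t < s / e0" | "j \<le> t" "j < s / e0" | "s / e0 \<le> t" "s / e0 \<le> j"
          by linarith
        then show ?thesis
        proof cases
          case 1
          then show ?thesis using lt \<open>emeasure _ {x. c} = _\<close> by (auto simp: Z_def h1_def h2_def h3_def r)
        next
          case 2
          then show ?thesis using lt \<open>emeasure _ (A i (t - j) \<times> UNIV) = _\<close> by (auto simp: Z_def h1_def h2_def h3_def r)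
        next
          case 3
          then show ?thesis using lt \<open>\<And>s. emeasure _ _ = ennreal (b s)\<close> by (auto simp: Z_def h1_def h2_def h3_def r)
        qed
      qed
      finally show ?case .
    qed
  qed
  also have "\<dots> = (\<integral>\<^sup>+ r. h1 r \<partial>segment_clock) + (\<integral>\<^sup>+ r. h2 r \<partial>segment_clock) + (\<integral>\<^sup>+ r. h3 r \<partial>segment_clock)"
    by (subst nn_integral_add; (subst nn_integral_add)?) auto
  also have "(\<integral>\<^sup>+ r. h1 r \<partial>segment_clock) = ennreal (if c then exp (- (1 + e0) * t) else 0)"
  proof -
    have "(\<integral>\<^sup>+ r. h1 r \<partial>segment_clock) = (\<integral>\<^sup>+ j. \<integral>\<^sup>+ s. ennreal (of_bool c) * indicator {t<..} j * indicator {e0 * t<..} s \<partial>unit_exponential \<partial>unit_exponential)"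
      by (subst nn_integral_segment_clock[OF h1_meas])
         (auto intro!: nn_integral_cong simp: h1_def ennreal_average simp del: ennreal_plus split: split_indicator)
    also have "\<dots> = (\<integral>\<^sup>+ j. (ennreal (of_bool c) * ennreal (exp (- (e0 * t)))) * indicator {t<..} j \<partial>unit_exponential)"
      using e0 t by (intro nn_integral_cong)
        (simp add: nn_integral_cmult_indicator emeasure_unit_exponential_greaterThan mult_ac)
    also have "\<dots> = ennreal (of_bool c) * ennreal (exp (- (e0 * t))) * ennreal (exp (- t))"
      using t by (simp add: nn_integral_cmult_indicator emeasure_unit_exponential_greaterThan)
    also have "\<dots> = ennreal (if c then exp (- (1 + e0) * t) else 0)"
      by (simp add: ennreal_mult[symmetric] exp_add[symmetric] algebra_simps)
    finally show ?thesis .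
  qed
  also have "(\<integral>\<^sup>+ r. h2 r \<partial>segment_clock) = (\<integral>\<^sup>+ \<sigma>. ennreal (exp (- (1 + e0) * (t - \<sigma>)) * ((a 1 \<sigma> + a (- 1) \<sigma>) / 2)) * indicator {0..t} \<sigma> \<partial>lborel)"
  proof -
    have "(\<integral>\<^sup>+ r. h2 r \<partial>segment_clock) = (\<integral>\<^sup>+ j. \<integral>\<^sup>+ s. (ennreal ((a 1 (t - j) + a (- 1) (t - j)) / 2) * indicator {..t} j) * indicator {e0 * j<..} s \<partial>unit_exponential \<partial>unit_exponential)"
      by (subst nn_integral_segment_clock[OF h2_meas])
         (auto intro!: nn_integral_cong simp: h2_def a_bounds ennreal_average simp del: ennreal_plus split: split_indicator)
    also have "\<dots> = (\<integral>\<^sup>+ j. (ennreal ((a 1 (t - j) + a (- 1) (t - j)) / 2) * indicator {..t} j) * emeasure unit_exponential {e0 * j<..} \<partial>unit_exponential)"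
      by (intro nn_integral_cong nn_integral_cmult_indicator) simp
    also have "\<dots> = (\<integral>\<^sup>+ j. (ennreal ((a 1 (t - j) + a (- 1) (t - j)) / 2) * indicator {..t} j) * ennreal (exp (- (e0 * j))) \<partial>unit_exponential)"
      using AE_unit_exponential_pos e0
      by (intro nn_integral_cong_AE) (auto elim!: eventually_mono simp: emeasure_unit_exponential_greaterThan)
    also have "\<dots> = (\<integral>\<^sup>+ j. ennreal (exp (- (1 + e0) * j) * ((a 1 (t - j) + a (- 1) (t - j)) / 2)) * indicator {0..1 * t} j \<partial>lborel)"
    proof -
      have "exp (- (1 + e0) * j) = exp (- j) * exp (- (e0 * j))" for j
        by (simp add: exp_add[symmetric] algebra_simps)
      then show ?thesis
        by (subst nn_integral_unit_exponential)
           (auto intro!: nn_integral_cong simp: ennreal_mult[symmetric] a_bounds mult_ac simp del: mult_minus_left split: split_indicator)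
    qed
    also have "\<dots> = (\<integral>\<^sup>+ \<sigma>. ennreal (exp (- (1 + e0) * (t - \<sigma>)) * ((a 1 \<sigma> + a (- 1) \<sigma>) / 2)) * indicator {0..t} \<sigma> \<partial>lborel)"
      using nn_integral_reflect_scale[of 1 t "\<lambda>j. ennreal (exp (- (1 + e0) * j) * ((a 1 (t - j) + a (- 1) (t - j)) / 2))"] t
      by (simp del: mult_minus_left)
    finally show ?thesis .
  qed
  also have "(\<integral>\<^sup>+ r. h3 r \<partial>segment_clock) = (\<integral>\<^sup>+ \<sigma>. ennreal (exp (- (1 + e0) * (t - \<sigma>)) * (e0 * b \<sigma>)) * indicator {0..t} \<sigma> \<partial>lborel)"
  proof -
    interpret E: prob_space unit_exponential by (rule prob_space_unit_exponential)
    interpret EE: pair_sigma_finite unit_exponential unit_exponential ..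
    have "(\<integral>\<^sup>+ r. h3 r \<partial>segment_clock) = (\<integral>\<^sup>+ j. \<integral>\<^sup>+ s. (ennreal (b (t - s / e0)) * indicator {..e0 * t} s) * indicator {s / e0..} j \<partial>unit_exponential \<partial>unit_exponential)"
      by (subst nn_integral_segment_clock[OF h3_meas])
         (auto intro!: nn_integral_cong simp: h3_def b_bounds ennreal_average simp del: ennreal_plus split: split_indicator)
    also have "\<dots> = (\<integral>\<^sup>+ s. \<integral>\<^sup>+ j. (ennreal (b (t - s / e0)) * indicator {..e0 * t} s) * indicator {s / e0..} j \<partial>unit_exponential \<partial>unit_exponential)"
    proof (rule EE.Fubini')
      have "(\<lambda>x. (ennreal (b (t - fst x / e0)) * indicator {..e0 * t} (fst x)) * (if fst x / e0 \<le> snd x then 1 else 0))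
         \<in> borel_measurable (unit_exponential \<Otimes>\<^sub>M unit_exponential)"
        by measurable
      also have "(\<lambda>x. (ennreal (b (t - fst x / e0)) * indicator {..e0 * t} (fst x)) * (if fst x / e0 \<le> snd x then 1 else 0))
        = (\<lambda>(s, j). (ennreal (b (t - s / e0)) * indicator {..e0 * t} s) * indicator {s / e0..} j)"
        by (auto simp: fun_eq_iff split: split_indicator)
      finally show "(\<lambda>(s, j). (ennreal (b (t - s / e0)) * indicator {..e0 * t} s) * indicator {s / e0..} j)
         \<in> borel_measurable (unit_exponential \<Otimes>\<^sub>M unit_exponential)" .
    qed
    also have "\<dots> = (\<integral>\<^sup>+ s. (ennreal (b (t - s / e0)) * indicator {..e0 * t} s) * emeasure unit_exponential {s / e0..} \<partial>unit_exponential)"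
      by (intro nn_integral_cong nn_integral_cmult_indicator) simp
    also have "\<dots> = (\<integral>\<^sup>+ s. (ennreal (b (t - s / e0)) * indicator {..e0 * t} s) * ennreal (exp (- (s / e0))) \<partial>unit_exponential)"
      using AE_unit_exponential_pos e0
      by (intro nn_integral_cong_AE) (auto elim!: eventually_mono simp: emeasure_unit_exponential_atLeast)
    also have "\<dots> = (\<integral>\<^sup>+ s. ennreal (exp (- s - s / e0) * b (t - s / e0)) * indicator {0..e0 * t} s \<partial>lborel)"
    proof -
      have "exp (- s - s / e0) = exp (- s) * exp (- (s / e0))" for s
        by (simp add: exp_add[symmetric])
      then show ?thesis
        by (subst nn_integral_unit_exponential)
           (auto intro!: nn_integral_cong simp: ennreal_mult[symmetric] b_bounds mult_ac split: split_indicator)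
    qed
    also have "\<dots> = (\<integral>\<^sup>+ \<sigma>. ennreal (exp (- (1 + e0) * (t - \<sigma>)) * (e0 * b \<sigma>)) * indicator {0..t} \<sigma> \<partial>lborel)"
    proof -
      have cancel: "e0 * (t - \<sigma>) / e0 = t - \<sigma>" for \<sigma> using e0 by simp
      have arg: "- (e0 * (t - \<sigma>)) - e0 * (t - \<sigma>) / e0 = - (1 + e0) * (t - \<sigma>)" "t - e0 * (t - \<sigma>) / e0 = \<sigma>" for \<sigma>
        unfolding cancel by (simp_all add: algebra_simps)
      have "(\<integral>\<^sup>+ s. ennreal (exp (- s - s / e0) * b (t - s / e0)) * indicator {0..e0 * t} s \<partial>lborel)
        = (\<integral>\<^sup>+ \<sigma>. ennreal e0 * ennreal (exp (- (e0 * (t - \<sigma>)) - e0 * (t - \<sigma>) / e0) * b (t - e0 * (t - \<sigma>) / e0)) * indicator {0..t} \<sigma> \<partial>lborel)"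
        by (rule nn_integral_reflect_scale[OF e0 t]) measurable
      also have "\<dots> = (\<integral>\<^sup>+ \<sigma>. ennreal (exp (- (1 + e0) * (t - \<sigma>)) * (e0 * b \<sigma>)) * indicator {0..t} \<sigma> \<partial>lborel)"
        unfolding arg using e0 by (intro nn_integral_cong) (simp add: ennreal_mult[symmetric] b_bounds mult_ac del: mult_minus_left)
      finally show ?thesis .
    qed
    finally show ?thesis .
  qed
  finally have eY: "emeasure clock_measure Y = ennreal (if c then exp (- (1 + e0) * t) else 0)
      + (\<integral>\<^sup>+ \<sigma>. ennreal (exp (- (1 + e0) * (t - \<sigma>)) * ((a 1 \<sigma> + a (- 1) \<sigma>) / 2)) * indicator {0..t} \<sigma> \<partial>lborel)
      + (\<integral>\<^sup>+ \<sigma>. ennreal (exp (- (1 + e0) * (t - \<sigma>)) * (e0 * b \<sigma>)) * indicator {0..t} \<sigma> \<partial>lborel)" .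
  define q where "q \<sigma> = exp (- (1 + e0) * (t - \<sigma>)) * ((a 1 \<sigma> + a (- 1) \<sigma>) / 2 + e0 * b \<sigma>)" for \<sigma>
  have q_meas [measurable]: "q \<in> borel_measurable borel"
    unfolding q_def by measurable
  have q_nonneg: "0 \<le> q \<sigma>" for \<sigma>
    using a_bounds(1)[of 1 \<sigma>] a_bounds(1)[of "-1" \<sigma>] b_bounds(1)[of \<sigma>] e0 by (simp add: q_def)
  have q_le: "q \<sigma> \<le> 1 + e0" if "\<sigma> \<in> {0..t}" for \<sigma>
  proof -
    have "(1 + e0) * (t - \<sigma>) \<ge> 0" using that e0 by simp
    then have "- (1 + e0) * (t - \<sigma>) \<le> 0" unfolding mult_minus_left by linarith
    then have 1: "exp (- (1 + e0) * (t - \<sigma>)) \<le> 1" unfolding exp_le_one_iff .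
    have "e0 * b \<sigma> \<le> e0" using b_bounds[of \<sigma>] e0 by simp
    moreover have "(a 1 \<sigma> + a (- 1) \<sigma>) / 2 \<le> 1"
      using a_bounds(2)[of 1 \<sigma>] a_bounds(2)[of "-1" \<sigma>] by simp
    ultimately have 2: "(a 1 \<sigma> + a (- 1) \<sigma>) / 2 + e0 * b \<sigma> \<le> 1 + e0"
      by (rule add_mono[rotated])
    show ?thesis
      unfolding q_def using mult_mono[OF 1 2] a_bounds(1)[of 1 \<sigma>] a_bounds(1)[of "-1" \<sigma>] b_bounds(1)[of \<sigma>] e0
      by (simp del: mult_minus_left)
  qed
  have "emeasure clock_measure Y = ennreal (if c then exp (- (1 + e0) * t) else 0)
      + (\<integral>\<^sup>+ \<sigma>. ennreal (indicator {0..t} \<sigma> *\<^sub>R q \<sigma>) \<partial>lborel)"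
  proof -
    have "(\<integral>\<^sup>+ \<sigma>. ennreal (exp (- (1 + e0) * (t - \<sigma>)) * ((a 1 \<sigma> + a (- 1) \<sigma>) / 2)) * indicator {0..t} \<sigma> \<partial>lborel)
      + (\<integral>\<^sup>+ \<sigma>. ennreal (exp (- (1 + e0) * (t - \<sigma>)) * (e0 * b \<sigma>)) * indicator {0..t} \<sigma> \<partial>lborel)
      = (\<integral>\<^sup>+ \<sigma>. ennreal (exp (- (1 + e0) * (t - \<sigma>)) * ((a 1 \<sigma> + a (- 1) \<sigma>) / 2)) * indicator {0..t} \<sigma>
         + ennreal (exp (- (1 + e0) * (t - \<sigma>)) * (e0 * b \<sigma>)) * indicator {0..t} \<sigma> \<partial>lborel)"
      by (rule nn_integral_add[symmetric]) measurable
    also have "\<dots> = (\<integral>\<^sup>+ \<sigma>. ennreal (indicator {0..t} \<sigma> *\<^sub>R q \<sigma>) \<partial>lborel)"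
    proof (intro nn_integral_cong)
      fix \<sigma>
      show "ennreal (exp (- (1 + e0) * (t - \<sigma>)) * ((a 1 \<sigma> + a (- 1) \<sigma>) / 2)) * indicator {0..t} \<sigma>
         + ennreal (exp (- (1 + e0) * (t - \<sigma>)) * (e0 * b \<sigma>)) * indicator {0..t} \<sigma>
         = ennreal (indicator {0..t} \<sigma> *\<^sub>R q \<sigma>)"
        using a_bounds(1)[of 1 \<sigma>] a_bounds(1)[of "-1" \<sigma>] b_bounds(1)[of \<sigma>] e0
        by (cases "\<sigma> \<in> {0..t}")
          (simp_all only: q_def distrib_left indicator_simps mult_1_right mult_zero_right scaleR_one scaleR_zero_left
             add_0 ennreal_0, simp_all del: mult_minus_left add: ennreal_plus[symmetric] del: ennreal_plus)
    qed
    finally show ?thesis unfolding eY add.assoc by simp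
  qed
  also have "(\<integral>\<^sup>+ \<sigma>. ennreal (indicator {0..t} \<sigma> *\<^sub>R q \<sigma>) \<partial>lborel) = ennreal (LBINT \<sigma>:{0..t}. q \<sigma>)"
    unfolding set_lebesgue_integral_def
  proof (rule nn_integral_eq_integral)
    show "integrable lborel (\<lambda>\<sigma>. indicator {0..t} \<sigma> *\<^sub>R q \<sigma>)"
      using set_integrable_bounded_Icc[OF q_meas, of 0 t "1 + e0"] q_le q_nonneg
      unfolding set_integrable_def by simp
    show "AE \<sigma> in lborel. 0 \<le> indicator {0..t} \<sigma> *\<^sub>R q \<sigma>"
      using q_nonneg by auto
  qed
  also have "ennreal (if c then exp (- (1 + e0) * t) else 0) + ennreal (LBINT \<sigma>:{0..t}. q \<sigma>)
    = ennreal ((if c then exp (- (1 + e0) * t) else 0) + (LBINT \<sigma>:{0..t}. q \<sigma>))"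
    by (rule ennreal_plus[symmetric]) (auto simp: set_lebesgue_integral_def q_nonneg intro!: Bochner_Integration.integral_nonneg)
  finally have "C.prob Y = (if c then exp (- (1 + e0) * t) else 0) + (LBINT \<sigma>:{0..t}. q \<sigma>)"
    unfolding C.emeasure_eq_measure
    by (subst (asm) ennreal_inj) (auto simp: set_lebesgue_integral_def q_nonneg intro!: add_nonneg_nonneg Bochner_Integration.integral_nonneg)
  then show ?thesis by (simp add: q_def a_def b_def)
qed

section \<open>Integral equations for hitting and occupation\<close>

text \<open>
  The environment seen from \<open>x\<close>. As every process starts at site \<open>0\<close>, a start at \<open>x\<close> is expressed by
  moving the environment, and levels become relative to \<open>x\<close>.
\<close>

definition recentre :: "(int \<Rightarrow> real) \<Rightarrow> int \<Rightarrow> int \<Rightarrow> real"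
  where "recentre e x = (\<lambda>i. e (x + i))"

lemma recentre_simps [simp]:
  "recentre e x i = e (x + i)" "recentre (recentre e x) i = recentre e (x + i)" "recentre e 0 = e"
  by (auto simp: recentre_def add.assoc)

lemma graft_subtree [simp]: "(\<lambda>v. graft (r, f, g) (v @ [b])) = (if b then g else f)"
  by (cases b) auto

lemma graft_root_clocks [simp]:
  "jump_clock (graft ((j, s, i), f, g)) [] = j"
  "split_clock (graft ((j, s, i), f, g)) [] = s"
  "jump_step (graft ((j, s, i), f, g)) [] = i"
  by (simp_all add: jump_clock_def split_clock_def jump_step_def)

lemma graft_subtree_clocks [simp]:
  "jump_clock (graft (r, f, g)) (u @ [b]) = jump_clock (if b then g else f) u"
  "split_clock (graft (r, f, g)) (u @ [b]) = split_clock (if b then g else f) u"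
  by (cases b; simp add: jump_clock_def split_clock_def)+

lemma segment_graft:
  "segment e (graft ((j, s, i), f, g)) (u @ [b]) =
    (if j < s / e 0
     then (if b then None else map_option (\<lambda>(a, y). (j + a, i + y)) (segment (recentre e i) f u))
     else map_option (\<lambda>(a, y). (s / e 0 + a, y)) (segment e (if b then g else f) u))"
  by (simp add: segment_snoc recentre_def)

lemma born_graft:
  "segment e (graft ((j, s, i), f, g)) (u @ [b]) = None \<longleftrightarrow>
    (if j < s / e 0 then b \<or> segment (recentre e i) f u = None else segment e (if b then g else f) u = None)"
  by (simp add: segment_graft)

lemma birth_graft:
  assumes "segment e (graft ((j, s, i), f, g)) (u @ [b]) \<noteq> None"
  shows "birth e (graft ((j, s, i), f, g)) (u @ [b]) =
    (if j < s / e 0 then j + birth (recentre e i) f u else s / e 0 + birth e (if b then g else f) u)"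
  using assms by (auto simp: segment_graft birth_def split: if_splits)

lemma site_graft:
  assumes "segment e (graft ((j, s, i), f, g)) (u @ [b]) \<noteq> None"
  shows "site e (graft ((j, s, i), f, g)) (u @ [b]) =
    (if j < s / e 0 then i + site (recentre e i) f u else site e (if b then g else f) u)"
  using assms by (auto simp: segment_graft site_def split: if_splits)

lemma root_simps [simp]: "segment e \<omega> [] \<noteq> None" "birth e \<omega> [] = 0" "site e \<omega> [] = 0"
  by (auto simp: birth_def site_def)

lemma ex_word_iff: "(\<exists>u :: bool list. \<Phi> u) \<longleftrightarrow> \<Phi> [] \<or> (\<exists>u. \<Phi> (u @ [False])) \<or> (\<exists>u. \<Phi> (u @ [True]))"
  by (metis (full_types) rev_exhaust)

lemma birth_nonneg:
  assumes "\<omega> \<in> positive_clocks" "\<And>i. 0 < e i" "segment e \<omega> u \<noteq> None"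
  shows "0 \<le> birth e \<omega> u"
  using assms(3)
proof (induction u)
  case (Cons b u)
  have "segment e \<omega> u \<noteq> None" using Cons.prems unfolding born_Cons by (rule conjunct1)
  then have "0 \<le> birth e \<omega> u" by (rule Cons.IH)
  moreover have "0 < jump_clock \<omega> u" "0 < split_clock \<omega> u / e (site e \<omega> u)"
    using assms(1,2) by (auto simp: positive_clocks_def)
  ultimately show ?case using Cons.prems by (auto simp: birth_Cons)
qed simp

lemma nothing_before_time_zero:
  assumes "\<omega> \<in> positive_clocks" "\<And>i. 0 < e i" "t < 0"
  shows "\<omega> \<notin> reached e k t" "\<omega> \<notin> occupied e k t" "\<omega> \<notin> generation e n t"
proof -
  have "\<not> birth e \<omega> u \<le> t" if "segment e \<omega> u \<noteq> None" for u
    using birth_nonneg[OF assms(1,2) that] assms(3) by simp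
  then show "\<omega> \<notin> reached e k t" "\<omega> \<notin> occupied e k t" "\<omega> \<notin> generation e n t"
    unfolding reached_def occupied_def generation_def particles_iff by blast+
qed

lemma reached_graft:
  assumes "\<And>i. 0 < e i" "0 < j" "0 < s" "f \<in> positive_clocks" "g \<in> positive_clocks" "0 < k"
  shows "graft ((j, s, i), f, g) \<in> reached e k t \<longleftrightarrow>
    (if t < min j (s / e 0) then False
     else if j < s / e 0 then f \<in> reached (recentre e i) (k - i) (t - j)
     else f \<in> reached e k (t - s / e 0) \<or> g \<in> reached e k (t - s / e 0))"
proof -
  have "graft ((j, s, i), f, g) \<in> reached e k t \<longleftrightarrow>
    (if j < s / e 0 then f \<in> reached (recentre e i) (k - i) (t - j)
     else f \<in> reached e k (t - s / e 0) \<or> g \<in> reached e k (t - s / e 0))"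
    unfolding reached_def mem_Collect_eq
    apply (subst ex_word_iff)
    using assms(6)
    by (auto simp: born_graft birth_graft site_graft algebra_simps cong: conj_cong)
  moreover have "\<not> (if j < s / e 0 then f \<in> reached (recentre e i) (k - i) (t - j)
     else f \<in> reached e k (t - s / e 0) \<or> g \<in> reached e k (t - s / e 0))" if "t < min j (s / e 0)"
    using that nothing_before_time_zero[of f "recentre e i" "t - j"] nothing_before_time_zero[of f e "t - s / e 0"]
      nothing_before_time_zero[of g e "t - s / e 0"] assms(1,4,5) by simp
  ultimately show ?thesis by auto
qed

lemma occupied_graft:
  assumes "\<And>i. 0 < e i" "0 < j" "0 < s" "f \<in> positive_clocks" "g \<in> positive_clocks" "0 \<le> t"
  shows "graft ((j, s, i), f, g) \<in> occupied e k t \<longleftrightarrow>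
    (if t < min j (s / e 0) then k \<le> 0
     else if j < s / e 0 then f \<in> occupied (recentre e i) (k - i) (t - j)
     else f \<in> occupied e k (t - s / e 0) \<or> g \<in> occupied e k (t - s / e 0))"
proof -
  have "graft ((j, s, i), f, g) \<in> occupied e k t \<longleftrightarrow> t < min j (s / e 0) \<and> k \<le> 0 \<or>
    (if j < s / e 0 then f \<in> occupied (recentre e i) (k - i) (t - j)
     else f \<in> occupied e k (t - s / e 0) \<or> g \<in> occupied e k (t - s / e 0))"
    unfolding occupied_def mem_Collect_eq particles_iff
    apply (subst ex_word_iff)
    using assms(6)
    by (auto simp: born_graft birth_graft site_graft algebra_simps cong: conj_cong)
  moreover have "\<not> (if j < s / e 0 then f \<in> occupied (recentre e i) (k - i) (t - j)
     else f \<in> occupied e k (t - s / e 0) \<or> g \<in> occupied e k (t - s / e 0))" if "t < min j (s / e 0)"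
    using that nothing_before_time_zero[of f "recentre e i" "t - j"] nothing_before_time_zero[of f e "t - s / e 0"]
      nothing_before_time_zero[of g e "t - s / e 0"] assms(1,4,5) by simp
  ultimately show ?thesis by auto
qed

lemma generation_graft:
  assumes "\<And>i. 0 < e i" "0 < j" "0 < s" "f \<in> positive_clocks" "g \<in> positive_clocks"
  shows "graft ((j, s, i), f, g) \<in> generation e (Suc n) t \<longleftrightarrow>
    (if t < min j (s / e 0) then False
     else if j < s / e 0 then f \<in> generation (recentre e i) n (t - j)
     else f \<in> generation e n (t - s / e 0) \<or> g \<in> generation e n (t - s / e 0))"
proof -
  have "graft ((j, s, i), f, g) \<in> generation e (Suc n) t \<longleftrightarrow>
    (if j < s / e 0 then f \<in> generation (recentre e i) n (t - j)
     else f \<in> generation e n (t - s / e 0) \<or> g \<in> generation e n (t - s / e 0))"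
    unfolding generation_def mem_Collect_eq
    apply (subst ex_word_iff)
    by (auto simp: born_graft birth_graft algebra_simps cong: conj_cong)
  moreover have "\<not> (if j < s / e 0 then f \<in> generation (recentre e i) n (t - j)
     else f \<in> generation e n (t - s / e 0) \<or> g \<in> generation e n (t - s / e 0))" if "t < min j (s / e 0)"
    using that nothing_before_time_zero[of f "recentre e i" "t - j"] nothing_before_time_zero[of f e "t - s / e 0"]
      nothing_before_time_zero[of g e "t - s / e 0"] assms(1,4,5) by simp
  ultimately show ?thesis by auto
qed

text \<open>
  Probabilities for a process started at \<open>x\<close>, with \<open>z\<close> an absolute level.
\<close>

definition hit_prob :: "(int \<Rightarrow> real) \<Rightarrow> int \<Rightarrow> int \<Rightarrow> real \<Rightarrow> real"
  where "hit_prob e z x t = C.prob (reached (recentre e x) (z - x) t)"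

definition occ_prob :: "(int \<Rightarrow> real) \<Rightarrow> int \<Rightarrow> int \<Rightarrow> real \<Rightarrow> real"
  where "occ_prob e z x t = C.prob (occupied (recentre e x) (z - x) t)"

definition gen_prob :: "(int \<Rightarrow> real) \<Rightarrow> nat \<Rightarrow> int \<Rightarrow> real \<Rightarrow> real"
  where "gen_prob e n x t = C.prob (generation (recentre e x) n t)"

text \<open>
  The inhomogeneity of the equation: a jump leads to the average over the neighbours, a split to the
  probability that one of two independent copies succeeds. \<open>mild e V\<close> is the Duhamel integral of this
  source against the exponential law of the first event; fixed points of \<open>mild e\<close> are solutions of a
  Fisher-KPP equation with discrete Laplacian.
\<close>

definition source :: "(int \<Rightarrow> real) \<Rightarrow> (int \<Rightarrow> real \<Rightarrow> real) \<Rightarrow> int \<Rightarrow> real \<Rightarrow> real"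
  where "source e V x s = (V (x + 1) s + V (x - 1) s) / 2 + e x * (2 * V x s - (V x s)\<^sup>2)"

definition mild :: "(int \<Rightarrow> real) \<Rightarrow> (int \<Rightarrow> real \<Rightarrow> real) \<Rightarrow> int \<Rightarrow> real \<Rightarrow> real"
  where "mild e V x t = (LBINT s:{0..t}. exp (- (1 + e x) * (t - s)) * source e V x s)"

lemmas sets_reached [measurable] = sets_section[OF measurable_reached]
lemmas sets_occupied [measurable] = sets_section[OF measurable_occupied]
lemmas sets_generation [measurable] = sets_section[OF measurable_generation]

lemma hit_prob_mild:
  assumes "\<And>i. 0 < e i" "0 \<le> t" "x < z"
  shows "hit_prob e z x t = mild e (hit_prob e z) x t"
proof -
  have "hit_prob e z x t = (if False then exp (- (1 + e x) * t) else 0)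
    + (LBINT \<sigma>:{0..t}. exp (- (1 + e x) * (t - \<sigma>)) *
        ((C.prob (reached (recentre e (x + 1)) (z - (x + 1)) \<sigma>) + C.prob (reached (recentre e (x + - 1)) (z - (x + - 1)) \<sigma>)) / 2
        + e x * (2 * C.prob (reached (recentre e x) (z - x) \<sigma>) - (C.prob (reached (recentre e x) (z - x) \<sigma>))\<^sup>2)))"
    unfolding hit_prob_def
    by (rule first_step[where A = "\<lambda>i. reached (recentre e (x + i)) (z - (x + i))"])
       (use assms in \<open>auto simp: measurable_reached sets_reached reached_graft diff_diff_eq\<close>)
  then show ?thesis
    by (simp add: mild_def source_def hit_prob_def)
qed

lemma occ_prob_mild:
  assumes "\<And>i. 0 < e i" "0 \<le> t"
  shows "occ_prob e z x t = (if z \<le> x then exp (- (1 + e x) * t) else 0) + mild e (occ_prob e z) x t"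
proof -
  have "occ_prob e z x t = (if z \<le> x then exp (- (1 + e x) * t) else 0)
    + (LBINT \<sigma>:{0..t}. exp (- (1 + e x) * (t - \<sigma>)) *
        ((C.prob (occupied (recentre e (x + 1)) (z - (x + 1)) \<sigma>) + C.prob (occupied (recentre e (x + - 1)) (z - (x + - 1)) \<sigma>)) / 2
        + e x * (2 * C.prob (occupied (recentre e x) (z - x) \<sigma>) - (C.prob (occupied (recentre e x) (z - x) \<sigma>))\<^sup>2)))"
    unfolding occ_prob_def
    by (rule first_step[where A = "\<lambda>i. occupied (recentre e (x + i)) (z - (x + i))"])
       (use assms in \<open>auto simp: measurable_occupied sets_occupied occupied_graft diff_diff_eq\<close>)
  then show ?thesis
    by (simp add: mild_def source_def occ_prob_def)
qed

lemma gen_prob_mild: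
  assumes "\<And>i. 0 < e i" "0 \<le> t"
  shows "gen_prob e (Suc n) x t = mild e (gen_prob e n) x t"
proof -
  have "gen_prob e (Suc n) x t = (if False then exp (- (1 + e x) * t) else 0)
    + (LBINT \<sigma>:{0..t}. exp (- (1 + e x) * (t - \<sigma>)) *
        ((C.prob (generation (recentre e (x + 1)) n \<sigma>) + C.prob (generation (recentre e (x + - 1)) n \<sigma>)) / 2
        + e x * (2 * C.prob (generation (recentre e x) n \<sigma>) - (C.prob (generation (recentre e x) n \<sigma>))\<^sup>2)))"
    unfolding gen_prob_def
    by (rule first_step[where A = "\<lambda>i. generation (recentre e (x + i)) n"])
       (use assms in \<open>auto simp: measurable_generation sets_generation generation_graft diff_diff_eq\<close>)
  then show ?thesis
    by (simp add: mild_def source_def gen_prob_def)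
qed

lemma hit_prob_measurable [measurable]: "hit_prob e z x \<in> borel_measurable borel"
  unfolding hit_prob_def[abs_def] by (rule measurable_prob_section[OF measurable_reached])

lemma occ_prob_measurable [measurable]: "occ_prob e z x \<in> borel_measurable borel"
  unfolding occ_prob_def[abs_def] by (rule measurable_prob_section[OF measurable_occupied])

lemma gen_prob_measurable [measurable]: "gen_prob e n x \<in> borel_measurable borel"
  unfolding gen_prob_def[abs_def] by (rule measurable_prob_section[OF measurable_generation])

lemma hit_prob_bounds: "0 \<le> hit_prob e z x t" "hit_prob e z x t \<le> 1"
  and occ_prob_bounds: "0 \<le> occ_prob e z x t" "occ_prob e z x t \<le> 1"
  and gen_prob_bounds: "0 \<le> gen_prob e n x t" "gen_prob e n x t \<le> 1"
  by (auto simp: hit_prob_def occ_prob_def gen_prob_def)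

lemma hit_prob_mono: "s \<le> t \<Longrightarrow> hit_prob e z x s \<le> hit_prob e z x t"
  unfolding hit_prob_def
  by (rule C.finite_measure_mono[OF _ sets_reached]) (auto simp: reached_def intro: order_trans)

lemma hit_prob_antimono: "z \<le> z' \<Longrightarrow> hit_prob e z' x t \<le> hit_prob e z x t"
  unfolding hit_prob_def
  by (rule C.finite_measure_mono[OF _ sets_reached]) (fastforce simp: reached_def)

lemma hit_prob_past:
  assumes "z \<le> x" "0 \<le> t"
  shows "hit_prob e z x t = 1"
proof -
  have "reached (recentre e x) (z - x) t = space clock_measure"
    using assms by (auto simp: reached_def intro!: exI[of _ "[]"])
  then show ?thesis by (simp add: hit_prob_def C.prob_space del: space_clock_measure)
qed

lemma hit_prob_negative:
  assumes "\<And>i. 0 < e i" "t < 0"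
  shows "hit_prob e z x t = 0"
proof -
  have "AE \<omega> in clock_measure. \<omega> \<notin> reached (recentre e x) (z - x) t"
    using AE_positive_clocks
  proof eventually_elim
    case (elim \<omega>)
    then show ?case using birth_nonneg[of \<omega> "recentre e x"] assms by (force simp: reached_def)
  qed
  then show ?thesis
    unfolding hit_prob_def by (subst C.prob_eq_0[OF sets_reached])
qed

lemma occ_prob_le_hit_prob: "occ_prob e z x t \<le> hit_prob e z x t"
  unfolding hit_prob_def occ_prob_def
  by (rule C.finite_measure_mono[OF _ sets_reached]) (auto simp: reached_def occupied_def particles_iff)

section \<open>Comparison principle\<close>

locale bounded_rates =
  fixes e :: "int \<Rightarrow> real" and a b :: real
  assumes a_pos: "0 < a" and lower: "a \<le> e x" and upper: "e x \<le> b"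
begin

lemma e_pos: "0 < e x"
  using a_pos lower[of x] by linarith

lemma b_pos: "0 < b"
  using e_pos[of 0] upper[of 0] by linarith

end

definition prob_field :: "(int \<Rightarrow> real \<Rightarrow> real) \<Rightarrow> bool"
  where "prob_field V \<longleftrightarrow> (\<forall>x. V x \<in> borel_measurable borel \<and> (\<forall>t. 0 \<le> V x t \<and> V x t \<le> 1))"

lemma prob_fieldD:
  assumes "prob_field V"
  shows "V x \<in> borel_measurable borel" "0 \<le> V x t" "V x t \<le> 1"
  using assms by (auto simp: prob_field_def)

lemma splitting_nonneg: "0 \<le> v \<Longrightarrow> v \<le> 1 \<Longrightarrow> 0 \<le> 2 * v - v\<^sup>2" for v :: real
proof -
  assume "0 \<le> v" "v \<le> 1"
  then have "0 \<le> v * (2 - v)" by simp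
  then show ?thesis by (simp add: power2_eq_square algebra_simps)
qed

lemma splitting_le_1: "2 * v - v\<^sup>2 \<le> 1" for v :: real
  using zero_le_power2[of "1 - v"] by (simp add: power2_eq_square algebra_simps)

lemma splitting_mono: "0 \<le> v \<Longrightarrow> v \<le> w \<Longrightarrow> w \<le> 1 \<Longrightarrow> 2 * v - v\<^sup>2 \<le> 2 * w - w\<^sup>2" for v w :: real
proof -
  assume "0 \<le> v" "v \<le> w" "w \<le> 1"
  then have "0 \<le> (w - v) * (2 - v - w)" by (intro mult_nonneg_nonneg) auto
  then show ?thesis by (simp add: power2_eq_square algebra_simps)
qed

lemma power_over_fact_tendsto_0: "(\<lambda>n. (r :: real) ^ n / fact n) \<longlonglongrightarrow> 0"
  using summable_LIMSEQ_zero[OF summable_exp[of r]] by (simp add: divide_inverse mult.commute)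

lemma LBINT_exp_le:
  fixes r t :: real assumes "0 < r" "0 \<le> t"
  shows "(LBINT s:{0..t}. exp (- r * (t - s))) \<le> 1 / r"
proof -
  have "(\<integral>s. exp (- r * (t - s)) * indicator {0..t} s \<partial>lborel) = exp (- r * (t - t)) / r - exp (- r * (t - 0)) / r"
    using assms
    by (intro integral_FTC_Icc_real[where F = "\<lambda>s. exp (- r * (t - s)) / r"])
       (auto intro!: derivative_eq_intros continuous_intros)
  then show ?thesis
    using assms by (simp add: set_lebesgue_integral_def mult.commute divide_right_mono)
qed

context bounded_rates
begin

lemma source_bounds:
  assumes "prob_field V"
  shows "0 \<le> source e V x s" "source e V x s \<le> 1 + e x"
proof -
  note V = prob_fieldD[OF assms]
  show "0 \<le> source e V x s"
    unfolding source_def using V e_pos[of x]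
    by (intro add_nonneg_nonneg mult_nonneg_nonneg splitting_nonneg) (auto intro: less_imp_le)
  have "e x * (2 * V x s - (V x s)\<^sup>2) \<le> e x * 1"
    using e_pos[of x] by (intro mult_left_mono splitting_le_1) auto
  moreover have "(V (x + 1) s + V (x - 1) s) / 2 \<le> 1"
    using V(3)[of "x + 1" s] V(3)[of "x - 1" s] by simp
  ultimately show "source e V x s \<le> 1 + e x"
    unfolding source_def by (intro add_mono) simp_all
qed

lemma source_measurable:
  assumes "prob_field V" shows "source e V x \<in> borel_measurable borel"
proof -
  note prob_fieldD(1)[OF assms, measurable]
  show ?thesis unfolding source_def[abs_def] by measurable
qed

lemma discount_le_1: "s \<le> t \<Longrightarrow> exp (- (1 + e x) * (t - s)) \<le> 1"
  using e_pos[of x] by (simp only: exp_le_one_iff mult_minus_left neg_le_0_iff_le) simp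

lemma mild_integrable:
  assumes "F \<in> borel_measurable borel" "\<And>s. s \<in> {c..t} \<Longrightarrow> \<bar>F s\<bar> \<le> K"
  shows "set_integrable lborel {c..t} (\<lambda>s. exp (- (1 + e x) * (t - s)) * F s)"
proof (rule set_integrable_bounded_Icc)
  show "(\<lambda>s. exp (- (1 + e x) * (t - s)) * F s) \<in> borel_measurable borel"
    using assms(1) by measurable
  show "\<bar>exp (- (1 + e x) * (t - s)) * F s\<bar> \<le> K" if "s \<in> {c..t}" for s
    using mult_mono[OF discount_le_1 assms(2), of s t s x] that
    by (simp add: abs_mult del: mult_minus_left)
qed

lemma mild_integrable_source:
  assumes "prob_field V"
  shows "set_integrable lborel {c..t} (\<lambda>s. exp (- (1 + e x) * (t - s)) * source e V x s)"
  by (rule mild_integrable[where K = "1 + e x"])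
     (use source_bounds[OF assms] source_measurable[OF assms] in auto)

lemma mild_nonneg: "prob_field V \<Longrightarrow> 0 \<le> mild e V x t"
  unfolding mild_def set_lebesgue_integral_def
  by (intro Bochner_Integration.integral_nonneg) (auto simp: source_bounds split: split_indicator)

text \<open>
  One step of a Picard iteration: \<open>source\<close> is one-sided Lipschitz with constant \<open>1 + 2 * b\<close> on
  fields with values in \<open>[0, 1]\<close>.
\<close>

lemma mild_iteration:
  assumes V: "prob_field V" and W: "prob_field W"
    and close: "\<And>x s. 0 \<le> s \<Longrightarrow> V x s - W x s \<le> ((1 + 2 * b) * s) ^ n / fact n"
    and t: "0 \<le> t"
  shows "mild e V x t - mild e W x t \<le> ((1 + 2 * b) * t) ^ Suc n / fact (Suc n)"
proof -
  define K where "K = 1 + 2 * b"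
  have K: "0 \<le> K" using b_pos by (simp add: K_def)
  note V' = prob_fieldD[OF V] and W' = prob_fieldD[OF W]
  have pt: "exp (- (1 + e x) * (t - s)) * source e V x s - exp (- (1 + e x) * (t - s)) * source e W x s
      \<le> K * ((K * s) ^ n / fact n)" if s: "s \<in> {0..t}" for s
  proof -
    define d where "d = (K * s) ^ n / fact n"
    have d: "0 \<le> d" using K s by (simp add: d_def)
    have c: "V y s - W y s \<le> d" for y using close[of s y] s by (simp add: d_def K_def)
    have "(V x s - W x s) * (2 - V x s - W x s) \<le> 2 * d"
    proof (cases "V x s \<le> W x s")
      case True
      then have "(V x s - W x s) * (2 - V x s - W x s) \<le> 0"
        using V'(3)[of x s] W'(3)[of x s] by (intro mult_nonpos_nonneg) auto
      then show ?thesis using d by simp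
    next
      case False
      then have "(V x s - W x s) * (2 - V x s - W x s) \<le> d * 2"
        using c[of x] d V'(2,3)[of x s] W'(2,3)[of x s] by (intro mult_mono) auto
      then show ?thesis by simp
    qed
    then have "e x * ((V x s - W x s) * (2 - V x s - W x s)) \<le> b * (2 * d)"
      using e_pos[of x] upper[of x] d b_pos
      by (meson less_imp_le mult_left_mono mult_right_mono order_trans mult_nonneg_nonneg zero_le_numeral)
    moreover have "((V (x + 1) s - W (x + 1) s) + (V (x - 1) s - W (x - 1) s)) / 2 \<le> d"
      using c[of "x + 1"] c[of "x - 1"] by simp
    ultimately have "((V (x + 1) s - W (x + 1) s) + (V (x - 1) s - W (x - 1) s)) / 2
        + e x * ((V x s - W x s) * (2 - V x s - W x s)) \<le> d + b * (2 * d)"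
      by (intro add_mono)
    also have "((V (x + 1) s - W (x + 1) s) + (V (x - 1) s - W (x - 1) s)) / 2
        + e x * ((V x s - W x s) * (2 - V x s - W x s)) = source e V x s - source e W x s"
      by (simp add: source_def power2_eq_square algebra_simps diff_divide_distrib add_divide_distrib)
    also have "d + b * (2 * d) = K * d"
      by (simp add: K_def algebra_simps)
    finally have *: "source e V x s - source e W x s \<le> K * d" .
    have "exp (- (1 + e x) * (t - s)) * (source e V x s - source e W x s) \<le> 1 * (K * d)"
    proof (cases "source e V x s - source e W x s \<le> 0")
      case True
      then have "exp (- (1 + e x) * (t - s)) * (source e V x s - source e W x s) \<le> 0"
        by (intro mult_nonneg_nonpos) auto
      then show ?thesis using K d by (smt (verit) mult_nonneg_nonneg)
    next
      case False
      then show ?thesis using * discount_le_1[of s t x] s K d by (intro mult_mono) auto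
    qed
    then show ?thesis by (simp add: right_diff_distrib d_def)
  qed
  have int: "(\<integral>s. s ^ n * indicator {0..t} s \<partial>lborel) = t ^ Suc n / Suc n"
    using integral_power[OF t, of n] by simp
  have poly: "K * ((K * s) ^ n / fact n) = (K ^ Suc n / fact n) * s ^ n" for s
    by (simp add: power_mult_distrib)
  have "mild e V x t - mild e W x t =
      (LBINT s:{0..t}. exp (- (1 + e x) * (t - s)) * source e V x s - exp (- (1 + e x) * (t - s)) * source e W x s)"
    unfolding mild_def by (rule set_integral_diff(2)[symmetric]) (intro mild_integrable_source V W)+
  also have "\<dots> \<le> (LBINT s:{0..t}. K * ((K * s) ^ n / fact n))"
  proof (rule set_integral_mono)
    show "set_integrable lborel {0..t} (\<lambda>s. exp (- (1 + e x) * (t - s)) * source e V x s - exp (- (1 + e x) * (t - s)) * source e W x s)"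
      by (intro set_integral_diff mild_integrable_source V W)
    show "set_integrable lborel {0..t} (\<lambda>s. K * ((K * s) ^ n / fact n))"
      by (intro borel_integrable_atLeastAtMost' continuous_intros) auto
  qed (use pt in auto)
  also have "\<dots> = (K ^ Suc n / fact n) * (\<integral>s. s ^ n * indicator {0..t} s \<partial>lborel)"
    unfolding poly set_lebesgue_integral_def
    by (subst integral_mult_right_zero[symmetric]) (simp add: mult_ac)
  also have "\<dots> = (K * t) ^ Suc n / fact (Suc n)"
    unfolding int by (simp add: power_mult_distrib field_simps)
  finally show ?thesis by (simp add: K_def)
qed

text \<open>
  A subsolution that lies below a supersolution off \<open>D\<close> lies below it everywhere. Iterating the
  Lipschitz bound, the difference is at most \<open>((1 + 2 * b) * t) ^ n / fact n\<close> for every \<open>n\<close>, hence at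
  most \<open>0\<close>. The term \<open>i\<close> is the contribution of the initial condition.
\<close>

lemma comparison:
  assumes V: "prob_field V" and W: "prob_field W"
    and sub: "\<And>x t. x \<in> D \<Longrightarrow> 0 \<le> t \<Longrightarrow> V x t \<le> i x t + mild e V x t"
    and super: "\<And>x t. x \<in> D \<Longrightarrow> 0 \<le> t \<Longrightarrow> i x t + mild e W x t \<le> W x t"
    and off: "\<And>x t. x \<notin> D \<Longrightarrow> 0 \<le> t \<Longrightarrow> V x t \<le> W x t"
    and t: "0 \<le> t"
  shows "V x t \<le> W x t"
proof -
  have "0 \<le> t \<Longrightarrow> V x t - W x t \<le> ((1 + 2 * b) * t) ^ n / fact n" for n x t
  proof (induction n arbitrary: x t)
    case 0
    then show ?case using prob_fieldD(3)[OF V, of x t] prob_fieldD(2)[OF W, of x t] by simp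
  next
    case (Suc n)
    show ?case
    proof (cases "x \<in> D")
      case True
      then show ?thesis
        using sub[OF True Suc.prems] super[OF True Suc.prems] mild_iteration[OF V W Suc.IH Suc.prems, of x] by linarith
    next
      case False
      then have "V x t - W x t \<le> 0" using off[OF False Suc.prems] by simp
      also have "0 \<le> ((1 + 2 * b) * t) ^ Suc n / fact (Suc n)"
        using b_pos Suc.prems by (intro divide_nonneg_nonneg zero_le_power mult_nonneg_nonneg) auto
      finally show ?thesis .
    qed
  qed
  from this[OF t] have "V x t - W x t \<le> 0"
    by (intro LIMSEQ_le_const[OF power_over_fact_tendsto_0[of "(1 + 2 * b) * t"]]) blast
  then show ?thesis by simp
qed

lemma prob_field_hit: "prob_field (hit_prob e z)"
  and prob_field_occ: "prob_field (occ_prob e z)"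
  and prob_field_gen: "prob_field (gen_prob e n)"
  by (auto simp: prob_field_def hit_prob_bounds occ_prob_bounds gen_prob_bounds)

text \<open>
  There is no explosion: the same iteration, compared with the zero solution, bounds the probability that
  some segment with \<open>n\<close> events behind it has started by time \<open>t\<close>.
\<close>

lemma gen_prob_le:
  assumes "0 \<le> t" shows "gen_prob e n x t \<le> ((1 + 2 * b) * t) ^ n / fact n"
  using assms
proof (induction n arbitrary: x t)
  case 0
  then show ?case by (simp add: gen_prob_bounds)
next
  case (Suc n)
  have zero: "prob_field (\<lambda>_ _. 0)" by (simp add: prob_field_def)
  have "mild e (\<lambda>_ _. 0) x t = 0" by (simp add: mild_def source_def)
  then show ?case
    using mild_iteration[OF prob_field_gen[of n] zero, where n = n and t = t and x = x] Suc gen_prob_mild[OF e_pos Suc.prems, where n = n and x = x] by simp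
qed

text \<open>
  A bound for a source that is discounted at rate \<open>\<gamma>\<close>; with \<open>\<gamma> = 0\<close> it covers constant bounds.
\<close>

lemma mild_le:
  assumes V: "prob_field V" and nn: "0 \<le> M" "0 \<le> \<gamma>" "0 \<le> t"
    and le: "\<And>s. s \<in> {0..t} \<Longrightarrow> source e V x s \<le> M * (1 + e x + \<gamma>) * exp (- \<gamma> * (t - s))"
  shows "mild e V x t \<le> M"
proof -
  define r where "r = 1 + e x + \<gamma>"
  have r: "0 < r" using e_pos[of x] nn by (simp add: r_def)
  have "mild e V x t \<le> (LBINT s:{0..t}. (M * r) * exp (- r * (t - s)))"
    unfolding mild_def
  proof (rule set_integral_mono[OF mild_integrable_source[OF V]])
    show "set_integrable lborel {0..t} (\<lambda>s. M * r * exp (- r * (t - s)))"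
      by (intro borel_integrable_atLeastAtMost' continuous_intros)
    fix s assume "s \<in> {0..t}"
    then have "exp (- (1 + e x) * (t - s)) * source e V x s
      \<le> exp (- (1 + e x) * (t - s)) * (M * r * exp (- \<gamma> * (t - s)))"
      using le[of s] by (intro mult_left_mono) (auto simp: r_def)
    also have "exp (- (1 + e x) * (t - s)) * (M * r * exp (- \<gamma> * (t - s))) = M * r * exp (- r * (t - s))"
    proof -
      have "exp (- r * (t - s)) = exp (- (1 + e x) * (t - s)) * exp (- \<gamma> * (t - s))"
        by (simp add: r_def exp_add[symmetric] algebra_simps)
      then show ?thesis by (simp only: mult_ac)
    qed
    finally show "exp (- (1 + e x) * (t - s)) * source e V x s \<le> M * r * exp (- r * (t - s))" .
  qed
  also have "\<dots> = (M * r) * (LBINT s:{0..t}. exp (- r * (t - s)))"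
    by (rule set_integral_mult_right)
  also have "\<dots> \<le> (M * r) * (1 / r)"
    using r nn by (intro mult_left_mono LBINT_exp_le) auto
  finally show ?thesis using r by simp
qed

text \<open>
  The expected number of particles beyond a level grows at most exponentially. Analytically, the
  exponential on the right solves a linear equation that dominates the nonlinear one, since
  \<open>2 * v - v ^ 2 \<le> 2 * v\<close>; truncation at \<open>1\<close> keeps it a supersolution. The rate \<open>2 + b\<close> is large enough
  because \<open>cosh 1 \<le> 2\<close>.
\<close>

lemma hit_prob_growth:
  assumes t: "0 \<le> t"
  shows "hit_prob e z x t \<le> exp (real_of_int (x - z) + (2 + b) * t)"
proof -
  define w where "w x t = exp (real_of_int (x - z) + (2 + b) * t)" for x t
  define W where "W x t = min 1 (w x t)" for x t
  have w_pos: "0 < w x t" for x t by (simp add: w_def)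
  have W: "prob_field W"
    unfolding prob_field_def W_def w_def by (auto simp: min_def)
  have "hit_prob e z x t \<le> W x t"
  proof (rule comparison[OF prob_field_hit W, where D = "{x. x < z}" and i = "\<lambda>_ _. 0"])
    fix x and t :: real assume x: "x \<in> {x. x < z}" and t: "0 \<le> t"
    show "hit_prob e z x t \<le> 0 + mild e (hit_prob e z) x t"
      using hit_prob_mild[OF e_pos t, where x = x and z = z] x by simp
    have "mild e W x t \<le> 1"
      using source_bounds(2)[OF W, of x] by (intro mild_le[OF W, where \<gamma> = 0] t) auto
    moreover have "mild e W x t \<le> w x t"
    proof (rule mild_le[OF W, where \<gamma> = "2 + b"])
      fix s assume s: "s \<in> {0..t}"
      have wx: "w (x + 1) s = exp 1 * w x s" "w (x - 1) s = exp (- 1) * w x s"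
        by (simp_all add: w_def exp_add[symmetric] algebra_simps)
      have "2 * W x s - (W x s)\<^sup>2 \<le> 2 * w x s"
        by (simp add: W_def add_increasing2 min_def)
      then have "e x * (2 * W x s - (W x s)\<^sup>2) \<le> e x * (2 * w x s)"
        using e_pos[of x] by (intro mult_left_mono) auto
      then have "source e W x s \<le> (w (x + 1) s + w (x - 1) s) / 2 + e x * (2 * w x s)"
        unfolding source_def by (intro add_mono divide_right_mono) (auto simp: W_def)
      also have "\<dots> = ((exp 1 + exp (- 1)) / 2 + 2 * e x) * w x s"
        unfolding wx by (simp add: algebra_simps add_divide_distrib)
      also have "\<dots> \<le> (1 + e x + (2 + b)) * w x s"
      proof (intro mult_right_mono)
        have "exp (- 1 :: real) \<le> 1" by simp
        from this exp_le upper[of x]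
        show "(exp 1 + exp (- 1)) / 2 + 2 * e x \<le> 1 + e x + (2 + b)"
          unfolding add_divide_distrib by linarith
      qed (use w_pos in \<open>auto intro: less_imp_le\<close>)
      also have "w x s = w x t * exp (- (2 + b) * (t - s))"
        by (simp add: w_def exp_add[symmetric] algebra_simps)
      finally show "source e W x s \<le> w x t * (1 + e x + (2 + b)) * exp (- (2 + b) * (t - s))"
        by (simp only: mult_ac)
    qed (use w_pos b_pos t in \<open>auto intro: less_imp_le\<close>)
    ultimately show "0 + mild e W x t \<le> W x t" by (simp add: W_def)
  next
    fix x and t :: real assume "x \<notin> {x. x < z}" "0 \<le> t"
    then have "1 \<le> w x t" using b_pos by (simp add: w_def)
    then show "hit_prob e z x t \<le> W x t" by (simp add: W_def hit_prob_bounds)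
  qed (rule t)
  then show ?thesis by (simp add: W_def w_def)
qed
end

section \<open>An explicit subsolution\<close>

text \<open>
  The pointwise inequality behind the travelling subsolution \<open>(E - 1) / (E + 2)\<close> with
  \<open>E = exp (l * x + \<kappa> * t)\<close>, where \<open>h = exp l\<close> is the factor between neighbouring sites. The profile
  is convex only where \<open>E < 2\<close>, and there the Laplacian supplies what the factor \<open>E - 1\<close> in the splitting
  term \<open>r * (v - v ^ 2)\<close> lacks near \<open>E = 1\<close>; for larger \<open>E\<close> the splitting term dominates. Cleared of
  denominators and divided by \<open>\<epsilon>\<close>, the difference is affine in \<open>\<epsilon>\<close>, with values \<open>G0\<close> and \<open>G1\<close> at the
  end points \<open>0\<close> and \<open>1\<close>, and both are positive for \<open>E \<ge> 1\<close>. This leaves room for a front that moves at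
  the small rate \<open>\<kappa> = \<epsilon> / 24\<close>.
\<close>

lemma barrier_inequality:
  fixes E h r \<epsilon> :: real
  assumes E: "1 \<le> E" and h: "0 < h" "h + 1 / h = 2 + \<epsilon>" and eps: "0 \<le> \<epsilon>" "\<epsilon> \<le> 1" "\<epsilon> \<le> r"
  shows "(1 + r) * ((E - 1) / (E + 2)) + 3 * (\<epsilon> / 24) * E / (E + 2)\<^sup>2
    \<le> ((E * h - 1) / (E * h + 2) + (E / h - 1) / (E / h + 2)) / 2
      + r * (2 * ((E - 1) / (E + 2)) - ((E - 1) / (E + 2))\<^sup>2)"
proof -
  define D where "D = (E + 2)\<^sup>2 + 2 * \<epsilon> * E"
  have Ep: "0 < E + 2" "0 < (E + 2)\<^sup>2" using E by auto
  have Dp: "0 < D" unfolding D_def using Ep eps E by (intro add_pos_nonneg) auto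
  have hp: "0 < E * h + 2" "0 < E / h + 2" using E h by (auto intro!: add_pos_pos mult_pos_pos divide_pos_pos)
  have prod: "(E * h + 2) * (E / h + 2) = D"
  proof -
    have "(E * h + 2) * (E / h + 2) = E\<^sup>2 + 2 * E * (h + 1 / h) + 4"
      using h(1) by (simp add: field_simps power2_eq_square)
    then show ?thesis unfolding h(2) D_def by (simp add: power2_eq_square algebra_simps)
  qed
  have sum: "(E * h - 1) / (E * h + 2) + (E / h - 1) / (E / h + 2) = 2 - 3 * (4 + E * (2 + \<epsilon>)) / D"
  proof -
    have "(E * h - 1) / (E * h + 2) = 1 - 3 / (E * h + 2)" "(E / h - 1) / (E / h + 2) = 1 - 3 / (E / h + 2)"
      using hp by (simp_all add: field_simps)
    moreover have "3 / (E * h + 2) + 3 / (E / h + 2) = 3 * (4 + E * (h + 1 / h)) / ((E * h + 2) * (E / h + 2))"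
      using hp h(1) by (simp add: add_frac_eq algebra_simps)
    ultimately show ?thesis unfolding prod h(2) by simp
  qed
  have E2: "E \<le> E * E" using E mult_left_mono[of 1 E E] by simp
  have E3: "0 \<le> E * E * E" using E by simp
  define G0 where "G0 = 11/24 * (E * E * E) + 17/6 * (E * E) + 11/6 * E - 4"
  define G1 where "G1 = 11/24 * (E * E * E) + 19/4 * (E * E) - 1/6 * E - 4"
  have "0 \<le> G0" "0 \<le> G1" unfolding G0_def G1_def using E E2 E3 by linarith+
  then have "0 \<le> (1 - \<epsilon>) * G0 + \<epsilon> * G1" using eps by simp
  also have "(1 - \<epsilon>) * G0 + \<epsilon> * G1 = (E - 1) * D + E * (4 - E\<^sup>2) / 2 - E * D / 24"
    unfolding G0_def G1_def D_def by (simp add: field_simps power2_eq_square)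
  finally have "0 \<le> \<epsilon> * ((E - 1) * D + E * (4 - E\<^sup>2) / 2 - E * D / 24)"
    using eps by simp
  also have "\<dots> \<le> r * (E - 1) * D + \<epsilon> * (E * (4 - E\<^sup>2) / 2 - E * D / 24)"
  proof -
    have "\<epsilon> * ((E - 1) * D) \<le> r * ((E - 1) * D)" using eps E Dp by (intro mult_right_mono) auto
    then show ?thesis by (simp add: algebra_simps)
  qed
  also have "\<dots> = (E + 2)\<^sup>2 * D / 3 *
     (r * (3 * (E - 1) / (E + 2)\<^sup>2) + 3 / (E + 2) - 3 / 2 * (4 + E * (2 + \<epsilon>)) / D - 3 * (\<epsilon> / 24) * E / (E + 2)\<^sup>2)"
  proof -
    have eq1: "(E + 2)\<^sup>2 * D / 3 *
     (r * (3 * (E - 1) / (E + 2)\<^sup>2) + 3 / (E + 2) - 3 / 2 * (4 + E * (2 + \<epsilon>)) / D - 3 * (\<epsilon> / 24) * E / (E + 2)\<^sup>2)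
      = r * (E - 1) * D + (E + 2) * D - (4 + E * (2 + \<epsilon>)) * (E + 2)\<^sup>2 / 2 - \<epsilon> * E * D / 24"
    proof -
      have *: "F\<^sup>2 * D / 3 * (r * (3 * u / F\<^sup>2) + 3 / F - 3 / 2 * v / D - 3 * y * E / F\<^sup>2)
        = r * u * D + F * D - v * F\<^sup>2 / 2 - y * E * D" if "F \<noteq> 0" for F u v y
      proof -
        have "F\<^sup>2 * D / 3 * (r * (3 * u / F\<^sup>2)) = r * u * D" "F\<^sup>2 * D / 3 * (3 / F) = F * D"
          "F\<^sup>2 * D / 3 * (3 / 2 * v / D) = v * F\<^sup>2 / 2" "F\<^sup>2 * D / 3 * (3 * y * E / F\<^sup>2) = y * E * D"
          using that Dp by (simp_all add: power2_eq_square)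
        then show ?thesis by (simp only: right_diff_distrib distrib_left)
      qed
      show ?thesis using *[of "E + 2" "E - 1" "4 + E * (2 + \<epsilon>)" "\<epsilon> / 24"] Ep by simp
    qed
    have eq2: "(E + 2) * D - (4 + E * (2 + \<epsilon>)) * (E + 2)\<^sup>2 / 2 = \<epsilon> * (E * (4 - E\<^sup>2) / 2)"
      by (simp add: D_def field_simps power2_eq_square)
    have eq3: "\<epsilon> * E * D / 24 = \<epsilon> * (E * D / 24)" by simp
    show ?thesis unfolding eq1 eq3 right_diff_distrib[of \<epsilon>] eq2[symmetric] by simp
  qed
  finally have nonneg: "0 \<le> (E + 2)\<^sup>2 * D / 3 * (r * (3 * (E - 1) / (E + 2)\<^sup>2) + 3 / (E + 2) - 3 / 2 * (4 + E * (2 + \<epsilon>)) / D - 3 * (\<epsilon> / 24) * E / (E + 2)\<^sup>2)" .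
  have cancel: "0 \<le> X" if "0 < Q" "0 \<le> Q * X" for Q X :: real
    using that by (simp add: zero_le_mult_iff)
  have "0 \<le> r * (3 * (E - 1) / (E + 2)\<^sup>2) + 3 / (E + 2) - 3 / 2 * (4 + E * (2 + \<epsilon>)) / D - 3 * (\<epsilon> / 24) * E / (E + 2)\<^sup>2"
    by (rule cancel[OF _ nonneg]) (use Ep Dp in simp)
  moreover have "((E - 1) / (E + 2)) - ((E - 1) / (E + 2))\<^sup>2 = 3 * (E - 1) / (E + 2)\<^sup>2"
  proof -
    have "1 - (E - 1) / (E + 2) = 3 / (E + 2)" using Ep by (simp add: field_simps)
    moreover have "((E - 1) / (E + 2)) - ((E - 1) / (E + 2))\<^sup>2 = ((E - 1) / (E + 2)) * (1 - (E - 1) / (E + 2))"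
      by (simp only: power2_eq_square right_diff_distrib mult_1_right)
    ultimately show ?thesis by (simp add: power2_eq_square)
  qed
  then have "r * (2 * ((E - 1) / (E + 2)) - ((E - 1) / (E + 2))\<^sup>2) = r * ((E - 1) / (E + 2)) + r * (3 * (E - 1) / (E + 2)\<^sup>2)"
    unfolding distrib_left[symmetric] by (intro arg_cong[of _ _ "(*) r"]) linarith
  moreover have "(E - 1) / (E + 2) = 1 - 3 / (E + 2)" using Ep by (simp add: field_simps)
  moreover have "(1 + r) * ((E - 1) / (E + 2)) = (E - 1) / (E + 2) + r * ((E - 1) / (E + 2))"
    by (simp only: distrib_right mult_1_left)
  moreover have "(2 - 3 * (4 + E * (2 + \<epsilon>)) / D) / 2 = 1 - 3 / 2 * (4 + E * (2 + \<epsilon>)) / D"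
    by (simp only: diff_divide_distrib divide_divide_eq_left mult.commute[of D 2] times_divide_eq_left)
  ultimately show ?thesis unfolding sum by linarith
qed

text \<open>
  A front that moves with speed \<open>\<kappa> / \<bar>l\<bar>\<close>, to the left if \<open>l > 0\<close> and to the right if \<open>l < 0\<close>. It vanishes ahead
  of the front and tends to \<open>1\<close> exponentially behind it. Setting it to \<open>0\<close> for negative times allows it to be
  delayed.
\<close>

definition barrier :: "real \<Rightarrow> real \<Rightarrow> int \<Rightarrow> int \<Rightarrow> real \<Rightarrow> real"
  where "barrier l \<kappa> z x t = (if t < 0 then 0 else
    max 0 ((exp (l * real_of_int (x - z) + \<kappa> * t) - 1) / (exp (l * real_of_int (x - z) + \<kappa> * t) + 2)))"

lemma prob_field_barrier: "prob_field (barrier l \<kappa> z)"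
proof -
  have "(y - 1) / (y + 2) \<le> 1" if "0 < y" for y :: real
    using that by (simp add: divide_le_eq)
  from this[OF exp_gt_zero] show ?thesis
    unfolding prob_field_def barrier_def[abs_def] by auto
qed

text \<open>
  The source of all exponential tails.
\<close>

lemma one_minus_barrier_le:
  assumes "0 \<le> t"
  shows "1 - barrier l \<kappa> z x t \<le> 3 * exp (- (l * real_of_int (x - z)) - \<kappa> * t)"
proof -
  define E where "E = exp (l * real_of_int (x - z) + \<kappa> * t)"
  have E: "0 < E" by (simp add: E_def)
  have "1 - barrier l \<kappa> z x t \<le> 1 - (E - 1) / (E + 2)"
    using assms by (simp add: barrier_def E_def)
  also have "\<dots> = 3 / (E + 2)" using E by (simp add: field_simps)
  also have "\<dots> \<le> 3 / E" using E by (intro divide_left_mono) auto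
  also have "\<dots> = 3 * exp (- (l * real_of_int (x - z)) - \<kappa> * t)"
    by (simp add: E_def exp_add exp_minus exp_diff field_simps)
  finally show ?thesis .
qed

lemma barrier_mono:
  assumes "l * real_of_int (x - z) + \<kappa> * t \<le> l' * real_of_int (x' - z') + \<kappa>' * t'" "0 \<le> t'"
  shows "barrier l \<kappa> z x t \<le> barrier l' \<kappa>' z' x' t'"
proof -
  have "(y - 1) / (y + 2) \<le> (w - 1) / (w + 2)" if "0 < y" "y \<le> w" for y w :: real
    using that by (simp add: frac_le_eq divide_le_0_iff algebra_simps)
  from this[of "exp (l * real_of_int (x - z) + \<kappa> * t)" "exp (l' * real_of_int (x' - z') + \<kappa>' * t')"]
  show ?thesis using assms by (auto simp: barrier_def max_def)
qed

context bounded_rates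
begin

lemma mild_mono_interval:
  assumes V: "prob_field V" and ct: "0 \<le> c"
    and F: "F \<in> borel_measurable borel" "\<And>s. s \<in> {c..t} \<Longrightarrow> \<bar>F s\<bar> \<le> K" "\<And>s. s \<in> {c..t} \<Longrightarrow> F s \<le> source e V x s"
  shows "(LBINT s:{c..t}. exp (- (1 + e x) * (t - s)) * F s) \<le> mild e V x t"
proof -
  have "(LBINT s:{c..t}. exp (- (1 + e x) * (t - s)) * F s) \<le> (LBINT s:{c..t}. exp (- (1 + e x) * (t - s)) * source e V x s)"
    by (intro set_integral_mono mild_integrable[OF F(1,2)] mild_integrable_source V mult_left_mono F(3)) auto
  also have "\<dots> \<le> mild e V x t"
    unfolding mild_def set_lebesgue_integral_def
  proof (rule integral_mono)
    show "integrable lborel (\<lambda>s. indicator {c..t} s *\<^sub>R (exp (- (1 + e x) * (t - s)) * source e V x s))"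
      "integrable lborel (\<lambda>s. indicator {0..t} s *\<^sub>R (exp (- (1 + e x) * (t - s)) * source e V x s))"
      using mild_integrable_source[OF V] unfolding set_integrable_def by auto
  qed (use source_bounds(1)[OF V] ct in \<open>auto split: split_indicator\<close>)
  finally show ?thesis .
qed

text \<open>
  Where the barrier is positive it satisfies the differential inequality, so the fundamental theorem of
  calculus applies from the time \<open>t1\<close> at which it becomes positive (or from time \<open>0\<close>).
\<close>

lemma barrier_subsolution:
  assumes l: "exp l + exp (- l) = 2 + \<epsilon>" and eps: "0 < \<epsilon>" "\<epsilon> \<le> 1" "\<epsilon> \<le> a" and t: "0 \<le> t"
  shows "barrier l (\<epsilon> / 24) z x t
    \<le> (if 0 \<le> l * real_of_int (x - z) then exp (- (1 + e x) * t) else 0) + mild e (barrier l (\<epsilon> / 24) z) x t"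
proof -
  define c where "c = l * real_of_int (x - z)"
  define \<kappa> where "\<kappa> = \<epsilon> / 24"
  define E where "E s = exp (c + \<kappa> * s)" for s
  define f where "f s = (E s - 1) / (E s + 2)" for s
  define V where "V = barrier l \<kappa> z"
  have \<kappa>: "0 < \<kappa>" using eps by (simp add: \<kappa>_def)
  have V: "prob_field V" unfolding V_def by (rule prob_field_barrier)
  have Epos: "0 < E s" for s by (simp add: E_def)
  have Vf: "V x s = max 0 (f s)" if "0 \<le> s" for s
    using that by (simp add: V_def barrier_def f_def E_def c_def)
  have init: "0 \<le> (if 0 \<le> c then exp (- (1 + e x) * t) else 0)" by simp
  show ?thesis
  proof (cases "E t \<le> 1")
    case True
    then have "f t \<le> 0" unfolding f_def using Epos[of t] by (intro divide_nonpos_pos) auto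
    then have "V x t = 0" using Vf[OF t] by simp
    then show ?thesis using mild_nonneg[OF V, of x t] init by (simp add: V_def \<kappa>_def c_def)
  next
    case False
    define t1 where "t1 = max 0 (- c / \<kappa>)"
    have ct: "0 < c + \<kappa> * t" using False by (simp add: E_def)
    then have t1: "0 \<le> t1" "t1 \<le> t"
      using t \<kappa> by (auto simp: t1_def field_simps)
    have E1: "1 \<le> E s" if "t1 \<le> s" for s
    proof -
      have "- c / \<kappa> \<le> s" using that by (simp add: t1_def)
      then show ?thesis using \<kappa> by (simp add: E_def field_simps)
    qed
    define F where "F s = (1 + e x) * f s + 3 * \<kappa> * E s / (E s + 2)\<^sup>2" for s
    have E_cont: "continuous_on A E" for A unfolding E_def by (intro continuous_intros)
    have E2: "E s + 2 \<noteq> 0" for s using Epos[of s] by linarith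
    have F_cont: "continuous_on A F" for A unfolding F_def f_def
      by (intro continuous_intros E_cont) (use E2 in auto)
    have F_meas: "F \<in> borel_measurable borel"
      using F_cont by (intro borel_measurable_continuous_onI)
    have F_le: "F s \<le> source e V x s" if s: "s \<in> {t1..t}" for s
    proof -
      have s0: "0 \<le> s" using s t1 by simp
      have nb: "(E s * exp l - 1) / (E s * exp l + 2) \<le> V (x + 1) s" "(E s / exp l - 1) / (E s / exp l + 2) \<le> V (x - 1) s"
      proof -
        have "E s * exp l = exp (l * real_of_int (x + 1 - z) + \<kappa> * s)" "E s / exp l = exp (l * real_of_int (x - 1 - z) + \<kappa> * s)"
          by (simp_all add: E_def c_def exp_add[symmetric] exp_diff[symmetric] algebra_simps)
        then show "(E s * exp l - 1) / (E s * exp l + 2) \<le> V (x + 1) s" "(E s / exp l - 1) / (E s / exp l + 2) \<le> V (x - 1) s"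
          using s0 by (simp_all add: V_def barrier_def)
      qed
      have f0: "0 \<le> f s" using E1[of s] s by (simp add: f_def)
      then have Vx: "V x s = f s" using Vf[OF s0] by simp
      have "exp l + 1 / exp l = 2 + \<epsilon>" using l by (simp add: exp_minus inverse_eq_divide)
      from barrier_inequality[OF E1[of s] exp_gt_zero this]
      have "F s \<le> ((E s * exp l - 1) / (E s * exp l + 2) + (E s / exp l - 1) / (E s / exp l + 2)) / 2
        + e x * (2 * f s - (f s)\<^sup>2)"
        using eps lower[of x] s by (simp add: F_def f_def \<kappa>_def)
      also have "\<dots> \<le> source e V x s"
        unfolding source_def Vx using nb by (intro add_mono divide_right_mono) auto
      finally show ?thesis .
    qed
    have F_bound: "\<bar>F s\<bar> \<le> 1 + e x" if "s \<in> {t1..t}" for s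
    proof -
      have "0 \<le> F s" unfolding F_def f_def using E1[of s] that \<kappa> e_pos[of x] Epos[of s]
        by (intro add_nonneg_nonneg mult_nonneg_nonneg divide_nonneg_nonneg) auto
      then show ?thesis using F_le[OF that] source_bounds(2)[OF V, of x s] by simp
    qed
    have "(\<integral>s. (exp (- (1 + e x) * (t - s)) * F s) * indicator {t1..t} s \<partial>lborel)
      = exp (- (1 + e x) * (t - t)) * f t - exp (- (1 + e x) * (t - t1)) * f t1"
    proof (rule integral_FTC_Icc_real[OF t1(2)])
      fix s
      have "(E has_real_derivative \<kappa> * E s) (at s)"
        unfolding E_def by (auto intro!: derivative_eq_intros)
      then have "(f has_real_derivative 3 * \<kappa> * E s / (E s + 2)\<^sup>2) (at s)"
        unfolding f_def using E2[of s]
        by (auto intro!: derivative_eq_intros simp: field_simps power2_eq_square)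
      then show "((\<lambda>s. exp (- (1 + e x) * (t - s)) * f s) has_real_derivative exp (- (1 + e x) * (t - s)) * F s) (at s)"
        by (auto intro!: derivative_eq_intros simp: F_def algebra_simps)
      show "isCont (\<lambda>s. exp (- (1 + e x) * (t - s)) * F s) s"
        using F_cont[of UNIV] by (auto intro!: continuous_intros simp: continuous_on_eq_continuous_at)
    qed
    then have "f t - exp (- (1 + e x) * (t - t1)) * f t1 = (LBINT s:{t1..t}. exp (- (1 + e x) * (t - s)) * F s)"
      by (simp add: set_lebesgue_integral_def mult.commute)
    also have "\<dots> \<le> mild e V x t"
      by (rule mild_mono_interval[OF V t1(1) F_meas F_bound F_le])
    finally have *: "f t \<le> exp (- (1 + e x) * (t - t1)) * f t1 + mild e V x t" by simp
    have "exp (- (1 + e x) * (t - t1)) * f t1 \<le> (if 0 \<le> c then exp (- (1 + e x) * t) else 0)"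
    proof (cases "0 \<le> c")
      case True
      then have "t1 = 0" using \<kappa> by (simp add: t1_def)
      moreover have "f 0 \<le> 1" unfolding f_def using Epos[of 0] by (simp add: divide_le_eq)
      ultimately show ?thesis using True by simp
    next
      case False
      then have "t1 = - c / \<kappa>" using \<kappa> by (simp add: t1_def max_def divide_nonpos_pos field_simps)
      then have "f t1 = 0" using \<kappa> by (simp add: f_def E_def)
      then show ?thesis using False by simp
    qed
    moreover have "V x t = f t" using Vf[OF t] E1[OF t1(2)] by (simp add: f_def)
    ultimately show ?thesis using * by (simp add: V_def \<kappa>_def c_def)
  qed
qed

section \<open>Mixtures of delayed subsolutions\<close>

lemma prob_field_mixture:
  assumes V: "prob_field V" and J: "finite J" and g: "\<And>j. j \<in> J \<Longrightarrow> 0 \<le> g j" "(\<Sum>j\<in>J. g j) \<le> 1"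
  shows "prob_field (\<lambda>x t. \<Sum>j\<in>J. g j * V x (t - s j))"
  unfolding prob_field_def
proof (intro allI conjI)
  note V' = prob_fieldD[OF V]
  fix x
  note V'(1)[of x, measurable]
  show "(\<lambda>t. \<Sum>j\<in>J. g j * V x (t - s j)) \<in> borel_measurable borel" by measurable
  fix t
  show "0 \<le> (\<Sum>j\<in>J. g j * V x (t - s j))" using g V' by (intro sum_nonneg mult_nonneg_nonneg) auto
  have "(\<Sum>j\<in>J. g j * V x (t - s j)) \<le> (\<Sum>j\<in>J. g j * 1)" using g V' by (intro sum_mono mult_left_mono) auto
  then show "(\<Sum>j\<in>J. g j * V x (t - s j)) \<le> 1" using g(2) by simp
qed

text \<open>
  A delayed field that vanishes before its start satisfies the same inequality, since the integral
  is translation invariant and the source is nonnegative.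
\<close>

lemma delayed_subsolution:
  assumes V: "prob_field V" and neg: "\<And>t. t < 0 \<Longrightarrow> V x t = 0"
    and sub: "\<And>t. 0 \<le> t \<Longrightarrow> V x t \<le> mild e V x t" and c: "0 \<le> c" and t: "0 \<le> t"
  shows "V x (t - c) \<le> (LBINT s:{0..t}. exp (- (1 + e x) * (t - s)) * source e V x (s - c))"
proof (cases "t < c")
  case True
  have "0 \<le> (LBINT s:{0..t}. exp (- (1 + e x) * (t - s)) * source e V x (s - c))"
    unfolding set_lebesgue_integral_def
    by (intro Bochner_Integration.integral_nonneg) (auto simp: source_bounds[OF V] split: split_indicator)
  then show ?thesis using neg[of "t - c"] True by simp
next
  case False
  note source_measurable[OF V, of x, measurable]
  have m: "(\<lambda>s. source e V x (s - c)) \<in> borel_measurable borel" by measurable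
  have int: "set_integrable lborel {d..t} (\<lambda>s. exp (- (1 + e x) * (t - s)) * source e V x (s - c))" for d
    by (rule mild_integrable[OF m, where K = "1 + e x"]) (use source_bounds[OF V] in auto)
  have "V x (t - c) \<le> mild e V x (t - c)" using sub False by simp
  also have "\<dots> = (\<integral>s. indicator {0..t - c} (- c + 1 * s) *\<^sub>R (exp (- (1 + e x) * ((t - c) - (- c + 1 * s))) * source e V x (- c + 1 * s)) \<partial>lborel)"
    unfolding mild_def set_lebesgue_integral_def
    by (subst lborel_integral_real_affine[where c = 1 and t = "- c"]) auto
  also have "\<dots> = (LBINT s:{c..t}. exp (- (1 + e x) * (t - s)) * source e V x (s - c))"
    unfolding set_lebesgue_integral_def
    by (intro Bochner_Integration.integral_cong refl) (auto split: split_indicator)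
  also have "\<dots> \<le> (LBINT s:{0..t}. exp (- (1 + e x) * (t - s)) * source e V x (s - c))"
    unfolding set_lebesgue_integral_def
    using int[of c] int[of 0] source_bounds(1)[OF V] c
    by (intro integral_mono) (auto simp: set_integrable_def split: split_indicator)
  finally show ?thesis .
qed

text \<open>
  Analytic counterpart of restarting the process at a random time \<open>c j\<close>, chosen with probability \<open>g j\<close>.
  The splitting term \<open>2 * v - v ^ 2\<close> is concave and vanishes at \<open>0\<close>, so it can only increase when it is
  applied to the mixture; by the Cauchy-Schwarz inequality this holds for weights of total mass at most \<open>1\<close>.
\<close>

lemma mixture_subsolution:
  assumes V: "prob_field V" and neg: "\<And>t. t < 0 \<Longrightarrow> V x t = 0"
    and sub: "\<And>t. 0 \<le> t \<Longrightarrow> V x t \<le> mild e V x t"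
    and J: "finite J" and g: "\<And>j. j \<in> J \<Longrightarrow> 0 \<le> g j" "(\<Sum>j\<in>J. g j) \<le> 1"
    and c: "\<And>j. j \<in> J \<Longrightarrow> 0 \<le> c j" and t: "0 \<le> t"
  shows "(\<Sum>j\<in>J. g j * V x (t - c j)) \<le> mild e (\<lambda>x t. \<Sum>j\<in>J. g j * V x (t - c j)) x t"
proof -
  define W where "W = (\<lambda>x t. \<Sum>j\<in>J. g j * V x (t - c j))"
  have W: "prob_field W" unfolding W_def by (rule prob_field_mixture[OF V J g])
  note source_measurable[OF V, of x, measurable]
  have m: "(\<lambda>s. source e V x (s - c j)) \<in> borel_measurable borel" for j by measurable
  have int: "set_integrable lborel {0..t} (\<lambda>s. exp (- (1 + e x) * (t - s)) * source e V x (s - c j))" for j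
    by (rule mild_integrable[OF m, where K = "1 + e x"]) (use source_bounds[OF V] in auto)
  have concave: "(\<Sum>j\<in>J. g j * source e V x (s - c j)) \<le> source e W x s" for s
  proof -
    define v where "v j = V x (s - c j)" for j
    have CS: "(\<Sum>j\<in>J. g j * v j)\<^sup>2 \<le> (\<Sum>j\<in>J. g j * (v j)\<^sup>2)"
    proof -
      have "(\<Sum>j\<in>J. sqrt (g j) * (sqrt (g j) * v j))\<^sup>2 \<le> (\<Sum>j\<in>J. (sqrt (g j))\<^sup>2) * (\<Sum>j\<in>J. (sqrt (g j) * v j)\<^sup>2)"
        by (rule Cauchy_Schwarz_ineq_sum)
      also have "(\<Sum>j\<in>J. sqrt (g j) * (sqrt (g j) * v j)) = (\<Sum>j\<in>J. g j * v j)"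
        using g by (intro sum.cong) (auto simp: mult.assoc[symmetric])
      also have "(\<Sum>j\<in>J. (sqrt (g j))\<^sup>2) = (\<Sum>j\<in>J. g j)"
        using g by (intro sum.cong) auto
      also have "(\<Sum>j\<in>J. (sqrt (g j) * v j)\<^sup>2) = (\<Sum>j\<in>J. g j * (v j)\<^sup>2)"
        using g by (intro sum.cong) (auto simp: power_mult_distrib)
      also have "(\<Sum>j\<in>J. g j) * (\<Sum>j\<in>J. g j * (v j)\<^sup>2) \<le> 1 * (\<Sum>j\<in>J. g j * (v j)\<^sup>2)"
        using g by (intro mult_right_mono sum_nonneg) auto
      finally show ?thesis by simp
    qed
    have "(\<Sum>j\<in>J. g j * source e V x (s - c j)) =
      (W (x + 1) s + W (x - 1) s) / 2 + e x * (2 * W x s - (\<Sum>j\<in>J. g j * (v j)\<^sup>2))"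
      unfolding source_def W_def v_def
      by (simp add: sum_distrib_left sum_divide_distrib sum.distrib[symmetric] sum_subtractf[symmetric] algebra_simps add_divide_distrib)
    also have "\<dots> \<le> source e W x s"
      unfolding source_def using CS e_pos[of x]
      by (intro add_left_mono mult_left_mono diff_left_mono) (auto simp: W_def v_def)
    finally show ?thesis .
  qed
  have "W x t \<le> (\<Sum>j\<in>J. g j * (LBINT s:{0..t}. exp (- (1 + e x) * (t - s)) * source e V x (s - c j)))"
    unfolding W_def using g c t by (intro sum_mono mult_left_mono delayed_subsolution V neg sub) auto
  also have "\<dots> = (LBINT s:{0..t}. \<Sum>j\<in>J. g j * (exp (- (1 + e x) * (t - s)) * source e V x (s - c j)))"
    unfolding set_integral_mult_right[symmetric] unfolding set_lebesgue_integral_def scaleR_sum_right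
  proof (subst Bochner_Integration.integral_sum)
    have "set_integrable lborel {0..t} (\<lambda>s. g j * (exp (- (1 + e x) * (t - s)) * source e V x (s - c j)))" for j
      using int by simp
    then show "integrable lborel (\<lambda>s. indicator {0..t} s *\<^sub>R (g j * (exp (- (1 + e x) * (t - s)) * source e V x (s - c j))))" for j
      by (simp add: set_integrable_def)
  qed simp
  also have "\<dots> = (LBINT s:{0..t}. exp (- (1 + e x) * (t - s)) * (\<Sum>j\<in>J. g j * source e V x (s - c j)))"
    by (simp add: sum_distrib_left mult_ac)
  also have "\<dots> \<le> mild e W x t"
  proof (rule mild_mono_interval[OF W order_refl])
    show "(\<lambda>s. \<Sum>j\<in>J. g j * source e V x (s - c j)) \<in> borel_measurable borel" by measurable
    show "\<bar>\<Sum>j\<in>J. g j * source e V x (s - c j)\<bar> \<le> 1 + e x" for s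
      using concave[of s] source_bounds(2)[OF W, of x s] source_bounds(1)[OF V] g
      by (subst abs_of_nonneg) (auto intro!: sum_nonneg order_trans[OF concave])
  qed (rule concave)
  finally show ?thesis by (simp add: W_def)
qed
end

section \<open>Comparison with a restarted process\<close>

definition increment :: "(nat \<Rightarrow> real) \<Rightarrow> nat \<Rightarrow> real"
  where "increment f j = f j - (if j = 0 then 0 else f (j - 1))"

text \<open>
  The growth of \<open>f\<close> up to \<open>n\<close>, where growth \<open>m\<close> steps ago counts with weight \<open>\<theta> ^ m\<close>.
\<close>

definition discounted :: "real \<Rightarrow> (nat \<Rightarrow> real) \<Rightarrow> nat \<Rightarrow> real"
  where "discounted \<theta> f n = (\<Sum>j\<le>n. increment f j * \<theta> ^ (n - j))"

lemma sum_increment: "(\<Sum>j\<le>n. increment f j) = f n"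
  by (induction n) (auto simp: increment_def)

lemma increment_nonneg: "mono f \<Longrightarrow> 0 \<le> f 0 \<Longrightarrow> 0 \<le> increment f j"
  by (auto simp: increment_def dest: monoD[of f "j - 1" j])

lemma convolution_commute:
  "(\<Sum>j\<le>n. increment f j * g (n - j)) = (\<Sum>i\<le>n. increment g i * f (n - i))"
proof -
  have idx: "{i. i \<in> {..n} \<and> i + j \<le> n} = {..n - j}" if "j \<le> n" for j using that by auto
  have "(\<Sum>j\<le>n. increment f j * g (n - j)) = (\<Sum>j\<le>n. \<Sum>i | i \<in> {..n} \<and> i + j \<le> n. increment f j * increment g i)"
    by (intro sum.cong refl) (simp add: idx[simplified] sum_distrib_left[symmetric] sum_increment)
  also have "\<dots> = (\<Sum>i\<le>n. \<Sum>j | j \<in> {..n} \<and> i + j \<le> n. increment f j * increment g i)"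
    by (rule sum.swap_restrict) auto
  also have "\<dots> = (\<Sum>i\<le>n. increment g i * f (n - i))"
  proof (intro sum.cong refl)
    fix i assume "i \<in> {..n}"
    then have "{j. j \<in> {..n} \<and> i + j \<le> n} = {..n - i}" by auto
    then show "(\<Sum>j | j \<in> {..n} \<and> i + j \<le> n. increment f j * increment g i) = increment g i * f (n - i)"
      by (simp add: sum_distrib_right[symmetric] sum_increment)
  qed
  finally show ?thesis .
qed

text \<open>
  Needed off the domain of a comparison, where a mixture has to stay below the function whose increments
  are its weights: the terms that have started by time \<open>t\<close> telescope to the value at the last \<open>\<tau> j \<le> t\<close>.
\<close>

lemma sum_increment_until:
  fixes G :: "real \<Rightarrow> real" and \<tau> :: "nat \<Rightarrow> real"
  assumes G: "mono G" "\<And>t. 0 \<le> G t" and \<tau>: "mono \<tau>"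
  shows "(\<Sum>j\<le>n. increment (\<lambda>j. G (\<tau> j)) j * of_bool (\<tau> j \<le> t)) \<le> G t"
proof -
  have "(\<Sum>j\<le>n. increment (\<lambda>j. G (\<tau> j)) j * of_bool (\<tau> j \<le> t)) \<le> G (min t (\<tau> n))"
  proof (induction n)
    case 0
    then show ?case using G(2) by (cases "\<tau> 0 \<le> t") (simp_all add: increment_def min_def)
  next
    case (Suc n)
    have le: "\<tau> n \<le> \<tau> (Suc n)" using \<tau> by (simp add: monoD)
    show ?case
    proof (cases "\<tau> (Suc n) \<le> t")
      case True
      then have "min t (\<tau> n) = \<tau> n" "min t (\<tau> (Suc n)) = \<tau> (Suc n)" using le by auto
      then show ?thesis using Suc True by (simp add: increment_def)
    next
      case False
      have "G (min t (\<tau> n)) \<le> G (min t (\<tau> (Suc n)))"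
        using le by (intro monoD[OF G(1)]) auto
      then show ?thesis using Suc False by simp
    qed
  qed
  also have "\<dots> \<le> G t" by (rule monoD[OF G(1)]) simp
  finally show ?thesis .
qed

context bounded_rates
begin

text \<open>
  In particular, the process started at \<open>z\<close> has at time \<open>t\<close> a particle at or beyond \<open>z\<close> with a
  probability that tends to \<open>1\<close> exponentially.
\<close>

lemma occ_prob_barrier:
  assumes l: "exp l + exp (- l) = 2 + \<epsilon>" "0 < l" and eps: "0 < \<epsilon>" "\<epsilon> \<le> 1" "\<epsilon> \<le> a" and t: "0 \<le> t"
  shows "barrier l (\<epsilon> / 24) z x t \<le> occ_prob e z x t"
proof (rule comparison[OF prob_field_barrier prob_field_occ, where D = UNIV
      and i = "\<lambda>x t. if z \<le> x then exp (- (1 + e x) * t) else 0"])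
  fix x and t :: real assume t: "0 \<le> t"
  have "0 \<le> l * real_of_int (x - z) \<longleftrightarrow> z \<le> x" using l(2) by (simp add: zero_le_mult_iff)
  then show "barrier l (\<epsilon> / 24) z x t \<le> (if z \<le> x then exp (- (1 + e x) * t) else 0) + mild e (barrier l (\<epsilon> / 24) z) x t"
    using barrier_subsolution[OF l(1) eps t, of z x] by simp
  show "(if z \<le> x then exp (- (1 + e x) * t) else 0) + mild e (occ_prob e z) x t \<le> occ_prob e z x t"
    using occ_prob_mild[OF e_pos t, where x = x and z = z] by simp
qed (use t in auto)

lemma mild_cong:
  assumes "\<And>s. V x s = W x s" "\<And>s. V (x + 1) s = W (x + 1) s" "\<And>s. V (x - 1) s = W (x - 1) s"
  shows "mild e V x t = mild e W x t"
  by (simp add: mild_def source_def assms)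

text \<open>
  From \<open>x\<close>, the process may first wait for a particle at \<open>0\<close> and then use it as a process started at
  \<open>0\<close>. The barrier bounds the probability that \<open>0\<close> is visited within a given time, from either side. On
  \<open>x \<noteq> 0\<close> the mixture is a subsolution, and at \<open>x = 0\<close> it is dominated because its weights are the
  increments of the hitting probability from \<open>0\<close>.
\<close>

lemma hit_prob_from_elsewhere:
  assumes l: "exp l + exp (- l) = 2 + \<epsilon>" "0 < l" and eps: "0 < \<epsilon>" "\<epsilon> \<le> 1" "\<epsilon> \<le> a"
    and \<tau>: "mono \<tau>" "\<And>j. 0 \<le> \<tau> j" and z: "0 < z" and t: "0 \<le> t"
  shows "(\<Sum>j\<le>n. increment (\<lambda>j. hit_prob e z 0 (\<tau> j)) j * barrier l (\<epsilon> / 24) 0 (- \<bar>x\<bar>) (t - \<tau> j)) \<le> hit_prob e z x t"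
proof -
  (* the distance to 0 as the argument makes one field serve both half-lines *)
  define \<kappa> where "\<kappa> = \<epsilon> / 24"
  have \<kappa>: "0 \<le> \<kappa>" using eps by (simp add: \<kappa>_def)
  define B where "B = (\<lambda>x t. barrier l \<kappa> 0 (- \<bar>x\<bar>) t)"
  define g where "g j = increment (\<lambda>j. hit_prob e z 0 (\<tau> j)) j" for j
  have B: "prob_field B"
    using prob_field_barrier[of l \<kappa> 0] by (simp add: prob_field_def B_def)
  have g: "0 \<le> g j" for j
    unfolding g_def by (intro increment_nonneg monoI hit_prob_mono hit_prob_bounds) (auto intro: monoD[OF \<tau>(1)])
  have g1: "(\<Sum>j\<le>n. g j) \<le> 1" unfolding g_def sum_increment by (rule hit_prob_bounds)
  have sub: "B x t \<le> mild e B x t" if "x \<noteq> 0" "0 \<le> t" for x t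
  proof (cases "0 < x")
    case True
    define V where "V = barrier (- l) \<kappa> 0"
    have eq: "B y s = V y s" if "0 \<le> y" for y s
      using that by (simp add: B_def V_def barrier_def)
    have "\<not> 0 \<le> - l * real_of_int (x - 0)" using True l(2) by (simp add: not_le mult_pos_pos)
    then have "V x t \<le> mild e V x t"
      using barrier_subsolution[of "- l" \<epsilon> t 0 x] l eps that by (simp add: V_def \<kappa>_def add.commute)
    moreover have "mild e B x t = mild e V x t" by (rule mild_cong) (use True eq in auto)
    ultimately show ?thesis using eq[of x] True by simp
  next
    case False
    define V where "V = barrier l \<kappa> 0"
    have x: "x < 0" using that False by simp
    have eq: "B y s = V y s" if "y \<le> 0" for y s
      using that by (simp add: B_def V_def)
    have "\<not> 0 \<le> l * real_of_int (x - 0)" using x l(2) by (simp add: not_le mult_pos_neg)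
    then have "V x t \<le> mild e V x t"
      using barrier_subsolution[of l \<epsilon> t 0 x] l eps that by (simp add: V_def \<kappa>_def)
    moreover have "mild e B x t = mild e V x t" by (rule mild_cong) (use x eq in auto)
    ultimately show ?thesis using eq[of x] x by simp
  qed
  have "(\<Sum>j\<le>n. g j * B x (t - \<tau> j)) \<le> hit_prob e z x t"
  proof (rule comparison[OF prob_field_mixture[OF B finite_atMost g g1] prob_field_hit,
        where D = "{x. x \<noteq> 0 \<and> x < z}" and i = "\<lambda>_ _. 0"])
    fix x and t :: real assume x: "x \<in> {x. x \<noteq> 0 \<and> x < z}" and t: "0 \<le> t"
    show "(\<Sum>j\<le>n. g j * B x (t - \<tau> j)) \<le> 0 + mild e (\<lambda>x t. \<Sum>j\<le>n. g j * B x (t - \<tau> j)) x t"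
      using mixture_subsolution[OF B _ sub finite_atMost g g1 \<tau>(2) t] x by (simp add: B_def barrier_def)
    show "0 + mild e (hit_prob e z) x t \<le> hit_prob e z x t"
      using hit_prob_mild[OF e_pos t, where x = x and z = z] x by simp
  next
    fix x and t :: real assume x: "x \<notin> {x. x \<noteq> 0 \<and> x < z}" and t: "0 \<le> t"
    show "(\<Sum>j\<le>n. g j * B x (t - \<tau> j)) \<le> hit_prob e z x t"
    proof (cases "z \<le> x")
      case True
      then show ?thesis
        using prob_fieldD(3)[OF prob_field_mixture[OF B finite_atMost g g1], of x t \<tau>] t by (simp add: hit_prob_past)
    next
      case False
      then have "x = 0" using x by auto
      have "(\<Sum>j\<le>n. g j * B 0 (t - \<tau> j)) \<le> (\<Sum>j\<le>n. g j * of_bool (\<tau> j \<le> t))"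
      proof (intro sum_mono mult_left_mono g)
        show "B 0 (t - \<tau> j) \<le> of_bool (\<tau> j \<le> t)" for j
          using prob_fieldD(3)[OF B, of 0 "t - \<tau> j"]
          by (cases "\<tau> j \<le> t") (simp_all add: B_def barrier_def[of _ _ _ _ "t - \<tau> j"] del: max.bounded_iff)
      qed
      also have "\<dots> \<le> hit_prob e z 0 t"
        unfolding g_def by (intro sum_increment_until \<tau> monoI hit_prob_mono hit_prob_bounds)
      finally show ?thesis using \<open>x = 0\<close> by simp
    qed
  qed (rule t)
  then show ?thesis by (simp add: g_def B_def \<kappa>_def)
qed

text \<open>
  To be at or beyond \<open>z\<close> at time \<open>t\<close>, it suffices to hit \<open>z\<close> early and then to have descendants that are not
  below \<open>z\<close> at time \<open>t\<close>. Here the hitting probabilities are delayed, and the weights are the increments of the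
  barrier: left of \<open>z\<close> the mixture is a subsolution, and from \<open>z\<close> on it is dominated by the barrier.
\<close>

lemma occ_prob_after_hit:
  assumes l: "exp l + exp (- l) = 2 + \<epsilon>" "0 < l" and eps: "0 < \<epsilon>" "\<epsilon> \<le> 1" "\<epsilon> \<le> a"
    and r: "0 < r" and t: "0 \<le> t"
  shows "(\<Sum>j\<le>n. increment (\<lambda>j. barrier l (\<epsilon> / 24) 0 0 (r * real j)) j * hit_prob e z x (t - r * real j)) \<le> occ_prob e z x t"
proof -
  define \<kappa> where "\<kappa> = \<epsilon> / 24"
  have \<kappa>: "0 \<le> \<kappa>" using eps by (simp add: \<kappa>_def)
  define \<Phi> where "\<Phi> = barrier l \<kappa> 0 0"
  have \<Phi>: "mono \<Phi>" "0 \<le> \<Phi> s" "\<Phi> s \<le> 1" for s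
  proof -
    show "0 \<le> \<Phi> s" "\<Phi> s \<le> 1" using prob_fieldD[OF prob_field_barrier] by (auto simp: \<Phi>_def)
    show "mono \<Phi>"
    proof (rule monoI)
      fix s t :: real assume "s \<le> t"
      then show "\<Phi> s \<le> \<Phi> t"
        using barrier_mono[of l 0 0 \<kappa> s l 0 0 \<kappa> t] \<kappa> prob_fieldD(2)[OF prob_field_barrier]
        by (cases "0 \<le> t") (auto simp: \<Phi>_def mult_left_mono barrier_def[of _ _ _ _ s])
    qed
  qed
  define c where "c j = increment (\<lambda>j. \<Phi> (r * real j)) j" for j
  have c: "0 \<le> c j" for j
    unfolding c_def using r by (intro increment_nonneg monoI monoD[OF \<Phi>(1)] \<Phi>) auto
  have c1: "(\<Sum>j\<le>n. c j) \<le> 1" unfolding c_def sum_increment by (rule \<Phi>)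
  have "(\<Sum>j\<le>n. c j * hit_prob e z x (t - r * real j)) \<le> occ_prob e z x t"
  proof (rule comparison[OF prob_field_mixture[OF prob_field_hit finite_atMost c c1] prob_field_occ,
        where D = "{x. x < z}" and i = "\<lambda>_ _. 0"])
    fix x and t :: real assume x: "x \<in> {x. x < z}" and t: "0 \<le> t"
    show "(\<Sum>j\<le>n. c j * hit_prob e z x (t - r * real j)) \<le> 0 + mild e (\<lambda>x t. \<Sum>j\<le>n. c j * hit_prob e z x (t - r * real j)) x t"
      using mixture_subsolution[OF prob_field_hit hit_prob_negative[OF e_pos] _ finite_atMost c c1 _ t, of z x "\<lambda>j. r * real j"]
        hit_prob_mild[OF e_pos, where x = x and z = z] x r by simp
    show "0 + mild e (occ_prob e z) x t \<le> occ_prob e z x t"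
      using occ_prob_mild[OF e_pos t, where x = x and z = z] x by simp
  next
    fix x and t :: real assume x: "x \<notin> {x. x < z}" and t: "0 \<le> t"
    have "(\<Sum>j\<le>n. c j * hit_prob e z x (t - r * real j)) \<le> (\<Sum>j\<le>n. c j * of_bool (r * real j \<le> t))"
      by (intro sum_mono mult_left_mono c) (auto simp: hit_prob_bounds hit_prob_negative[OF e_pos])
    also have "\<dots> \<le> \<Phi> t"
      unfolding c_def using r by (intro sum_increment_until \<Phi> monoI) auto
    also have "\<dots> \<le> barrier l \<kappa> z x t"
      unfolding \<Phi>_def using x l(2) t by (intro barrier_mono) auto
    also have "\<dots> \<le> occ_prob e z x t"
      unfolding \<kappa>_def by (rule occ_prob_barrier[OF l eps t])
    finally show "(\<Sum>j\<le>n. c j * hit_prob e z x (t - r * real j)) \<le> occ_prob e z x t" .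
  qed (rule t)
  then show ?thesis by (simp add: c_def \<Phi>_def \<kappa>_def)
qed

text \<open>
  The inequality of Dekking and Host at a single level. All hitting probabilities increase with time,
  so over a step of length \<open>r\<close> the source is at least its initial value, and what the equation gains
  over that step is visible in the increment.
\<close>

lemma hit_prob_step:
  assumes t: "0 \<le> t" and r: "0 < r" and x: "x < z"
  shows "source e (hit_prob e z) x t - (1 + e x) * hit_prob e z x t
    \<le> (1 + e x) / (1 - exp (- (1 + e x) * r)) * (hit_prob e z x (t + r) - hit_prob e z x t)"
proof -
  define \<beta> where "\<beta> = 1 + e x"
  define u where "u = hit_prob e z x"
  define q where "q = source e (hit_prob e z) x"
  have \<beta>: "0 < \<beta>" using e_pos[of x] by (simp add: \<beta>_def)
  have q_mono: "q t \<le> q s" if "t \<le> s" for s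
    unfolding q_def source_def using that e_pos[of x]
    by (intro add_mono divide_right_mono mult_left_mono splitting_mono hit_prob_mono hit_prob_bounds) auto
  have f: "set_integrable lborel {c..t + r} (\<lambda>s. exp (- \<beta> * (t + r - s)) * q s)" for c
    unfolding \<beta>_def q_def by (rule mild_integrable_source[OF prob_field_hit])
  have "u (t + r) = (LBINT s:{0..t + r}. exp (- \<beta> * (t + r - s)) * q s)"
    using hit_prob_mild[OF e_pos, where x = x and z = z] x t r by (simp add: u_def mild_def \<beta>_def q_def)
  also have "{0..t + r} = {0..t} \<union> {t<..t + r}" using t r by auto
  also have "(LBINT s:{0..t} \<union> {t<..t + r}. exp (- \<beta> * (t + r - s)) * q s)
    = (LBINT s:{0..t}. exp (- \<beta> * (t + r - s)) * q s) + (LBINT s:{t<..t + r}. exp (- \<beta> * (t + r - s)) * q s)"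
    using r by (intro set_integral_Un set_integrable_subset[OF f[of 0]]) (use t in auto)
  also have "(LBINT s:{0..t}. exp (- \<beta> * (t + r - s)) * q s) = (LBINT s:{0..t}. exp (- \<beta> * r) * (exp (- \<beta> * (t - s)) * q s))"
    by (intro set_lebesgue_integral_cong) (auto simp: exp_add[symmetric] algebra_simps)
  also have "\<dots> = exp (- \<beta> * r) * u t"
    using hit_prob_mild[OF e_pos t, where x = x and z = z] x by (simp add: u_def mild_def \<beta>_def q_def)
  also have "(LBINT s:{t<..t + r}. exp (- \<beta> * (t + r - s)) * q s) \<ge> (LBINT s:{t<..t + r}. exp (- \<beta> * (t + r - s)) * q t)"
  proof (rule set_integral_mono)
    have "set_integrable lborel {t..t + r} (\<lambda>s. exp (- \<beta> * (t + r - s)) * q t)"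
      by (intro borel_integrable_atLeastAtMost' continuous_intros)
    then show "set_integrable lborel {t<..t + r} (\<lambda>s. exp (- \<beta> * (t + r - s)) * q t)"
      by (rule set_integrable_subset) auto
    show "set_integrable lborel {t<..t + r} (\<lambda>s. exp (- \<beta> * (t + r - s)) * q s)"
      by (rule set_integrable_subset[OF f[of t]]) auto
  qed (use q_mono in auto)
  moreover have "(LBINT s:{t<..t + r}. exp (- \<beta> * (t + r - s)) * q t) = (1 - exp (- \<beta> * r)) / \<beta> * q t"
  proof -
    have "(\<integral>s. exp (- \<beta> * (t + r - s)) * indicator {t..t + r} s \<partial>lborel)
      = exp (- \<beta> * (t + r - (t + r))) / \<beta> - exp (- \<beta> * (t + r - t)) / \<beta>"
      using r \<beta>
      by (intro integral_FTC_Icc_real[where F = "\<lambda>s. exp (- \<beta> * (t + r - s)) / \<beta>"])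
         (auto intro!: derivative_eq_intros continuous_intros)
    then have *: "(LBINT s:{t..t + r}. exp (- \<beta> * (t + r - s))) = (1 - exp (- \<beta> * r)) / \<beta>"
      by (simp add: set_lebesgue_integral_def mult.commute diff_divide_distrib)
    have "(LBINT s:{t<..t + r}. exp (- \<beta> * (t + r - s))) = (LBINT s:{t..t + r}. exp (- \<beta> * (t + r - s)))"
      unfolding set_lebesgue_integral_def
      by (intro integral_cong_AE) (auto intro!: AE_I[where N = "{t}"] split: split_indicator)
    then show ?thesis using * by simp
  qed
  ultimately have main: "exp (- \<beta> * r) * u t + (1 - exp (- \<beta> * r)) / \<beta> * q t \<le> u (t + r)" by simp
  define p where "p = 1 - exp (- \<beta> * r)"
  have p: "0 < p" using \<beta> r by (simp add: p_def)
  have "p / \<beta> * (q t - \<beta> * u t) \<le> u (t + r) - u t"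
    using main \<beta> by (simp add: p_def[symmetric] right_diff_distrib) (simp add: p_def algebra_simps)
  then have "(\<beta> / p) * (p / \<beta> * (q t - \<beta> * u t)) \<le> (\<beta> / p) * (u (t + r) - u t)"
    using p \<beta> by (intro mult_left_mono) auto
  moreover have "(\<beta> / p) * (p / \<beta> * (q t - \<beta> * u t)) = q t - \<beta> * u t" using p \<beta> by simp
  ultimately have "q t - \<beta> * u t \<le> (\<beta> / p) * (u (t + r) - u t)" by simp
  then show ?thesis by (simp only: p_def u_def q_def \<beta>_def)
qed
end

section \<open>The mean record and the sums over all levels\<close>

lemma discounted_sums:
  assumes "\<And>j. (\<lambda>k. U k j) sums \<rho> j"
  shows "(\<lambda>k. discounted \<theta> (U k) n) sums discounted \<theta> \<rho> n"
proof -
  have "(\<lambda>k. increment (U k) j) sums increment \<rho> j" for j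
    unfolding increment_def using assms by (cases "j = 0") (auto intro: sums_diff)
  then show ?thesis
    unfolding discounted_def by (intro sums_sum sums_mult2)
qed

context bounded_rates
begin

text \<open>
  The mean of the rightmost site visited by time \<open>t\<close> when the process starts at \<open>0\<close>.
\<close>

definition mean_record :: "real \<Rightarrow> real"
  where "mean_record t = (\<Sum>k. hit_prob e (int k + 1) 0 t)"

lemma hit_prob_le_geometric:
  assumes "0 \<le> t"
  shows "hit_prob e (int k + 1) 0 t \<le> exp ((2 + b) * t) * exp (- 1) ^ Suc k"
proof -
  have "exp (- 1 :: real) ^ Suc k = exp (- real (Suc k))"
    using exp_of_nat_mult[of "Suc k" "- 1 :: real"] by simp
  then show ?thesis
    using hit_prob_growth[OF assms, of "int k + 1" 0] by (simp add: exp_add[symmetric] algebra_simps)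
qed

lemma summable_hit_prob:
  assumes "0 \<le> t" shows "summable (\<lambda>k. hit_prob e (int k + 1) 0 t)"
proof (rule summable_comparison_test')
  show "summable (\<lambda>k. exp ((2 + b) * t) * exp (- 1) ^ Suc k)"
    by (intro summable_mult summable_Suc_iff[THEN iffD2] summable_geometric) simp
  show "norm (hit_prob e (int k + 1) 0 t) \<le> exp ((2 + b) * t) * exp (- 1) ^ Suc k" for k
    using hit_prob_le_geometric[OF assms, of k] by (simp add: hit_prob_bounds)
qed

lemma hit_prob_sums: "0 \<le> t \<Longrightarrow> (\<lambda>k. hit_prob e (int k + 1) 0 t) sums mean_record t"
  unfolding mean_record_def by (intro summable_sums summable_hit_prob)

lemma mean_record_nonneg: "0 \<le> t \<Longrightarrow> 0 \<le> mean_record t"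
  unfolding mean_record_def by (intro suminf_nonneg summable_hit_prob hit_prob_bounds)

lemma mean_record_mono: "0 \<le> s \<Longrightarrow> s \<le> t \<Longrightarrow> mean_record s \<le> mean_record t"
  unfolding mean_record_def by (intro suminf_le summable_hit_prob hit_prob_mono) auto

text \<open>
  Levels up to \<open>(2 + b) * t\<close> contribute at most \<open>1\<close> each, and beyond them the hitting probabilities decay
  geometrically.
\<close>

lemma mean_record_linear:
  assumes t: "0 \<le> t"
  shows "mean_record t \<le> (2 + b) * t + (1 + (\<Sum>k. exp (- 1 :: real) ^ Suc k))"
proof -
  define N where "N = nat \<lceil>(2 + b) * t\<rceil>"
  have nn: "0 \<le> (2 + b) * t" using t b_pos by simp
  have N: "(2 + b) * t \<le> real N" "real N \<le> (2 + b) * t + 1"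
    using nn by (auto simp: N_def)
  have geo: "summable (\<lambda>k. exp (- 1 :: real) ^ Suc k)"
    by (intro summable_Suc_iff[THEN iffD2] summable_geometric) simp
  have sh: "summable (\<lambda>k. hit_prob e (int (k + N) + 1) 0 t)"
    using summable_iff_shift[of "\<lambda>k. hit_prob e (int k + 1) 0 t" N] summable_hit_prob[OF t] by simp
  have "mean_record t = (\<Sum>k. hit_prob e (int (k + N) + 1) 0 t) + (\<Sum>k<N. hit_prob e (int k + 1) 0 t)"
    unfolding mean_record_def by (rule suminf_split_initial_segment[OF summable_hit_prob[OF t]])
  also have "(\<Sum>k. hit_prob e (int (k + N) + 1) 0 t) \<le> (\<Sum>k. exp (- 1 :: real) ^ Suc k)"
  proof (rule suminf_le[OF _ sh geo])
    fix k
    have "hit_prob e (int (k + N) + 1) 0 t \<le> exp (real_of_int (0 - (int (k + N) + 1)) + (2 + b) * t)"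
      by (rule hit_prob_growth[OF t])
    also have "\<dots> \<le> exp (- real (Suc k))" using N(1) by simp
    also have "\<dots> = exp (- 1) ^ Suc k" using exp_of_nat_mult[of "Suc k" "- 1 :: real"] by simp
    finally show "hit_prob e (int (k + N) + 1) 0 t \<le> exp (- 1) ^ Suc k" .
  qed
  also have "(\<Sum>k<N. hit_prob e (int k + 1) 0 t) \<le> (\<Sum>k<N. 1)"
    by (intro sum_mono hit_prob_bounds)
  finally show ?thesis using N(2) by simp
qed

text \<open>
  The estimates at single levels, summed over all levels: the spread of the record, the mean of the gap between
  record and maximum, and the mean of the negative part of the maximum. The first two are controlled by the
  growth of the mean record and the third is bounded in time; the rate \<open>\<theta>\<close> and the constant \<open>C\<close> depend on the environment and on the grid only.
\<close>

lemma record_estimates: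
  assumes r: "0 < r" and \<eta>: "0 \<le> \<eta>"
  obtains \<theta> C :: real where "0 < \<theta>" "\<theta> < 1" "0 \<le> C"
    "\<And>n. (\<Sum>k. hit_prob e (int k + 1) 0 (\<eta> + r * real n) * (1 - hit_prob e (int k + 1) 0 (\<eta> + r * real n)))
      \<le> C * (mean_record (\<eta> + r * real (Suc n)) - mean_record (\<eta> + r * real n)
          + discounted \<theta> (\<lambda>n. mean_record (\<eta> + r * real n)) n)"
    "\<And>n. (\<Sum>k. hit_prob e (int k + 1) 0 (\<eta> + r * real n) - occ_prob e (int k + 1) 0 (\<eta> + r * real n))
      \<le> C * discounted \<theta> (\<lambda>n. mean_record (\<eta> + r * real n)) n"
    "\<And>t. 0 \<le> t \<Longrightarrow> summable (\<lambda>k. 1 - occ_prob e (- int k) 0 t)"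
    "\<And>t. 0 \<le> t \<Longrightarrow> (\<Sum>k. 1 - occ_prob e (- int k) 0 t) \<le> C"
proof -
  define \<epsilon> where "\<epsilon> = min a 1"
  have eps: "0 < \<epsilon>" "\<epsilon> \<le> 1" "\<epsilon> \<le> a" using a_pos by (auto simp: \<epsilon>_def)
  (* the spatial rate l is chosen such that the discrete Laplacian of exp (l * x) is eps / 2 times it *)
  define l where "l = arcosh (1 + \<epsilon> / 2)"
  have cosh_l: "cosh l = 1 + \<epsilon> / 2" using eps by (simp add: l_def cosh_arcosh_real)
  then have l1: "exp l + exp (- l) = 2 + \<epsilon>" by (simp add: cosh_def)
  have "l \<noteq> 0" using cosh_l eps by auto
  moreover have "0 \<le> l" using eps by (simp add: l_def)
  ultimately have l2: "0 < l" by simp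
  define \<theta> where "\<theta> = exp (- (\<epsilon> / 24 * r))"
  have \<theta>: "0 < \<theta>" "\<theta> < 1" using eps r by (auto simp: \<theta>_def)
  have \<theta>_pow: "exp (- (\<epsilon> / 24 * (r * real m))) = \<theta> ^ m" for m
    using exp_of_nat_mult[of m "- (\<epsilon> / 24 * r)"] by (simp add: \<theta>_def mult_ac)
  define T where "T n = \<eta> + r * real n" for n
  have T: "0 \<le> T n" for n using r \<eta> by (simp add: T_def)
  have T_mono: "mono T" using r by (auto simp: T_def intro!: monoI)
  define U where "U k n = hit_prob e (int k + 1) 0 (T n)" for k n
  define \<rho> where "\<rho> n = mean_record (T n)" for n
  have U: "0 \<le> U k n" "U k n \<le> 1" for k n by (auto simp: U_def hit_prob_bounds)
  have U_sums: "(\<lambda>k. U k n) sums \<rho> n" for n unfolding U_def \<rho>_def by (rule hit_prob_sums[OF T])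
  have U_mono: "mono (U k)" for k unfolding U_def by (intro monoI hit_prob_mono monoD[OF T_mono])
  have inc: "0 \<le> increment (U k) j" for k j by (rule increment_nonneg[OF U_mono U(1)])
  have disc_sums: "(\<lambda>k. discounted \<theta> (U k) n) sums discounted \<theta> \<rho> n" for n
    by (rule discounted_sums[OF U_sums])

  (* the price of a start at a neighbour of 0 *)
  have far: "U k n - hit_prob e (int k + 1) y (T n) \<le> 3 * exp l * discounted \<theta> (U k) n" if y: "\<bar>y\<bar> = 1" for k n y
  proof -
    have "U k n - hit_prob e (int k + 1) y (T n)
      \<le> (\<Sum>j\<le>n. increment (U k) j) - (\<Sum>j\<le>n. increment (U k) j * barrier l (\<epsilon> / 24) 0 (- \<bar>y\<bar>) (T n - T j))"
      unfolding sum_increment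
      using hit_prob_from_elsewhere[OF l1 l2 eps T_mono T _ T, where z = "int k + 1" and x = y] by (simp add: U_def[abs_def])
    also have "\<dots> = (\<Sum>j\<le>n. increment (U k) j * (1 - barrier l (\<epsilon> / 24) 0 (- \<bar>y\<bar>) (T n - T j)))"
      by (simp add: sum_subtractf[symmetric] right_diff_distrib)
    also have "\<dots> \<le> (\<Sum>j\<le>n. increment (U k) j * (3 * exp l * \<theta> ^ (n - j)))"
    proof (intro sum_mono mult_left_mono inc)
      fix j assume "j \<in> {..n}"
      then have d: "T n - T j = r * real (n - j)" by (simp add: T_def of_nat_diff algebra_simps)
      have "1 - barrier l (\<epsilon> / 24) 0 (- \<bar>y\<bar>) (T n - T j) \<le> 3 * exp (l - \<epsilon> / 24 * (r * real (n - j)))"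
        unfolding d y using one_minus_barrier_le[of "r * real (n - j)" l "\<epsilon> / 24" 0 "- 1"] r by simp
      also have "\<dots> = 3 * exp l * \<theta> ^ (n - j)"
        unfolding \<theta>_pow[symmetric] by (simp only: exp_add[symmetric] mult.assoc diff_conv_add_uminus)
      finally show "1 - barrier l (\<epsilon> / 24) 0 (- \<bar>y\<bar>) (T n - T j) \<le> 3 * exp l * \<theta> ^ (n - j)" .
    qed
    also have "\<dots> = 3 * exp l * discounted \<theta> (U k) n"
      by (simp add: discounted_def sum_distrib_left mult_ac)
    finally show ?thesis .
  qed

  (* the price of replacing the record by the maximum; the convolution moves the delay from the
     hitting probabilities to the barrier *)
  have survive: "U k n - occ_prob e (int k + 1) 0 (T n) \<le> 3 * discounted \<theta> (U k) n" for k n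
  proof -
    define \<Phi> where "\<Phi> j = barrier l (\<epsilon> / 24) 0 0 (r * real j)" for j
    have "(\<Sum>j\<le>n. increment (U k) j * \<Phi> (n - j)) = (\<Sum>j\<le>n. increment \<Phi> j * U k (n - j))"
      by (rule convolution_commute)
    also have "\<dots> = (\<Sum>j\<le>n. increment \<Phi> j * hit_prob e (int k + 1) 0 (T n - r * real j))"
      by (intro sum.cong refl) (simp add: U_def T_def of_nat_diff algebra_simps)
    also have "\<dots> \<le> occ_prob e (int k + 1) 0 (T n)"
      using occ_prob_after_hit[OF l1 l2 eps r T, where z = "int k + 1" and x = 0] by (simp add: \<Phi>_def[abs_def])
    finally have "U k n - occ_prob e (int k + 1) 0 (T n)
      \<le> (\<Sum>j\<le>n. increment (U k) j) - (\<Sum>j\<le>n. increment (U k) j * \<Phi> (n - j))"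
      unfolding sum_increment by simp
    also have "\<dots> = (\<Sum>j\<le>n. increment (U k) j * (1 - \<Phi> (n - j)))"
      by (simp add: sum_subtractf[symmetric] right_diff_distrib)
    also have "\<dots> \<le> (\<Sum>j\<le>n. increment (U k) j * (3 * \<theta> ^ (n - j)))"
    proof (intro sum_mono mult_left_mono inc)
      fix j
      show "1 - \<Phi> (n - j) \<le> 3 * \<theta> ^ (n - j)"
        using one_minus_barrier_le[of "r * real (n - j)" l "\<epsilon> / 24" 0 0] r \<theta>_pow[of "n - j"] by (simp add: \<Phi>_def)
    qed
    also have "\<dots> = 3 * discounted \<theta> (U k) n"
      by (simp add: discounted_def sum_distrib_left mult_ac)
    finally show ?thesis .
  qed

  define D where "D = (1 + e 0) / (1 - exp (- (1 + e 0) * r))"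
  have D: "0 \<le> D" using e_pos[of 0] r
    unfolding D_def by (intro divide_nonneg_nonneg) (auto simp: mult_le_0_iff)
  (* the Laplacian in the equation at 0 is bounded from below by the price of a neighbouring start *)
  have spread: "e 0 * (U k n * (1 - U k n)) \<le> D * (U k (Suc n) - U k n) + 3 * exp l * discounted \<theta> (U k) n" for k n
  proof -
    have "source e (hit_prob e (int k + 1)) 0 (T n) - (1 + e 0) * U k n \<le> D * (U k (Suc n) - U k n)"
      using hit_prob_step[OF T[of n] r, where x = 0 and z = "int k + 1"] by (simp add: U_def D_def T_def algebra_simps)
    moreover have "source e (hit_prob e (int k + 1)) 0 (T n) - (1 + e 0) * U k n
      = e 0 * (U k n * (1 - U k n)) - ((U k n - hit_prob e (int k + 1) 1 (T n)) + (U k n - hit_prob e (int k + 1) (- 1) (T n))) / 2"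
      by (simp add: source_def U_def power2_eq_square algebra_simps add_divide_distrib diff_divide_distrib)
    moreover have "((U k n - hit_prob e (int k + 1) 1 (T n)) + (U k n - hit_prob e (int k + 1) (- 1) (T n))) / 2
      \<le> 3 * exp l * discounted \<theta> (U k) n"
      using far[of 1 k n] far[of "-1" k n] by simp
    ultimately show ?thesis by linarith
  qed

  define G where "G = (\<Sum>k. 3 * exp (- l) ^ k)"
  have geo: "summable (\<lambda>k. 3 * exp (- l) ^ k)"
    using l2 by (intro summable_mult summable_geometric) simp
  have low: "1 - occ_prob e (- int k) 0 t \<le> 3 * exp (- l) ^ k" if "0 \<le> t" for k t
  proof -
    have "1 - occ_prob e (- int k) 0 t \<le> 1 - barrier l (\<epsilon> / 24) (- int k) 0 t"
      using occ_prob_barrier[OF l1 l2 eps that, where z = "- int k" and x = 0] by simp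
    also have "\<dots> \<le> 3 * exp (- (l * real k) - \<epsilon> / 24 * t)"
      using one_minus_barrier_le[OF that, of l "\<epsilon> / 24" "- int k" 0] by simp
    also have "\<dots> \<le> 3 * exp (- (l * real k))" using eps that by simp
    also have "exp (- (l * real k)) = exp (- l) ^ k"
      using exp_of_nat_mult[of k "- l"] by (simp add: mult.commute)
    finally show ?thesis .
  qed
  have low_summable: "summable (\<lambda>k. 1 - occ_prob e (- int k) 0 t)" if "0 \<le> t" for t
    by (rule summable_comparison_test'[OF geo]) (use low[OF that] in \<open>simp add: occ_prob_bounds\<close>)

  define C where "C = max (max (D / e 0) (3 * exp l / e 0)) (max 3 G)"
  have disc_nonneg: "0 \<le> discounted \<theta> \<rho> n" for n
  proof -
    have "0 \<le> discounted \<theta> (U k) n" for k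
      unfolding discounted_def using inc \<theta> by (intro sum_nonneg mult_nonneg_nonneg) auto
    then show ?thesis by (rule sums_le[OF _ sums_zero disc_sums[of n]])
  qed
  have rho_inc: "0 \<le> \<rho> (Suc n) - \<rho> n" for n
    unfolding \<rho>_def using mean_record_mono[OF T[of n] monoD[OF T_mono, of n "Suc n"]] by simp
  show ?thesis
  proof (rule that[of \<theta> C])
    show "0 < \<theta>" "\<theta> < 1" by fact+
    show "0 \<le> C" by (simp add: C_def)
    fix n
    have sq: "summable (\<lambda>k. U k n * (1 - U k n))"
      by (rule summable_comparison_test'[OF sums_summable[OF U_sums[of n]]]) (use U in \<open>auto simp: mult_left_le\<close>)
    have R: "(\<lambda>k. D * (U k (Suc n) - U k n) + 3 * exp l * discounted \<theta> (U k) n)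
      sums (D * (\<rho> (Suc n) - \<rho> n) + 3 * exp l * discounted \<theta> \<rho> n)"
      by (intro sums_add sums_mult sums_diff U_sums disc_sums)
    have "e 0 * (\<Sum>k. U k n * (1 - U k n)) \<le> D * (\<rho> (Suc n) - \<rho> n) + 3 * exp l * discounted \<theta> \<rho> n"
      using sums_le[OF spread sums_mult[OF summable_sums[OF sq]] R] .
    then have "(\<Sum>k. U k n * (1 - U k n)) \<le> (D * (\<rho> (Suc n) - \<rho> n) + 3 * exp l * discounted \<theta> \<rho> n) / e 0"
      using e_pos[of 0] by (simp add: pos_le_divide_eq mult.commute)
    also have "\<dots> = D / e 0 * (\<rho> (Suc n) - \<rho> n) + 3 * exp l / e 0 * discounted \<theta> \<rho> n"
      by (simp add: add_divide_distrib)
    also have "\<dots> \<le> C * (\<rho> (Suc n) - \<rho> n) + C * discounted \<theta> \<rho> n"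
      by (intro add_mono mult_right_mono rho_inc disc_nonneg) (auto simp: C_def)
    finally show "(\<Sum>k. hit_prob e (int k + 1) 0 (\<eta> + r * real n) * (1 - hit_prob e (int k + 1) 0 (\<eta> + r * real n)))
      \<le> C * (mean_record (\<eta> + r * real (Suc n)) - mean_record (\<eta> + r * real n)
          + discounted \<theta> (\<lambda>n. mean_record (\<eta> + r * real n)) n)"
      by (simp add: U_def \<rho>_def[abs_def] T_def distrib_left)
    have diff_nonneg: "0 \<le> U k n - occ_prob e (int k + 1) 0 (T n)" for k
      by (simp add: U_def occ_prob_le_hit_prob)
    have dsum: "summable (\<lambda>k. U k n - occ_prob e (int k + 1) 0 (T n))"
      by (rule summable_comparison_test'[OF sums_summable[OF U_sums[of n]]]) (use diff_nonneg occ_prob_bounds in auto)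
    have "(\<Sum>k. U k n - occ_prob e (int k + 1) 0 (T n)) \<le> 3 * discounted \<theta> \<rho> n"
      using sums_le[OF survive summable_sums[OF dsum] sums_mult[OF disc_sums]] .
    also have "\<dots> \<le> C * discounted \<theta> \<rho> n"
      by (intro mult_right_mono disc_nonneg) (simp add: C_def)
    finally show "(\<Sum>k. hit_prob e (int k + 1) 0 (\<eta> + r * real n) - occ_prob e (int k + 1) 0 (\<eta> + r * real n))
      \<le> C * discounted \<theta> (\<lambda>n. mean_record (\<eta> + r * real n)) n"
      by (simp add: U_def \<rho>_def[abs_def] T_def)
  next
    fix t :: real assume t: "0 \<le> t"
    show "summable (\<lambda>k. 1 - occ_prob e (- int k) 0 t)" by (rule low_summable[OF t])
    have "(\<Sum>k. 1 - occ_prob e (- int k) 0 t) \<le> G"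
      unfolding G_def by (rule suminf_le[OF low[OF t] low_summable[OF t] geo])
    then show "(\<Sum>k. 1 - occ_prob e (- int k) 0 t) \<le> C" by (simp add: C_def)
  qed
qed
end

section \<open>The rightmost particle\<close>

text \<open>
  Ancestors start earlier. Hence, once a generation is missing at time \<open>t\<close>, all later ones are missing as
  well, and only finitely many particles are left.
\<close>

lemma generation_downward:
  assumes "\<omega> \<in> positive_clocks" "\<And>i. 0 < e i" "segment e \<omega> u \<noteq> None" "birth e \<omega> u \<le> t" "n \<le> length u"
  shows "\<omega> \<in> generation e n t"
  using assms(3-5)
proof (induction u)
  case Nil
  then show ?case by (auto simp: generation_def intro!: exI[of _ "[]"])
next
  case (Cons b u)
  show ?case
  proof (cases "n = length (b # u)")
    case True
    then show ?thesis using Cons.prems unfolding generation_def by blast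
  next
    case False
    have u: "segment e \<omega> u \<noteq> None" using Cons.prems(1) unfolding born_Cons by blast
    have "0 < jump_clock \<omega> u" "0 < split_clock \<omega> u / e (site e \<omega> u)"
      using assms(1,2) by (auto simp: positive_clocks_def)
    then have "birth e \<omega> u \<le> birth e \<omega> (b # u)" using Cons.prems(1) unfolding birth_Cons by simp
    then show ?thesis using Cons u False by simp
  qed
qed

lemma finite_particles:
  assumes "\<omega> \<in> positive_clocks" "\<And>i. 0 < e i" "\<omega> \<notin> generation e n t"
  shows "finite (particles e \<omega> t)"
proof (rule finite_subset)
  show "particles e \<omega> t \<subseteq> {u. length u \<le> n}"
  proof (intro subsetI, rule ccontr)
    fix u assume "u \<in> particles e \<omega> t" "u \<notin> {u. length u \<le> n}"
    then show False
      using generation_downward[OF assms(1,2), where u = u and t = t and n = n] assms(3) unfolding particles_iff by simp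
  qed
  show "finite {u :: bool list. length u \<le> n}"
    using finite_lists_length_le[of "UNIV :: bool set" n] by simp
qed

lemma particles_nonempty:
  assumes "0 \<le> t" "\<omega> \<notin> generation e n t"
  shows "particles e \<omega> t \<noteq> {}"
proof
  assume empty: "particles e \<omega> t = {}"
  have "\<omega> \<in> generation e n t" for n
  proof (induction n)
    case 0
    show ?case using assms(1) by (auto simp: generation_def)
  next
    case (Suc n)
    then obtain u where u: "length u = n" "segment e \<omega> u \<noteq> None" "birth e \<omega> u \<le> t"
      unfolding generation_def by blast
    have born: "segment e \<omega> (False # u) \<noteq> None" using u(2) unfolding born_Cons by simp
    have "u \<notin> particles e \<omega> t" using empty by simp
    then have "birth e \<omega> (False # u) \<le> t"
      using u born unfolding particles_iff birth_Cons by simp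
    then show ?case using u(1) born unfolding generation_def mem_Collect_eq
      by (intro exI[of _ "False # u"]) simp
  qed
  then show False using assms(2) by blast
qed

lemma Max_infinite_eq: "\<not> finite A \<Longrightarrow> Max A = Max (UNIV :: int set)"
  using infinite_UNIV_int by (simp add: Max.infinite)

text \<open>
  \<open>Max\<close> takes one fixed value on the empty set and one on all infinite sets, so the maximum is measurable
  on the whole space and not only almost everywhere.
\<close>

lemma measurable_max_position [measurable]: "max_position e t \<in> borel_measurable clock_measure"
proof -
  define S where "S \<omega> = site e \<omega> ` particles e \<omega> t" for \<omega>
  note measurable_rate_at_site[of e e, measurable]
  have S [measurable]: "Measurable.pred clock_measure (\<lambda>\<omega>. y \<in> S \<omega>)" for y
    unfolding S_def image_iff Bex_def particles_iff by measurable
  have fin: "finite (S \<omega>) \<longleftrightarrow> (\<exists>N. \<forall>y. y \<in> S \<omega> \<longrightarrow> \<bar>y\<bar> \<le> N)" for \<omega>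
    unfolding finite_int_iff_bounded_le by auto
  have fin_meas [measurable]: "Measurable.pred clock_measure (\<lambda>\<omega>. finite (S \<omega>))"
    unfolding fin by measurable
  have Max_eq: "Max (S \<omega>) = m \<longleftrightarrow> (if finite (S \<omega>)
      then (if \<exists>y. y \<in> S \<omega> then m \<in> S \<omega> \<and> (\<forall>y. y \<in> S \<omega> \<longrightarrow> y \<le> m) else Max {} = m) else Max (UNIV :: int set) = m)" for \<omega> m
  proof (cases "finite (S \<omega>)")
    case True
    show ?thesis
    proof (cases "S \<omega> = {}")
      case False
      then have "\<exists>y. y \<in> S \<omega>" by blast
      then show ?thesis using True Max_eq_iff[OF True False, of m] by auto
    qed simp
  next
    case False
    then show ?thesis using Max_infinite_eq[OF False] by simp
  qed
  have "Measurable.pred clock_measure (\<lambda>\<omega>. Max (S \<omega>) = m)" for m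
    unfolding Max_eq by measurable
  then have "(\<lambda>\<omega>. Max (S \<omega>)) \<in> clock_measure \<rightarrow>\<^sub>M count_space UNIV"
    by (subst measurable_count_space_eq2_countable) (auto simp: pred_def vimage_def)
  then have "(\<lambda>\<omega>. real_of_int (Max (S \<omega>))) \<in> borel_measurable clock_measure"
    by measurable
  then show ?thesis by (simp add: max_position_def[abs_def] S_def)
qed

text \<open>
  An integer differs from \<open>c\<close> by the number of levels that separate the two; the negative levels are counted
  by the second summand.
\<close>

lemma layer_cake:
  fixes m :: int and c :: nat
  shows "ennreal \<bar>real_of_int m - real c\<bar>
    \<le> (\<Sum>k. ennreal (of_bool (if c \<le> k then int k + 1 \<le> m else \<not> int k + 1 \<le> m) + of_bool (\<not> - int k \<le> m)))"
proof -
  define N where "N = nat \<bar>m\<bar> + c"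
  let ?f = "\<lambda>k. of_bool (if c \<le> k then int k + 1 \<le> m else \<not> int k + 1 \<le> m) + of_bool (\<not> - int k \<le> m) :: real"
  have split: "?f k = of_bool (k \<in> {c..<nat m}) + of_bool (k \<in> {nat m..<c}) + of_bool (k \<in> {0..<nat (- m)})" for k
    by auto
  have "(\<Sum>k<N. ?f k) = real (card {c..<nat m}) + real (card {nat m..<c}) + real (card {0..<nat (- m)})"
  proof -
    have "(\<Sum>k<N. of_bool (k \<in> A)) = real (card A)" if "A \<subseteq> {..<N}" for A
      using that by (simp add: Int_absorb1)
    moreover have "{c..<nat m} \<subseteq> {..<N}" "{nat m..<c} \<subseteq> {..<N}" "{0..<nat (- m)} \<subseteq> {..<N}"
      by (auto simp: N_def)
    ultimately show ?thesis unfolding split sum.distrib by (simp only:)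
  qed
  also have "\<dots> = \<bar>real_of_int m - real c\<bar>"
    by (cases "0 \<le> m") (auto simp: of_nat_diff nat_le_iff abs_if)
  finally have "ennreal \<bar>real_of_int m - real c\<bar> = (\<Sum>k<N. ennreal (?f k))"
    by (subst sum_ennreal) auto
  also have "\<dots> \<le> (\<Sum>k. ennreal (?f k))" by (rule sum_le_suminf) auto
  finally show ?thesis .
qed

context bounded_rates
begin

lemma AE_no_explosion:
  assumes t: "0 \<le> t" shows "AE \<omega> in clock_measure. \<exists>n. \<omega> \<notin> generation e n t"
proof -
  have meas: "(\<Inter>n. generation e n t) \<in> sets clock_measure" by (intro sets.countable_INT) auto
  have "C.prob (\<Inter>n. generation e n t) \<le> ((1 + 2 * b) * t) ^ n / fact n" for n
  proof -
    have "C.prob (\<Inter>n. generation e n t) \<le> gen_prob e n 0 t"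
      unfolding gen_prob_def by (rule C.finite_measure_mono) auto
    then show ?thesis using gen_prob_le[OF t, of n 0] by simp
  qed
  then have "C.prob (\<Inter>n. generation e n t) \<le> 0"
    by (intro LIMSEQ_le_const[OF power_over_fact_tendsto_0]) blast
  then have "C.prob (\<Inter>n. generation e n t) = 0" using measure_nonneg[of clock_measure] by (simp add: antisym)
  then have "AE \<omega> in clock_measure. \<omega> \<notin> (\<Inter>n. generation e n t)"
    by (subst (asm) C.prob_eq_0[OF meas])
  then show ?thesis by simp
qed

lemma AE_max_position:
  assumes t: "0 \<le> t"
  shows "AE \<omega> in clock_measure. \<exists>m :: int. max_position e t \<omega> = real_of_int m \<and> (\<forall>z. z \<le> m \<longleftrightarrow> \<omega> \<in> occupied e z t)"
  using AE_no_explosion[OF t] AE_positive_clocks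
proof eventually_elim
  case (elim \<omega>)
  then obtain n where n: "\<omega> \<notin> generation e n t" by blast
  have fin: "finite (site e \<omega> ` particles e \<omega> t)" using finite_particles[OF elim(2) e_pos n] by simp
  have ne: "site e \<omega> ` particles e \<omega> t \<noteq> {}" using particles_nonempty[OF t n] by simp
  show ?case
    by (intro exI[of _ "Max (site e \<omega> ` particles e \<omega> t)"])
       (auto simp: max_position_def Max_ge_iff[OF fin ne] occupied_def)
qed

text \<open>
  Take for \<open>c\<close> the median of the record. A level \<open>k\<close> separates the maximum from \<open>c\<close> with a probability of at
  most \<open>min U (1 - U) + (U - F)\<close>, and \<open>min U (1 - U) \<le> 2 * U * (1 - U)\<close>.
\<close>

lemma max_position_near_median:
  assumes t: "0 \<le> t"
    and low: "summable (\<lambda>k. 1 - occ_prob e (- int k) 0 t)"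
  shows "\<exists>c. (\<integral>\<^sup>+ \<omega>. ennreal \<bar>max_position e t \<omega> - c\<bar> \<partial>clock_measure)
    \<le> ennreal (2 * (\<Sum>k. hit_prob e (int k + 1) 0 t * (1 - hit_prob e (int k + 1) 0 t))
      + (\<Sum>k. hit_prob e (int k + 1) 0 t - occ_prob e (int k + 1) 0 t)
      + (\<Sum>k. 1 - occ_prob e (- int k) 0 t))"
proof -
  define U where "U k = hit_prob e (int k + 1) 0 t" for k
  define F where "F k = occ_prob e (int k + 1) 0 t" for k
  define L where "L k = 1 - occ_prob e (- int k) 0 t" for k
  have U: "0 \<le> U k" "U k \<le> 1" for k by (auto simp: U_def hit_prob_bounds)
  have F: "0 \<le> F k" "F k \<le> U k" for k by (auto simp: F_def U_def occ_prob_bounds occ_prob_le_hit_prob)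
  have L: "0 \<le> L k" for k by (simp add: L_def occ_prob_bounds)
  have U_summable: "summable U"
    using summable_hit_prob[OF t] by (simp add: U_def[abs_def])
  have "\<exists>k. U k < 1 / 2"
    using LIMSEQ_iff[THEN iffD1, OF summable_LIMSEQ_zero[OF U_summable], rule_format, of "1 / 2"] U by force
  define c where "c = (LEAST k. U k < 1 / 2)"
  have below: "1 / 2 \<le> U k" if "k < c" for k
    using not_less_Least[of k "\<lambda>k. U k < 1 / 2"] that by (simp add: c_def not_less)
  have above: "U k \<le> 1 / 2" if "c \<le> k" for k
  proof -
    have "U k \<le> U c" using that unfolding U_def by (intro hit_prob_antimono) simp
    also have "U c < 1 / 2" unfolding c_def using \<open>\<exists>k. U k < 1 / 2\<close> by (rule LeastI_ex)
    finally show ?thesis by simp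
  qed
  define w where "w k = (if c \<le> k then F k else 1 - F k) + L k" for k
  have w: "0 \<le> w k" for k using F[of k] U[of k] L[of k] by (auto simp: w_def)
  define q where "q k = 2 * (U k * (1 - U k)) + (U k - F k) + L k" for k
  have wq: "w k \<le> q k" for k
  proof (cases "c \<le> k")
    case True
    have "U k * 1 \<le> U k * (2 * (1 - U k))" using above[OF True] U[of k] by (intro mult_left_mono) auto
    then have "U k \<le> 2 * (U k * (1 - U k))" by (simp only: mult_1_right mult.left_commute[of "U k" 2])
    then show ?thesis using True F[of k] unfolding w_def q_def by simp
  next
    case False
    have "1 * (1 - U k) \<le> (2 * U k) * (1 - U k)" using below[of k] False U[of k] by (intro mult_right_mono) auto
    then have "1 - U k \<le> 2 * (U k * (1 - U k))" by (simp only: mult_1_left mult.assoc)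
    then show ?thesis using False unfolding w_def q_def by simp
  qed
  have s1: "summable (\<lambda>k. U k * (1 - U k))"
    by (rule summable_comparison_test'[OF U_summable]) (use U in \<open>auto simp: mult_left_le\<close>)
  have s2: "summable (\<lambda>k. U k - F k)"
    by (rule summable_comparison_test'[OF U_summable]) (use F in auto)
  have s3: "summable L" using low by (simp add: L_def[abs_def])
  have q_sums: "q sums (2 * (\<Sum>k. U k * (1 - U k)) + (\<Sum>k. U k - F k) + (\<Sum>k. L k))"
    unfolding q_def by (intro sums_add sums_mult summable_sums s1 s2 s3)
  define X where "X k \<omega> = ennreal (of_bool (if c \<le> k then \<omega> \<in> occupied e (int k + 1) t else \<omega> \<notin> occupied e (int k + 1) t)
      + of_bool (\<omega> \<notin> occupied e (- int k) t))" for k \<omega>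
  have occ_pred [measurable]: "Measurable.pred clock_measure (\<lambda>\<omega>. \<omega> \<in> occupied e z t)" for z
    using sets_occupied[of e z t] by (simp add: pred_def)
  have "(\<integral>\<^sup>+ \<omega>. ennreal \<bar>max_position e t \<omega> - real c\<bar> \<partial>clock_measure) \<le> (\<integral>\<^sup>+ \<omega>. (\<Sum>k. X k \<omega>) \<partial>clock_measure)"
  proof (rule nn_integral_mono_AE)
    show "AE \<omega> in clock_measure. ennreal \<bar>max_position e t \<omega> - real c\<bar> \<le> (\<Sum>k. X k \<omega>)"
      using AE_max_position[OF t]
    proof eventually_elim
      case (elim \<omega>)
      then obtain m :: int where m: "max_position e t \<omega> = real_of_int m" "\<And>z. z \<le> m \<longleftrightarrow> \<omega> \<in> occupied e z t" by blast
      show ?case using layer_cake[of m c] unfolding m(1) X_def m(2) .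
    qed
  qed
  also have "\<dots> = (\<Sum>k. \<integral>\<^sup>+ \<omega>. X k \<omega> \<partial>clock_measure)"
    by (rule nn_integral_suminf) (simp add: X_def)
  also have "\<dots> = (\<Sum>k. ennreal (w k))"
  proof (intro suminf_cong)
    fix k
    have i1: "(\<integral>\<^sup>+ \<omega>. ennreal (of_bool (\<omega> \<in> occupied e z t)) \<partial>clock_measure) = ennreal (occ_prob e z 0 t)" for z
    proof -
      have "(\<integral>\<^sup>+ \<omega>. ennreal (of_bool (\<omega> \<in> occupied e z t)) \<partial>clock_measure) = (\<integral>\<^sup>+ \<omega>. indicator (occupied e z t) \<omega> \<partial>clock_measure)"
        by (intro nn_integral_cong) (simp add: indicator_def)
      then show ?thesis by (simp add: occ_prob_def C.emeasure_eq_measure)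
    qed
    have i2: "(\<integral>\<^sup>+ \<omega>. ennreal (of_bool (\<omega> \<notin> occupied e z t)) \<partial>clock_measure) = ennreal (1 - occ_prob e z 0 t)" for z
    proof -
      have "(\<integral>\<^sup>+ \<omega>. ennreal (of_bool (\<omega> \<notin> occupied e z t)) \<partial>clock_measure)
          = (\<integral>\<^sup>+ \<omega>. indicator (space clock_measure - occupied e z t) \<omega> \<partial>clock_measure)"
        by (intro nn_integral_cong) (simp add: indicator_def)
      also have "\<dots> = emeasure clock_measure (space clock_measure - occupied e z t)"
        by (rule nn_integral_indicator) (intro sets.compl_sets sets_occupied)
      finally show ?thesis using C.prob_compl[OF sets_occupied[of e z t]]
        by (simp add: occ_prob_def C.emeasure_eq_measure)
    qed
    have "(\<integral>\<^sup>+ \<omega>. X k \<omega> \<partial>clock_measure)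
      = (\<integral>\<^sup>+ \<omega>. ennreal (of_bool (if c \<le> k then \<omega> \<in> occupied e (int k + 1) t else \<omega> \<notin> occupied e (int k + 1) t)) \<partial>clock_measure)
       + (\<integral>\<^sup>+ \<omega>. ennreal (of_bool (\<omega> \<notin> occupied e (- int k) t)) \<partial>clock_measure)"
      unfolding X_def by (subst nn_integral_add[symmetric]) (auto intro!: nn_integral_cong)
    also have "\<dots> = ennreal (w k)"
      unfolding i2 using i1 i2 F[of k] U[of k] L[of k]
      by (cases "c \<le> k") (simp_all add: w_def F_def L_def ennreal_plus[symmetric] occ_prob_bounds del: ennreal_plus)
    finally show "(\<integral>\<^sup>+ \<omega>. X k \<omega> \<partial>clock_measure) = ennreal (w k)" .
  qed
  also have "\<dots> \<le> (\<Sum>k. ennreal (q k))"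
    by (intro suminf_le summableI ennreal_leI wq)
  also have "\<dots> = ennreal (2 * (\<Sum>k. U k * (1 - U k)) + (\<Sum>k. U k - F k) + (\<Sum>k. L k))"
    using q_sums order_trans[OF w wq] by (subst suminf_ennreal2) (auto simp: sums_iff)
  finally show ?thesis unfolding U_def F_def L_def by blast
qed
end

text \<open>
  Passes from a median to the mean: the two differ by at most \<open>B\<close>, so the mean distance at most doubles, and
  Markov's inequality applies.
\<close>

lemma (in prob_space) deviation_from_mean:
  fixes X :: "'a \<Rightarrow> real"
  assumes X [measurable]: "X \<in> borel_measurable M"
    and c: "(\<integral>\<^sup>+ \<omega>. ennreal \<bar>X \<omega> - c\<bar> \<partial>M) \<le> ennreal B" and B: "0 \<le> B" and K: "0 < K"
  shows "prob {\<omega> \<in> space M. K \<le> \<bar>X \<omega> - expectation X\<bar>} \<le> 2 * B / K"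
proof -
  have int: "integrable M (\<lambda>\<omega>. X \<omega> - c)"
    unfolding integrable_iff_bounded using c by (auto simp: le_less_trans)
  have intX: "integrable M X"
    using Bochner_Integration.integrable_add[OF int, of "\<lambda>_. c"] by simp
  have "ennreal (expectation (\<lambda>\<omega>. \<bar>X \<omega> - c\<bar>)) \<le> ennreal B"
    using c by (subst nn_integral_eq_integral[symmetric]) (auto intro: integrable_abs int)
  then have 1: "expectation (\<lambda>\<omega>. \<bar>X \<omega> - c\<bar>) \<le> B" using B by simp
  have "expectation X - c = expectation (\<lambda>\<omega>. X \<omega> - c)"
    using intX by (simp add: prob_space)
  then have 2: "\<bar>expectation X - c\<bar> \<le> B"
    using order_trans[OF integral_abs_bound 1] by simp
  have intE: "integrable M (\<lambda>\<omega>. \<bar>X \<omega> - expectation X\<bar>)" using intX by simp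
  have "expectation (\<lambda>\<omega>. \<bar>X \<omega> - expectation X\<bar>) \<le> expectation (\<lambda>\<omega>. \<bar>X \<omega> - c\<bar> + B)"
    using int 2 intE by (intro integral_mono) auto
  also have "\<dots> = expectation (\<lambda>\<omega>. \<bar>X \<omega> - c\<bar>) + B"
    using int by (simp add: prob_space)
  finally have 3: "expectation (\<lambda>\<omega>. \<bar>X \<omega> - expectation X\<bar>) \<le> 2 * B" using 1 by simp
  have "prob {\<omega> \<in> space M. K \<le> \<bar>X \<omega> - expectation X\<bar>} \<le> expectation (\<lambda>\<omega>. \<bar>X \<omega> - expectation X\<bar>) / K"
    by (rule integral_Markov_inequality_measure[where A = "{}"]) (use intE K in auto)
  also have "\<dots> \<le> 2 * B / K" using 3 K by (simp add: divide_right_mono)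
  finally show ?thesis .
qed

section \<open>Times of slow growth and tightness\<close>

text \<open>
  Holds because \<open>discounted \<theta> f\<close> solves \<open>d (n + 1) = \<theta> * d n + increment f (n + 1)\<close>.
\<close>

lemma sum_discounted:
  "(1 - \<theta>) * (\<Sum>n\<le>N. discounted \<theta> f n) + \<theta> * discounted \<theta> f N = f N"
proof (induction N)
  case 0
  then show ?case by (simp add: discounted_def increment_def algebra_simps)
next
  case (Suc N)
  have "discounted \<theta> f (Suc N) = (\<Sum>j\<le>N. increment f j * \<theta> ^ (Suc N - j)) + increment f (Suc N)"
    by (simp add: discounted_def)
  also have "(\<Sum>j\<le>N. increment f j * \<theta> ^ (Suc N - j)) = \<theta> * discounted \<theta> f N"
    by (simp add: discounted_def sum_distrib_left Suc_diff_le mult_ac)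
  finally have "discounted \<theta> f (Suc N) = \<theta> * discounted \<theta> f N + (f (Suc N) - f N)"
    by (simp add: increment_def)
  then show ?case using Suc by (simp add: algebra_simps)
qed

text \<open>
  By linear growth, the sum of the quantity in question over \<open>n \<le> N\<close> is of order \<open>N\<close>, so by
  Markov's inequality it exceeds \<open>K\<close> for at most the fraction \<open>\<delta> / (1 + \<delta>)\<close> of all \<open>n\<close> when \<open>K\<close> is
  large. The \<open>k\<close>-th remaining index is then at most about \<open>(1 + \<delta>) * k\<close>.
\<close>

lemma slow_times:
  fixes \<rho> :: "nat \<Rightarrow> real"
  assumes \<theta>: "0 < \<theta>" "\<theta> < 1" and \<rho>: "mono \<rho>" "\<And>n. 0 \<le> \<rho> n" "\<And>n. \<rho> n \<le> C * (real n + 1)"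
    and \<delta>: "0 < \<delta>"
  obtains s K where "strict_mono s" "\<And>k. 1 \<le> s k" "0 \<le> K"
    "\<And>k. \<rho> (Suc (s k)) - \<rho> (s k) + discounted \<theta> \<rho> (s k) \<le> K"
    "\<And>k. real (s k) \<le> (1 + \<delta>) * (real k + 2)"
proof -
  define w where "w n = \<rho> (Suc n) - \<rho> n + discounted \<theta> \<rho> n" for n
  have disc: "0 \<le> discounted \<theta> \<rho> n" for n
    unfolding discounted_def using \<theta> increment_nonneg[OF \<rho>(1,2)]
    by (intro sum_nonneg mult_nonneg_nonneg) auto
  have w: "0 \<le> w n" for n
    unfolding w_def using disc[of n] monoD[OF \<rho>(1), of n "Suc n"] by simp
  have C: "0 \<le> C" using \<rho>(2)[of 0] \<rho>(3)[of 0] by simp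
  (* 2 * C from the increments, C / (1 - theta) from the discounted growth *)
  define C0 where "C0 = 2 * C + C / (1 - \<theta>)"
  have C0: "0 \<le> C0" using C \<theta> by (simp add: C0_def)
  have sum_w: "(\<Sum>n\<le>N. w n) \<le> C0 * (real N + 1)" for N
  proof -
    have tel: "(\<Sum>n\<le>N. \<rho> (Suc n) - \<rho> n) = \<rho> (Suc N) - \<rho> 0"
      by (induction N) auto
    have "(1 - \<theta>) * (\<Sum>n\<le>N. discounted \<theta> \<rho> n) \<le> C * (real N + 1)"
      using sum_discounted[of \<theta> \<rho> N] \<theta> disc[of N] \<rho>(3)[of N] mult_nonneg_nonneg[of \<theta> "discounted \<theta> \<rho> N"] by linarith
    then have "(\<Sum>n\<le>N. discounted \<theta> \<rho> n) \<le> C * (real N + 1) / (1 - \<theta>)"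
      using \<theta> by (simp add: pos_le_divide_eq mult.commute)
    moreover have "C * (real (Suc N) + 1) \<le> C * (2 * (real N + 1))"
      using C by (intro mult_left_mono) auto
    then have "\<rho> (Suc N) \<le> 2 * C * (real N + 1)"
      using \<rho>(3)[of "Suc N"] by (simp only: mult.assoc mult.left_commute[of C 2])
    ultimately show ?thesis
      using \<rho>(2)[of 0] by (simp add: w_def sum.distrib tel C0_def distrib_right)
  qed
  define \<epsilon> where "\<epsilon> = \<delta> / (1 + \<delta>)"
  have eps: "0 < \<epsilon>" "\<epsilon> < 1" "(1 + \<delta>) * (1 - \<epsilon>) = 1" using \<delta> by (auto simp: \<epsilon>_def field_simps)
  define K where "K = C0 / \<epsilon> + 1"
  have K: "0 < K" "C0 \<le> \<epsilon> * K" using C0 eps by (auto simp: K_def field_simps intro!: add_nonneg_pos)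
  define S where "S = {n. 1 \<le> n \<and> w n \<le> K}"
  have count: "real N - \<epsilon> * (real N + 1) \<le> real (card {n \<in> S. n \<le> N})" for N
  proof -
    define Bad where "Bad = {n \<in> {1..N}. K < w n}"
    have "real (card Bad) * K = (\<Sum>n\<in>Bad. K)" by simp
    also have "\<dots> \<le> (\<Sum>n\<in>Bad. w n)" by (intro sum_mono) (auto simp: Bad_def)
    also have "\<dots> \<le> (\<Sum>n\<le>N. w n)" by (intro sum_mono2 w) (auto simp: Bad_def)
    also have "\<dots> \<le> C0 * (real N + 1)" by (rule sum_w)
    also have "\<dots> \<le> (\<epsilon> * K) * (real N + 1)" using K(2) by (intro mult_right_mono) auto
    finally have "real (card Bad) * K \<le> (\<epsilon> * (real N + 1)) * K" by (simp only: mult_ac)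
    then have "real (card Bad) \<le> \<epsilon> * (real N + 1)" using K(1) by simp
    moreover have "{n \<in> S. n \<le> N} \<union> Bad = {1..N}" "{n \<in> S. n \<le> N} \<inter> Bad = {}"
      by (auto simp: S_def Bad_def)
    then have "card {n \<in> S. n \<le> N} + card Bad = N"
      by (subst card_Un_disjoint[symmetric]) (auto simp: Bad_def)
    ultimately show ?thesis by linarith
  qed
  have "infinite S"
  proof
    assume fin: "finite S"
    define N where "N = nat \<lceil>(real (card S) + 1) / (1 - \<epsilon>)\<rceil>"
    have "(real (card S) + 1) / (1 - \<epsilon>) \<le> real N" unfolding N_def by (rule real_nat_ceiling_ge)
    then have "real (card S) + 1 \<le> real N * (1 - \<epsilon>)" using eps by (simp add: pos_divide_le_eq)
    moreover have "real (card {n \<in> S. n \<le> N}) \<le> real (card S)" using fin by (intro of_nat_mono card_mono) auto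
    ultimately show False using count[of N] eps by (simp add: algebra_simps)
  qed
  define s where "s = enumerate S"
  have s_mono: "strict_mono s" unfolding s_def by (rule strict_mono_enumerate[OF \<open>infinite S\<close>])
  have s_in: "s k \<in> S" for k unfolding s_def by (rule enumerate_in_set[OF \<open>infinite S\<close>])
  have bound: "real (s k) \<le> (1 + \<delta>) * (real k + 2)" for k
  proof -
    have "{n \<in> S. n \<le> s k} \<subseteq> s ` {..k}"
    proof
      fix n assume n: "n \<in> {n \<in> S. n \<le> s k}"
      then obtain i where "n = s i" using range_enumerate[OF \<open>infinite S\<close>] by (auto simp: s_def)
      then show "n \<in> s ` {..k}" using n strict_mono_less_eq[OF s_mono] by auto
    qed
    then have "card {n \<in> S. n \<le> s k} \<le> card (s ` {..k})" by (intro card_mono) auto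
    also have "\<dots> \<le> Suc k" using card_image_le[of "{..k}" s] by simp
    finally have "real (s k) - \<epsilon> * (real (s k) + 1) \<le> real k + 1" using count[of "s k"] by linarith
    then have "real (s k) * (1 - \<epsilon>) \<le> real k + 2" using eps by (simp add: algebra_simps)
    then have "(1 + \<delta>) * (real (s k) * (1 - \<epsilon>)) \<le> (1 + \<delta>) * (real k + 2)"
      using \<delta> by (intro mult_left_mono) auto
    moreover have "(1 + \<delta>) * (real (s k) * (1 - \<epsilon>)) = real (s k) * ((1 + \<delta>) * (1 - \<epsilon>))" by (simp only: mult_ac)
    ultimately show ?thesis using eps(3) by simp
  qed
  show ?thesis
    by (rule that[of s K]) (use s_mono s_in bound K(1) in \<open>auto simp: S_def w_def intro: less_imp_le\<close>)
qed

context bounded_rates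
begin

lemma tight_along_slow_times:
  assumes L: "L \<ge> (1 :: nat)" and \<eta>: "0 \<le> \<eta>" and \<delta>: "0 < \<delta>"
  shows "\<exists>t :: nat \<Rightarrow> real. strict_mono t \<and> range t \<subseteq> time_grid L \<eta> \<and>
      limsup (\<lambda>k. ereal (t k / real (Suc k))) \<le> ereal ((1 + \<delta>) / real L) \<and>
      tight (\<lambda>k. distr clock_measure borel (\<lambda>\<omega>. max_position e (t k) \<omega> - mean_max_position e (t k)))"
proof -
  define r where "r = 1 / real L"
  have r: "0 < r" using L by (simp add: r_def)
  obtain \<theta> C where \<theta>: "0 < \<theta>" "\<theta> < 1" and C: "0 \<le> C"
    and spread: "\<And>n. (\<Sum>k. hit_prob e (int k + 1) 0 (\<eta> + r * real n) * (1 - hit_prob e (int k + 1) 0 (\<eta> + r * real n)))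
      \<le> C * (mean_record (\<eta> + r * real (Suc n)) - mean_record (\<eta> + r * real n)
          + discounted \<theta> (\<lambda>n. mean_record (\<eta> + r * real n)) n)"
    and deficit: "\<And>n. (\<Sum>k. hit_prob e (int k + 1) 0 (\<eta> + r * real n) - occ_prob e (int k + 1) 0 (\<eta> + r * real n))
      \<le> C * discounted \<theta> (\<lambda>n. mean_record (\<eta> + r * real n)) n"
    and low: "\<And>t. 0 \<le> t \<Longrightarrow> summable (\<lambda>k. 1 - occ_prob e (- int k) 0 t)"
      "\<And>t. 0 \<le> t \<Longrightarrow> (\<Sum>k. 1 - occ_prob e (- int k) 0 t) \<le> C"
    by (rule record_estimates[OF r \<eta>], rule that)
  define \<rho> where "\<rho> n = mean_record (\<eta> + r * real n)" for n
  have T: "0 \<le> \<eta> + r * real n" for n using r \<eta> by simp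
  have \<rho>: "mono \<rho>" "0 \<le> \<rho> n" for n
    unfolding \<rho>_def using r by (auto intro!: monoI mean_record_mono mean_record_nonneg T)
  define A where "A = (2 + b) * (\<eta> + r) + (1 + (\<Sum>k. exp (- 1 :: real) ^ Suc k))"
  have "\<rho> n \<le> A * (real n + 1)" for n
  proof -
    have "0 \<le> (\<Sum>k. exp (- 1 :: real) ^ Suc k)"
      by (intro suminf_nonneg summable_Suc_iff[THEN iffD2] summable_geometric) auto
    then have 1: "1 + (\<Sum>k. exp (- 1 :: real) ^ Suc k) \<le> (1 + (\<Sum>k. exp (- 1 :: real) ^ Suc k)) * (real n + 1)"
      by (simp add: mult_le_cancel_left1)
    have "\<eta> + r * real n \<le> (\<eta> + r) * (real n + 1)" using r \<eta> by (simp add: algebra_simps)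
    then have "(2 + b) * (\<eta> + r * real n) \<le> (2 + b) * ((\<eta> + r) * (real n + 1))"
      using b_pos by (intro mult_left_mono) auto
    with 1 mean_record_linear[OF T[of n]] show ?thesis
      by (simp add: \<rho>_def A_def distrib_right mult.assoc)
  qed
  from slow_times[OF \<theta> \<rho> this \<delta>]
  obtain s K where s: "strict_mono s" "\<And>k. 1 \<le> s k" and K: "0 \<le> K"
    and slow: "\<And>k. \<rho> (Suc (s k)) - \<rho> (s k) + discounted \<theta> \<rho> (s k) \<le> K"
    and dense: "\<And>k. real (s k) \<le> (1 + \<delta>) * (real k + 2)" by blast
  define t where "t k = \<eta> + r * real (s k)" for k
  have t: "0 \<le> t k" for k using T by (simp add: t_def)
  define B where "B = 2 * (C * K) + C * K + C"
  have B: "0 \<le> B" using C K by (simp add: B_def)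
  have near: "\<exists>c. (\<integral>\<^sup>+ \<omega>. ennreal \<bar>max_position e (t k) \<omega> - c\<bar> \<partial>clock_measure) \<le> ennreal B" for k
  proof -
    have inc: "0 \<le> \<rho> (Suc (s k)) - \<rho> (s k)" using monoD[OF \<rho>(1), of "s k" "Suc (s k)"] by simp
    have "C * (\<rho> (Suc (s k)) - \<rho> (s k) + discounted \<theta> \<rho> (s k)) \<le> C * K"
      using slow C by (intro mult_left_mono) auto
    moreover have "C * discounted \<theta> \<rho> (s k) \<le> C * K"
      using slow[of k] inc C by (intro mult_left_mono) auto
    ultimately have "2 * (\<Sum>j. hit_prob e (int j + 1) 0 (t k) * (1 - hit_prob e (int j + 1) 0 (t k)))
      + (\<Sum>j. hit_prob e (int j + 1) 0 (t k) - occ_prob e (int j + 1) 0 (t k))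
      + (\<Sum>j. 1 - occ_prob e (- int j) 0 (t k)) \<le> B"
      using spread[of "s k"] deficit[of "s k"] low(2)[OF t[of k]]
      unfolding B_def t_def \<rho>_def[abs_def] by linarith
    then show ?thesis
      using max_position_near_median[OF t[of k] low(1)[OF t[of k]]] by (meson ennreal_leI order_trans)
  qed
  have dev: "C.prob {\<omega> \<in> space clock_measure. M \<le> \<bar>max_position e (t k) \<omega> - mean_max_position e (t k)\<bar>} \<le> 2 * B / M"
    if "0 < M" for k M
    using near[of k] C.deviation_from_mean[OF measurable_max_position _ B that] unfolding mean_max_position_def by blast
  define X where "X k \<omega> = max_position e (t k) \<omega> - mean_max_position e (t k)" for k \<omega>
  have X [measurable]: "X k \<in> borel_measurable clock_measure" for k
    unfolding X_def by measurable
  have tight: "tight (\<lambda>k. distr clock_measure borel (X k))"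
    unfolding tight_def
  proof (intro conjI allI impI)
    show "real_distribution (distr clock_measure borel (X k))" for k
      by (rule C.real_distribution_distr) measurable
    fix \<epsilon> :: real assume \<epsilon>: "0 < \<epsilon>"
    define M where "M = 2 * B / \<epsilon> + 1"
    have M: "0 < M" "2 * B / M < \<epsilon>" using B \<epsilon> by (auto simp: M_def field_simps intro!: add_nonneg_pos)
    have "1 - \<epsilon> < measure (distr clock_measure borel (X k)) {- M<..M}" for k
    proof -
      have bad: "{\<omega> \<in> space clock_measure. M \<le> \<bar>X k \<omega>\<bar>} \<in> sets clock_measure" by measurable
      have "1 - 2 * B / M \<le> 1 - C.prob {\<omega> \<in> space clock_measure. M \<le> \<bar>X k \<omega>\<bar>}"
        using dev[OF M(1), of k] by (simp add: X_def)
      also have "\<dots> = C.prob (space clock_measure - {\<omega> \<in> space clock_measure. M \<le> \<bar>X k \<omega>\<bar>})"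
        by (rule C.prob_compl[OF bad, symmetric])
      also have "\<dots> \<le> C.prob (X k -` {- M<..M} \<inter> space clock_measure)"
        by (intro C.finite_measure_mono measurable_sets[OF X]) auto
      also have "\<dots> = measure (distr clock_measure borel (X k)) {- M<..M}"
        by (rule measure_distr[symmetric]) auto
      finally show ?thesis using M(2) by linarith
    qed
    then show "\<exists>a b. a < b \<and> (\<forall>k. 1 - \<epsilon> < measure (distr clock_measure borel (X k)) {a<..b})"
      using M(1) by (intro exI[of _ "- M"] exI[of _ M]) auto
  qed
  have mono: "strict_mono t"
    using s(1) r by (auto simp: t_def strict_mono_def)
  have grid: "range t \<subseteq> time_grid L \<eta>"
    using s(2) by (auto simp: t_def time_grid_def r_def add.commute)
  have lim: "limsup (\<lambda>k. ereal (t k / real (Suc k))) \<le> ereal ((1 + \<delta>) / real L)"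
  proof -
    define R where "R = \<eta> + r * (1 + \<delta>)"
    have le: "t k / real (Suc k) \<le> (1 + \<delta>) / real L + R / real (Suc k)" for k
    proof -
      have "t k \<le> \<eta> + r * ((1 + \<delta>) * (real k + 2))"
        unfolding t_def using dense[of k] r by (intro add_left_mono mult_left_mono) auto
      also have "\<dots> = r * (1 + \<delta>) * real (Suc k) + R"
        by (simp add: R_def algebra_simps)
      also have "r * (1 + \<delta>) = (1 + \<delta>) / real L"
        by (simp add: r_def)
      finally have "t k / real (Suc k) \<le> ((1 + \<delta>) / real L * real (Suc k) + R) / real (Suc k)"
        by (intro divide_right_mono) auto
      then show ?thesis by (simp add: add_divide_distrib del: of_nat_Suc)
    qed
    have "(\<lambda>k. (1 + \<delta>) / real L + R * (1 / real (Suc k))) \<longlonglongrightarrow> (1 + \<delta>) / real L + R * 0"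
      by (intro tendsto_intros) (use LIMSEQ_inverse_real_of_nat in \<open>simp add: inverse_eq_divide\<close>)
    then have "(\<lambda>k. ereal ((1 + \<delta>) / real L + R / real (Suc k))) \<longlonglongrightarrow> ereal ((1 + \<delta>) / real L)"
      by simp
    then have "limsup (\<lambda>k. ereal ((1 + \<delta>) / real L + R / real (Suc k))) = ereal ((1 + \<delta>) / real L)"
      by (intro lim_imp_Limsup) auto
    moreover have "limsup (\<lambda>k. ereal (t k / real (Suc k))) \<le> limsup (\<lambda>k. ereal ((1 + \<delta>) / real L + R / real (Suc k)))"
      using le by (intro Limsup_mono always_eventually) auto
    ultimately show ?thesis by simp
  qed
  show ?thesis
    using mono grid lim tight unfolding X_def by blast
qed
end

theorem theorem2:
  fixes P :: "'w measure" and \<xi> :: "int \<Rightarrow> 'w \<Rightarrow> real"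
    and L :: nat and \<eta> \<delta> :: real
  assumes "prob_space P"
    and "prob_space.indep_vars P (\<lambda>_. borel) \<xi> UNIV"
    and "\<And>x. distr P borel (\<xi> x) = distr P borel (\<xi> 0)"
    and "0 < essinf P (\<lambda>w. ereal (\<xi> 0 w))"
    and "essinf P (\<lambda>w. ereal (\<xi> 0 w)) < esssup P (\<lambda>w. ereal (\<xi> 0 w))"
    and "esssup P (\<lambda>w. ereal (\<xi> 0 w)) < \<infinity>"
    and "L \<ge> 1" and "0 \<le> \<eta>" and "\<eta> < 1 / real L" and "\<delta> > 0"
  shows "AE w in P. \<exists>t :: nat \<Rightarrow> real.
      strict_mono t \<and> range t \<subseteq> time_grid L \<eta> \<and>
      limsup (\<lambda>k. ereal (t k / real (Suc k))) \<le> ereal ((1 + \<delta>) / real L) \<and>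
      tight (\<lambda>k. distr clock_measure borel
        (\<lambda>\<omega>. max_position (\<lambda>x. \<xi> x w) (t k) \<omega> - mean_max_position (\<lambda>x. \<xi> x w) (t k)))"
proof -
  interpret P: prob_space P by fact
  have meas [measurable]: "\<xi> x \<in> borel_measurable P" for x
    using assms(2) by (auto simp: P.indep_vars_def)
  have meas0: "(\<lambda>w. ereal (\<xi> 0 w)) \<in> borel_measurable P" by measurable
  obtain a where a: "0 < ereal a" "ereal a < essinf P (\<lambda>w. ereal (\<xi> 0 w))"
    using ereal_dense2[OF assms(4)] by blast
  obtain b where b: "esssup P (\<lambda>w. ereal (\<xi> 0 w)) < ereal b"
    using ereal_dense2[OF assms(6)] by blast
  have "AE w in P. ereal a < ereal (\<xi> 0 w)"
    using less_LiminfD[of "ereal a" "ae_filter P" "\<lambda>w. ereal (\<xi> 0 w)"] a(2) meas0 by (simp add: essinf_def)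
  moreover have "AE w in P. ereal (\<xi> 0 w) \<le> esssup P (\<lambda>w. ereal (\<xi> 0 w))" by (rule esssup_AE)
  ultimately have "AE w in P. \<xi> 0 w \<in> {a..b}"
    by eventually_elim (use b in \<open>auto dest: order.strict_trans1\<close>)
  then have "AE y in distr P borel (\<xi> 0). y \<in> {a..b}"
    by (subst AE_distr_iff) auto
  then have "AE y in distr P borel (\<xi> x). y \<in> {a..b}" for x
    by (subst assms(3))
  then have "AE w in P. \<xi> x w \<in> {a..b}" for x
    by (subst (asm) AE_distr_iff) auto
  then have "AE w in P. \<forall>x. \<xi> x w \<in> {a..b}" by (simp add: AE_all_countable)
  then show ?thesis
  proof eventually_elim
    case (elim w)
    interpret bounded_rates "\<lambda>x. \<xi> x w" a b
      by unfold_locales (use elim a(1) in auto)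
    show ?case by (rule tight_along_slow_times[OF assms(7,8,10)])
  qed
qed

end
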